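(* Let $d \ge 4$, let $a \in \mathbb{R}^d$ with $a \neq 0$, let $\sigma_X^2, \sigma_Y^2 > 0$, and let $\mathcal{L}_1, \mathcal{L}_2$ be cdfs on $\mathbb{R}$, all known. For unknown $\theta \in \mathbb{R}^d$, let $X|\theta \sim MMN_d(\theta, a, \sigma_X^2 I_d, \mathcal{L}_1)$ and $Y|\theta \sim MMN_d(\theta, a, \sigma_Y^2 I_d, \mathcal{L}_2)$ be independently distributed. Let $H = \begin{pmatrix} h_1^{\top} \\ H_2 \end{pmatrix}$ be a $d \times d$ orthogonal matrix with $h_1 = a/\|a\|$. Let $\pi(\theta) = \pi_0(H_2 \theta)$ be a prior density (with respect to Lebesgue measure on $\mathbb{R}^d$), where $\pi_0$ is a (possibly improper) density on $\mathbb{R}^{d-1}$ other than the uniform density, and let $$ m_{\pi_0}(z,\sigma^2) = \int_{\mathbb{R}^{d-1}} \phi_{d-1}(z - \zeta_{(2)}; \sigma^2 I_{d-1})\, \pi_0(\zeta_{(2)})\, d\zeta_{(2)}, \quad z \in \mathbb{R}^{d-1}. $$ Suppose that $m_{\pi_0}(z, \sigma_X^2)$ is finite for all $z \in \mathbb{R}^{d-1}$. Then each of the following conditions is sufficient for the Bayes predictive density $\hat{q}_\pi(\cdot;X)$ of $Y$ associated with the prior $\pi$ to dominate the minimum risk equivariant (MRE) predictive density $\hat{q}_U$ under Kullback-Leibler risk: (i) $\Delta\, m_{\pi_0}(z, \sigma^2) \le 0$ for all $z \in \mathbb{R}^{d-1}$ and all $\sigma^2$ with $\frac{\sigma_X^2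 \sigma_Y^2}{\sigma_X^2 + \sigma_Y^2} < \sigma^2 < \sigma_X^2$, with strict inequality on a set of positive Lebesgue measure on $\mathbb{R}^{d-1}$ for at least one such $\sigma^2$; (ii) $\Delta \sqrt{m_{\pi_0}(z, \sigma^2)} \le 0$ for all $z \in \mathbb{R}^{d-1}$ and all $\sigma^2$ with $\frac{\sigma_X^2 \sigma_Y^2}{\sigma_X^2 + \sigma_Y^2} < \sigma^2 < \sigma_X^2$, with strict inequality on a set of positive Lebesgue measure on $\mathbb{R}^{d-1}$ for at least one such $\sigma^2$; (iii) the prior $\pi_0$ is such that $\Delta \pi_0(\zeta_{(2)}) \le 0$ almost everywhere.
   Context: A random vector $X \in \mathbb{R}^d$ has a mean-mixture of normal distributions, written $X \sim MMN_d(\theta, a, \Sigma, \mathcal{L})$, if $X|V=v \sim N_d(\theta + v a, \Sigma)$ with $V \sim \mathcal{L}$, where $\theta\in\mathbb{R}^d$ is a location parameter, $a \in \mathbb{R}^d$ a perturbation vector, $\Sigma$ a positive definite matrix, and $V$ a scalar random variable with cdf $\mathcal{L}$. $\phi_{m}(\cdot;\Sigma)$ is the pdf of the $N_m(0,\Sigma)$ distribution. $\Delta h(t) = \sum_{i=1}^{d-1} \partial^2 h(t)/\partial t_i^2$ is the Laplacian of $h:\mathbb{R}^{d-1}\to\mathbb{R}$ (taken in the $z$ variable for $m_{\pi_0}$); the conditions include the existence of the Laplacian. Let $p(\cdot|\theta)$, $q(\cdot|\theta)$ denote the conditional densities of $X$ and $Y$ given $\theta$. The Bayes predictive density for a prior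 density $\pi$ is $\hat{q}_\pi(y;x) = \int q(y|\theta)\,\pi(\theta|x)\,d\theta$, where $\pi(\theta|x) = p(x|\theta)\pi(\theta)/\int p(x|t)\pi(t)\,dt$. The MRE predictive density $\hat{q}_U$ is the Bayes predictive density for the uniform prior $\pi_U(\theta)=1$; here it is the $MMN_d(X,a,(\sigma_X^2+\sigma_Y^2)I_d,\mathcal{L}_3)$ density, with $\mathcal{L}_3$ the cdf of $V_2-V_1$ for independent $V_1\sim\mathcal{L}_1$, $V_2\sim\mathcal{L}_2$. The Kullback-Leibler risk is $R_{KL}(\theta,\hat{q}) = \int_{\mathbb{R}^d} \left\{ \int_{\mathbb{R}^d} q(y|\theta) \log \frac{q(y|\theta)}{\hat{q}(y;x)}\, dy \right\} p(x|\theta)\, dx$. One predictive density dominates another if its risk is less than or equal to that of the other for all $\theta$, with strict inequality for at least one $\theta$.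
   Formalization: The MRE density is assumed to have finite Kullback-Leibler risk (otherwise both risks can be infinite for all θ), and in (iii) Δπ₀ ≤ 0 is taken in the sense of distributions, since the pointwise a.e. inequality holds for the indicator of a ball, where dominance fails. *)

theory Defs
  imports "HOL-Probability.Probability"
begin

section \<open>Normal densities and mean mixtures of normals\<close>

text \<open>The covariance matrix \<open>s I\<close> is \<open>mat s\<close>.\<close>

definition mvn_density :: "real^'n^'n \<Rightarrow> real^'n \<Rightarrow> real" where
  "mvn_density S x =
     exp (- (x \<bullet> (matrix_inv S *v x)) / 2) / sqrt ((2 * pi) ^ CARD('n) * det S)"

definition is_cdf :: "(real \<Rightarrow> real) \<Rightarrow> bool" where
  "is_cdf F \<longleftrightarrow> (\<exists>M. real_distribution M \<and> F = cdf M)"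

text \<open>
  The hierarchical definition of the model: \<open>V\<close> has cdf \<open>L\<close> and, given \<open>V = v\<close>, \<open>X\<close> is normal
  with mean \<open>\<theta> + v a\<close> and covariance matrix \<open>S\<close>. Equivalently, \<open>(V, X)\<close> has the joint density
  below with respect to the product of the law of \<open>V\<close> and Lebesgue measure.
\<close>

definition is_mmn ::
    "'w measure \<Rightarrow> ('w \<Rightarrow> real^'n) \<Rightarrow> real^'n \<Rightarrow> real^'n \<Rightarrow> real^'n^'n \<Rightarrow> (real \<Rightarrow> real) \<Rightarrow> bool" where
  "is_mmn M X \<theta> a S L \<longleftrightarrow>
     (\<exists>V. distributed M (interval_measure L \<Otimes>\<^sub>M lborel) (\<lambda>w. (V w, X w))
        (\<lambda>(v, x). ennreal (mvn_density S (x - \<theta> - v *\<^sub>R a))))"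

definition mmn_density ::
    "real^'n \<Rightarrow> real^'n \<Rightarrow> real^'n^'n \<Rightarrow> (real \<Rightarrow> real) \<Rightarrow> real^'n \<Rightarrow> real" where
  "mmn_density \<theta> a S L x = (LINT v|interval_measure L. mvn_density S (x - \<theta> - v *\<^sub>R a))"

lemma real_distribution_is_cdf:
  assumes "is_cdf F"
  shows "real_distribution (interval_measure F)"
proof -
  obtain M where M: "real_distribution M" "F = cdf M"
    using assms by (auto simp: is_cdf_def)
  interpret real_distribution M by (rule M(1))
  show ?thesis
    unfolding M(2)
    by (intro real_distribution_interval_measure cdf_nondecreasing cdf_is_right_cont
        cdf_lim_at_bot cdf_lim_at_top_prob)
qed

lemma mvn_density_measurable [measurable]: "mvn_density S \<in> borel_measurable borel"
proof -
  have "continuous_on UNIV (mvn_density S)"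
    unfolding mvn_density_def divide_inverse by (intro continuous_intros)
  then show ?thesis
    by (rule borel_measurable_continuous_onI)
qed

lemma mvn_density_mat:
  fixes x :: "real^'n"
  assumes "0 < s"
  shows "mvn_density (mat s) x = exp (- (norm x)\<^sup>2 / (2 * s)) / sqrt ((2 * pi * s) ^ CARD('n))"
proof -
  have mul: "mat r ** mat t = (mat (r * t) :: real^'n^'n)" for r t :: real
    by (auto simp: mat_def matrix_matrix_mult_def vec_eq_iff if_distrib cong: if_cong
        intro!: sum.neutral)
  have inv: "matrix_inv (mat s :: real^'n^'n) = mat (1 / s)"
    unfolding matrix_inv_def
  proof (rule some_equality)
    show "mat s ** mat (1 / s) = (mat 1 :: real^'n^'n) \<and> mat (1 / s) ** mat s = (mat 1 :: real^'n^'n)"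
      using assms by (simp add: mul)
    show "B = mat (1 / s)" if "mat s ** B = mat 1 \<and> B ** mat s = mat 1" for B :: "real^'n^'n"
    proof -
      have "B = mat (1 / s) ** mat s ** B"
        using assms by (simp add: mul)
      then show ?thesis
        using that by (simp add: matrix_mul_assoc[symmetric])
    qed
  qed
  have "mat (1 / s) *v x = (1 / s) *\<^sub>R x"
    by (simp add: mat_def matrix_vector_mult_def vec_eq_iff if_distrib if_distribR cong: if_cong)
  moreover have "det (mat s :: real^'n^'n) = s ^ CARD('n)"
    by (subst det_diagonal) (auto simp: mat_def)
  ultimately show ?thesis
    by (simp add: mvn_density_def inv power2_norm_eq_inner power_mult_distrib)
qed

lemma is_mmn_density:
  fixes X :: "'w \<Rightarrow> real^'n"
  assumes M: "prob_space M" and L: "is_cdf L" and s: "0 < s"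
    and X: "is_mmn M X \<theta> a (mat s) L"
  shows "distributed M lborel X (\<lambda>x. ennreal (mmn_density \<theta> a (mat s) L x))"
proof -
  interpret M: prob_space M by (rule M)
  interpret L: real_distribution "interval_measure L" by (rule real_distribution_is_cdf[OF L])
  obtain V where V: "distributed M (interval_measure L \<Otimes>\<^sub>M lborel) (\<lambda>w. (V w, X w))
        (\<lambda>(v, x). ennreal (mvn_density (mat s) (x - \<theta> - v *\<^sub>R a)))"
    using X by (auto simp: is_mmn_def)
  have nn: "0 \<le> mvn_density (mat s) x" for x :: "real^'n"
    using s by (simp add: mvn_density_mat)
  have bnd: "mvn_density (mat s) x \<le> 1 / sqrt ((2 * pi * s) ^ CARD('n))" for x :: "real^'n"
    unfolding mvn_density_mat[OF s] using s by (intro divide_right_mono) auto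
  have int: "integrable (interval_measure L) (\<lambda>v. mvn_density (mat s) (x - \<theta> - v *\<^sub>R a))" for x
  proof (rule L.integrable_const_bound)
    show "AE v in interval_measure L.
        norm (mvn_density (mat s) (x - \<theta> - v *\<^sub>R a)) \<le> 1 / sqrt ((2 * pi * s) ^ CARD('n))"
      using bnd nn by (intro AE_I2) (simp only: real_norm_def abs_of_nonneg)
  qed measurable
  have "(\<integral>\<^sup>+v. ennreal (mvn_density (mat s) (x - \<theta> - v *\<^sub>R a)) \<partial>interval_measure L)
          = ennreal (mmn_density \<theta> a (mat s) L x)" for x
    unfolding mmn_density_def by (rule nn_integral_eq_integral[OF int]) (simp add: nn)
  with M.distr_marginal2[OF _ _ V] show ?thesis
    by (simp add: L.sigma_finite_measure_axioms lborel.sigma_finite_measure_axioms)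
qed


section \<open>Predictive densities and Kullback-Leibler risk\<close>

text \<open>
  Sampling densities are written \<open>p x \<theta>\<close> and \<open>q y \<theta>\<close>, a predictive density \<open>d\<close> as \<open>d y x\<close>.
\<close>

definition posterior_density ::
    "('x \<Rightarrow> 'p::euclidean_space \<Rightarrow> real) \<Rightarrow> ('p \<Rightarrow> real) \<Rightarrow> 'p \<Rightarrow> 'x \<Rightarrow> real" where
  "posterior_density p prior \<theta> x = p x \<theta> * prior \<theta> / (LINT t|lborel. p x t * prior t)"

definition bayes_pred_density ::
    "('x \<Rightarrow> 'p::euclidean_space \<Rightarrow> real) \<Rightarrow> ('y \<Rightarrow> 'p \<Rightarrow> real) \<Rightarrow> ('p \<Rightarrow> real) \<Rightarrow> 'y \<Rightarrow> 'x \<Rightarrow> real" where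
  "bayes_pred_density p q prior y x = (LINT \<theta>|lborel. q y \<theta> * posterior_density p prior \<theta> x)"

definition mre_pred_density ::
    "('x \<Rightarrow> 'p::euclidean_space \<Rightarrow> real) \<Rightarrow> ('y \<Rightarrow> 'p \<Rightarrow> real) \<Rightarrow> 'y \<Rightarrow> 'x \<Rightarrow> real" where
  "mre_pred_density p q = bayes_pred_density p q (\<lambda>_. 1)"

text \<open>
  The Lebesgue integral with values in the extended reals, so that an infinite
  Kullback-Leibler risk is \<open>\<infinity>\<close> and not the default value \<open>0\<close> of the Bochner integral.
\<close>

definition ext_integral :: "'a measure \<Rightarrow> ('a \<Rightarrow> ereal) \<Rightarrow> ereal" where
  "ext_integral M f =
     enn2ereal (\<integral>\<^sup>+x. e2ennreal (f x) \<partial>M) - enn2ereal (\<integral>\<^sup>+x. e2ennreal (- f x) \<partial>M)"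

definition kl_risk ::
    "('x::euclidean_space \<Rightarrow> 'p \<Rightarrow> real) \<Rightarrow> ('y::euclidean_space \<Rightarrow> 'p \<Rightarrow> real) \<Rightarrow>
     'p \<Rightarrow> ('y \<Rightarrow> 'x \<Rightarrow> real) \<Rightarrow> ereal" where
  "kl_risk p q \<theta> d =
     ext_integral lborel (\<lambda>x.
       ext_integral lborel (\<lambda>y. ereal (q y \<theta> * ln (q y \<theta> / d y x))) * ereal (p x \<theta>))"

definition dominates :: "('p \<Rightarrow> 'd \<Rightarrow> ereal) \<Rightarrow> 'd \<Rightarrow> 'd \<Rightarrow> bool" where
  "dominates R d1 d2 \<longleftrightarrow> (\<forall>\<theta>. R \<theta> d1 \<le> R \<theta> d2) \<and> (\<exists>\<theta>. R \<theta> d1 < R \<theta> d2)"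


section \<open>Laplacians\<close>

definition laplacian :: "(real^'m \<Rightarrow> real) \<Rightarrow> real^'m \<Rightarrow> real" where
  "laplacian h t = (\<Sum>i\<in>UNIV. deriv (deriv (\<lambda>s. h (t + s *\<^sub>R axis i 1))) 0)"

definition laplacian_exists :: "(real^'m \<Rightarrow> real) \<Rightarrow> real^'m \<Rightarrow> bool" where
  "laplacian_exists h t \<longleftrightarrow>
     (\<forall>i. let g = (\<lambda>s. h (t + s *\<^sub>R axis i 1)) in
        (\<forall>\<^sub>F s in nhds 0. g field_differentiable (at s)) \<and> deriv g field_differentiable (at 0))"

definition C2_function :: "(real^'m \<Rightarrow> real) \<Rightarrow> bool" where
  "C2_function f \<longleftrightarrow>
     (\<exists>(grad :: real^'m \<Rightarrow> real^'m) (hess :: real^'m \<Rightarrow> real^'m^'m).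
        (\<forall>t. (f has_derivative (\<lambda>h. grad t \<bullet> h)) (at t)) \<and>
        (\<forall>t. (grad has_derivative (\<lambda>h. hess t *v h)) (at t)) \<and>
        continuous_on UNIV hess)"

text \<open>
  The inequality \<open>\<Delta>f \<le> 0\<close> for a density \<open>f\<close>, which is only given up to null sets: it is meant
  in the sense of distributions. By mollification it makes no difference whether the test
  functions are \<open>C\<^sup>2\<close> or smooth. The pointwise inequality off a null set would not do, since
  it holds for the indicator function of a ball; on the other hand, the harmonic density
  \<open>\<zeta> \<mapsto> norm \<zeta> powr (2 - m)\<close> on \<open>m\<close>-space, \<open>m \<ge> 3\<close>, has no Laplacian at the origin and is
  covered.
\<close>

definition weak_laplacian_nonpos :: "(real^'m \<Rightarrow> real) \<Rightarrow> bool" where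
  "weak_laplacian_nonpos f \<longleftrightarrow>
     (\<forall>K. compact K \<longrightarrow> set_integrable lborel K f) \<and>
     (\<forall>\<psi>. C2_function \<psi> \<and> (\<forall>t. 0 \<le> \<psi> t) \<and> bounded {t. \<psi> t \<noteq> 0} \<longrightarrow>
        (LINT t|lborel. f t * laplacian \<psi> t) \<le> 0)"


section \<open>The marginal density of the projected prior\<close>

definition marginal_m :: "(real^'m \<Rightarrow> real) \<Rightarrow> real^'m \<Rightarrow> real \<Rightarrow> real" where
  "marginal_m \<pi>\<^sub>0 z s = (LINT \<zeta>|lborel. mvn_density (mat s) (z - \<zeta>) * \<pi>\<^sub>0 \<zeta>)"

text \<open>
  \<open>F\<close> is a function of \<open>z\<close> and \<open>s\<close>, and \<open>s\<close> ranges over the open interval from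
  \<open>sX sY / (sX + sY)\<close> to \<open>sX\<close>, where \<open>sX\<close> and \<open>sY\<close> are variances.
\<close>

definition laplacian_condition :: "real \<Rightarrow> real \<Rightarrow> (real^'m \<Rightarrow> real \<Rightarrow> real) \<Rightarrow> bool" where
  "laplacian_condition sX sY F \<longleftrightarrow>
     (\<forall>s. sX * sY / (sX + sY) < s \<and> s < sX \<longrightarrow>
        (\<forall>z. laplacian_exists (\<lambda>z. F z s) z \<and> laplacian (\<lambda>z. F z s) z \<le> 0)) \<and>
     (\<exists>s. sX * sY / (sX + sY) < s \<and> s < sX \<and>
        0 < emeasure lebesgue {z. laplacian (\<lambda>z. F z s) z < 0})"

end

theory Submission
  imports Defs
begin

text \<open>
  Write \<open>m_s\<close> for the convolution of \<open>\<pi>\<^sub>0\<close> with \<open>N(0, s I)\<close> and \<open>sW = sX sY / (sX + sY)\<close>. The Bayes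
  predictive density is the MRE one times \<open>m_sW (w) / m_sX (H2 x)\<close>, where
  \<open>w = H2 (sY x + sX y) / (sX + sY)\<close> has law \<open>N(H2 \<theta>, sW I)\<close>. Hence the difference of the risks is
  \<open>E ln m_sW (w) - E ln m_sX (H2 x)\<close>.

  Since \<open>m_s\<close> solves \<open>\<partial>m_s/\<partial>s = \<Delta>m_s/2\<close>, \<open>ln m_s\<close> is a supersolution of the backward heat equation
  iff \<open>\<Delta>m_s - |\<nabla>m_s|^2 / (2 m_s) \<le> 0\<close>, that is, iff \<open>\<Delta>(sqrt m_s) \<le> 0\<close>; this follows from each of the three
  conditions. As \<open>ln m_s\<close> is bounded below by a quadratic function, a minimum principle shows that its
  Gaussian averages decrease. Equality would make \<open>ln m_s\<close> an exact solution.
  Superharmonicity of \<open>sqrt m_s\<close> also gives the finiteness of \<open>E sqrt (m_sW (w))\<close>, hence of both expectations.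
\<close>

section \<open>The Gaussian kernel and its semigroup\<close>

text \<open>The average of \<open>u s\<close> over \<open>N(z, s I)\<close> has as its
  \<open>s\<close>-derivative the average of \<open>(d/ds + Delta/2) u\<close>; this is why
  \<open>ln m\<close> is tested against the backward heat equation. Differentiating under the
  average would need growth bounds on the derivatives of \<open>ln m\<close>, which a general
  improper prior does not provide. Instead, the comparison is made pointwise with truncated caloric
  functions, and only integrals of nonnegative functions pass to the limit. To have a nonnegative
  function at all, an exact solution of quadratic growth is added to \<open>ln m\<close>; its
  Gaussian averages do not depend on \<open>s\<close>, so it drops out of the risk difference. The
  conditions speak of the open interval between \<open>sW\<close> and \<open>sX\<close>, and at
  \<open>sX\<close> the prior is integrable against the kernel but derivatives of \<open>m\<close>
  are not at hand; so both end points are reached by Fatou's lemma. The mixing variables disappear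
  because \<open>H2\<close> kills \<open>a\<close>: shifts along \<open>a\<close> are invisible to a
  function of \<open>H2 \<theta>\<close>, and the whole mixture collects in a factor common to both
  predictive densities.\<close>

definition gauss :: "real \<Rightarrow> 'a::euclidean_space \<Rightarrow> real" where
  "gauss s x = exp (- (norm x)\<^sup>2 / (2 * s)) / sqrt ((2 * pi * s) ^ DIM('a))"

lemma mvn_density_eq_gauss: "0 < s \<Longrightarrow> mvn_density (mat s) (x :: real^'n) = gauss s x"
  by (simp add: mvn_density_mat gauss_def)

lemma gauss_pos: "0 < s \<Longrightarrow> 0 < gauss s x"
  by (simp add: gauss_def)

lemma gauss_nonneg: "0 < s \<Longrightarrow> 0 \<le> gauss s x"
  by (simp add: gauss_def)

lemma gauss_minus_commute: "gauss s (x - y) = gauss s (y - x)"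
  by (simp add: gauss_def norm_minus_commute)

lemma gauss_uminus [simp]: "gauss s (- x) = gauss s x"
  by (simp add: gauss_def)

lemma gauss_le: "0 < s \<Longrightarrow> gauss s (x :: 'a::euclidean_space) \<le> 1 / sqrt ((2 * pi * s) ^ DIM('a))"
  unfolding gauss_def by (intro divide_right_mono) auto

lemma gauss_measurable [measurable]: "gauss s \<in> borel_measurable borel"
  unfolding gauss_def by measurable

lemma gauss_eq_prod_normal_density:
  fixes x z :: "'a::euclidean_space"
  assumes "0 < s"
  shows "gauss s (z - x) = (\<Prod>b\<in>Basis. normal_density (z \<bullet> b) (sqrt s) (x \<bullet> b))"
    (is "_ = ?R")
proof -
  have "?R = (\<Prod>b\<in>(Basis::'a set). 1 / sqrt (2 * pi * s)) * exp (\<Sum>b\<in>Basis. - (x \<bullet> b - z \<bullet> b)\<^sup>2 / (2 * s))"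
    using assms by (simp add: normal_density_def exp_sum prod_dividef power_one_over)
  also have "(\<Sum>b\<in>Basis. - (x \<bullet> b - z \<bullet> b)\<^sup>2 / (2 * s)) = - (norm (z - x))\<^sup>2 / (2 * s)"
  proof -
    have "(norm (z - x))\<^sup>2 = (\<Sum>b\<in>Basis. (x \<bullet> b - z \<bullet> b)\<^sup>2)"
      unfolding power2_norm_eq_inner euclidean_inner[of "z - x" "z - x"]
      by (intro sum.cong) (auto simp: inner_diff_left power2_eq_square algebra_simps)
    then show ?thesis
      by (simp add: sum_divide_distrib[symmetric] sum_negf)
  qed
  also have "(\<Prod>b\<in>(Basis::'a set). 1 / sqrt (2 * pi * s)) = 1 / sqrt ((2 * pi * s) ^ DIM('a))"
    by (simp add: power_one_over real_sqrt_power)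
  finally show ?thesis
    by (simp add: gauss_def)
qed

lemma nn_integral_gauss:
  assumes "0 < s"
  shows "(\<integral>\<^sup>+x. ennreal (gauss s (z - x)) \<partial>lborel) = 1"
proof -
  have *: "(\<integral>\<^sup>+x. ennreal (normal_density m (sqrt s) x) \<partial>lborel) = 1" for m
    using assms by (subst nn_integral_eq_integral) auto
  have "(\<integral>\<^sup>+x. ennreal (gauss s (z - x)) \<partial>lborel)
      = (\<integral>\<^sup>+x. (\<Prod>b\<in>Basis. ennreal (normal_density (z \<bullet> b) (sqrt s) (x \<bullet> b))) \<partial>lborel)"
    by (simp add: gauss_eq_prod_normal_density[OF assms] prod_ennreal)
  also have "\<dots> = 1"
    by (subst nn_integral_lborel_prod[where f="\<lambda>b x. ennreal (normal_density (z \<bullet> b) (sqrt s) x)"])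
       (auto simp: *)
  finally show ?thesis .
qed

lemma integrable_gauss: "0 < s \<Longrightarrow> integrable lborel (\<lambda>x. gauss s (z - x))"
  and integral_gauss: "0 < s \<Longrightarrow> (LINT x|lborel. gauss s (z - x)) = 1"
  using nn_integral_gauss[of s z]
  by (auto simp: integral_eq_nn_integral gauss_nonneg intro!: integrableI_nonneg)

text \<open>Completing the square in \<open>z\<close>: a normal factor in \<open>x - y\<close>
  splits off, and what remains is normal in \<open>z\<close> around the mean of \<open>x\<close> and
  \<open>y\<close> with inverse-variance weights. The semigroup law, the law of the weighted mean
  and the posterior all rest on this identity.\<close>

lemma gauss_mult:
  fixes x y z :: "'a::euclidean_space"
  assumes s: "0 < s" and t: "0 < t"
  shows "gauss s (x - z) * gauss t (y - z)
    = gauss (s + t) (x - y) * gauss (s * t / (s + t)) ((t / (s + t)) *\<^sub>R x + (s / (s + t)) *\<^sub>R y - z)"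
proof -
  let ?w = "\<lambda>u v. (1 / (s + t)) *\<^sub>R (t *\<^sub>R u + s *\<^sub>R v)"
  define u v where "u = x - z" and "v = y - z"
  have st: "s + t > 0" "s * t > 0"
    using assms by auto
  have "(t / (s + t)) *\<^sub>R x + (s / (s + t)) *\<^sub>R y - z
      = (t / (s + t)) *\<^sub>R u + (s / (s + t)) *\<^sub>R v + ((t + s) / (s + t) - 1) *\<^sub>R z"
    using st by (simp add: u_def v_def algebra_simps add_divide_distrib[symmetric]
        flip: scaleR_add_left)
  then have w: "(t / (s + t)) *\<^sub>R x + (s / (s + t)) *\<^sub>R y - z = ?w u v"
    using st by (simp add: scaleR_add_right add.commute)
  have xy: "x - y = u - v"
    by (simp add: u_def v_def)
  have "(norm u)\<^sup>2 / (2 * s) + (norm v)\<^sup>2 / (2 * t)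
     = (norm (u - v))\<^sup>2 / (2 * (s + t)) + (norm (?w u v))\<^sup>2 / (2 * (s * t / (s + t)))"
    unfolding power2_norm_eq_inner using s t st
    by (simp add: inner_simps inner_commute[of v u] divide_simps) (simp add: algebra_simps)
  then have e: "exp (- (norm u)\<^sup>2 / (2 * s)) * exp (- (norm v)\<^sup>2 / (2 * t))
     = exp (- (norm (u - v))\<^sup>2 / (2 * (s + t))) *
       exp (- (norm (?w u v))\<^sup>2 / (2 * (s * t / (s + t))))"
    by (simp only: exp_add[symmetric] minus_divide_left[symmetric] minus_add_distrib[symmetric])
  have "(2 * pi * s) * (2 * pi * t) = (2 * pi * (s + t)) * (2 * pi * (s * t / (s + t)))"
    using st by (simp add: field_simps)
  then have c: "sqrt ((2 * pi * s) ^ DIM('a)) * sqrt ((2 * pi * t) ^ DIM('a))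
     = sqrt ((2 * pi * (s + t)) ^ DIM('a)) * sqrt ((2 * pi * (s * t / (s + t))) ^ DIM('a))"
    by (simp only: real_sqrt_mult[symmetric] power_mult_distrib[symmetric])
  show ?thesis
    unfolding w xy u_def[symmetric] v_def[symmetric]
    unfolding gauss_def times_divide_times_eq e c ..
qed

text \<open>The same Gaussian average is used in two versions: with values in
  \<open>ennreal\<close>, where Fubini, Fatou and the semigroup law hold without integrability, and
  as the real integral \<open>heat\<close>, which can be differentiated.\<close>

definition heat_nn :: "real \<Rightarrow> ('a::euclidean_space \<Rightarrow> ennreal) \<Rightarrow> 'a \<Rightarrow> ennreal" where
  "heat_nn s f z = (\<integral>\<^sup>+x. ennreal (gauss s (z - x)) * f x \<partial>lborel)"

definition heat :: "real \<Rightarrow> ('a::euclidean_space \<Rightarrow> real) \<Rightarrow> 'a \<Rightarrow> real" where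
  "heat s f z = (LINT x|lborel. gauss s (z - x) * f x)"

lemma heat_nn_measurable [measurable]:
  assumes [measurable]: "f \<in> borel_measurable borel"
  shows "heat_nn s f \<in> borel_measurable borel"
  unfolding heat_nn_def by measurable

lemma heat_measurable [measurable]:
  assumes [measurable]: "f \<in> borel_measurable borel"
  shows "heat s f \<in> borel_measurable borel"
  unfolding heat_def by measurable

lemma heat_nonneg: "0 < s \<Longrightarrow> (\<And>x. 0 \<le> f x) \<Longrightarrow> 0 \<le> heat s f z"
  unfolding heat_def by (intro Bochner_Integration.integral_nonneg) (simp add: gauss_nonneg)

lemma heat_nn_mono: "(\<And>x. f x \<le> g x) \<Longrightarrow> heat_nn s f z \<le> heat_nn s g z"
  unfolding heat_nn_def by (intro nn_integral_mono mult_left_mono) auto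

lemma heat_nn_const: "0 < s \<Longrightarrow> heat_nn s (\<lambda>_. c) z = c"
  unfolding heat_nn_def by (simp add: nn_integral_multc nn_integral_gauss)

lemma heat_nn_eq_heat:
  assumes "0 < s" "\<And>x. 0 \<le> f x" "integrable lborel (\<lambda>x. gauss s (z - x) * f x)"
  shows "heat_nn s (\<lambda>x. ennreal (f x)) z = ennreal (heat s f z)"
  unfolding heat_nn_def heat_def using assms
  by (simp add: ennreal_mult'[symmetric] gauss_nonneg nn_integral_eq_integral)

lemma integrable_heat_iff:
  assumes "0 < s" "\<And>x. 0 \<le> f x" and [measurable]: "f \<in> borel_measurable borel"
  shows "integrable lborel (\<lambda>x. gauss s (z - x) * f x) \<longleftrightarrow> heat_nn s (\<lambda>x. ennreal (f x)) z < \<infinity>"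
proof -
  have "integrable lborel (\<lambda>x. gauss s (z - x) * f x)
      \<longleftrightarrow> (\<integral>\<^sup>+x. ennreal (norm (gauss s (z - x) * f x)) \<partial>lborel) < \<infinity>"
    by (subst integrable_iff_bounded) auto
  then show ?thesis
    using assms by (simp add: heat_nn_def ennreal_mult gauss_nonneg abs_mult)
qed

text \<open>After \<open>gauss_mult\<close> only the second factor contains the intermediate point,
  and it integrates to 1.\<close>

lemma heat_nn_heat_nn:
  fixes f :: "'a::euclidean_space \<Rightarrow> ennreal"
  assumes s: "0 < s" and t: "0 < t" and [measurable]: "f \<in> borel_measurable borel"
  shows "heat_nn s (heat_nn t f) z = heat_nn (s + t) f z"
proof -
  have "heat_nn s (heat_nn t f) z
      = (\<integral>\<^sup>+x. \<integral>\<^sup>+y. ennreal (gauss s (z - x)) * (ennreal (gauss t (x - y)) * f y) \<partial>lborel \<partial>lborel)"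
    unfolding heat_nn_def by (simp add: nn_integral_cmult)
  also have "\<dots> = (\<integral>\<^sup>+y. \<integral>\<^sup>+x. ennreal (gauss s (z - x)) * (ennreal (gauss t (x - y)) * f y) \<partial>lborel \<partial>lborel)"
    by (rule lborel_pair.Fubini') measurable
  also have "\<dots> = (\<integral>\<^sup>+y. ennreal (gauss (s + t) (z - y)) * f y *
      (\<integral>\<^sup>+x. ennreal (gauss (s * t / (s + t)) ((t / (s + t)) *\<^sub>R z + (s / (s + t)) *\<^sub>R y - x)) \<partial>lborel) \<partial>lborel)"
  proof (rule nn_integral_cong)
    fix y
    have "ennreal (gauss s (z - x)) * (ennreal (gauss t (x - y)) * f y)
       = ennreal (gauss (s + t) (z - y)) * f y *
          ennreal (gauss (s * t / (s + t)) ((t / (s + t)) *\<^sub>R z + (s / (s + t)) *\<^sub>R y - x))" for x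
      using gauss_mult[OF s t, of z x y] s t
      by (simp add: gauss_minus_commute[of t x y] mult.assoc[symmetric] ennreal_mult'[symmetric] gauss_nonneg)
         (simp add: ennreal_mult' gauss_nonneg mult_ac)
    then show "(\<integral>\<^sup>+x. ennreal (gauss s (z - x)) * (ennreal (gauss t (x - y)) * f y) \<partial>lborel)
      = ennreal (gauss (s + t) (z - y)) * f y *
      (\<integral>\<^sup>+x. ennreal (gauss (s * t / (s + t)) ((t / (s + t)) *\<^sub>R z + (s / (s + t)) *\<^sub>R y - x)) \<partial>lborel)"
      by (simp add: nn_integral_cmult)
  qed
  also have "\<dots> = heat_nn (s + t) f z"
    using s t by (simp add: nn_integral_gauss heat_nn_def)
  finally show ?thesis .
qed

section \<open>Smoothness of Gaussian convolutions\<close>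

text \<open>The mean value theorem turns the bound on \<open>k'\<close> into the same bound on all
  difference quotients, so dominated convergence applies along every sequence tending to
  \<open>r0\<close>.\<close>

lemma has_real_derivative_integral:
  fixes k :: "real \<Rightarrow> 'a \<Rightarrow> real"
  assumes d: "0 < d"
    and int: "\<And>r. \<bar>r - r0\<bar> < d \<Longrightarrow> integrable M (k r)"
    and der: "\<And>r x. x \<in> space M \<Longrightarrow> \<bar>r - r0\<bar> < d \<Longrightarrow> ((\<lambda>r. k r x) has_real_derivative k' r x) (at r)"
    and bound: "\<And>r x. x \<in> space M \<Longrightarrow> \<bar>r - r0\<bar> < d \<Longrightarrow> \<bar>k' r x\<bar> \<le> G x"
    and G: "integrable M G"
  shows "((\<lambda>r. LINT x|M. k r x) has_real_derivative (LINT x|M. k' r0 x)) (at r0)"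
  unfolding DERIV_def tendsto_at_iff_sequentially
proof (intro allI impI)
  fix X :: "nat \<Rightarrow> real"
  assume X: "\<forall>i. X i \<in> UNIV - {0}" "X \<longlonglongrightarrow> 0"
  \<comment> \<open>Difference quotients, set to 0 where the increment leaves the range of the
    hypotheses, so that \<open>G\<close> bounds every term and not only the late ones.\<close>
  define s where "s n x = (if \<bar>X n\<bar> < d then (k (r0 + X n) x - k r0 x) / X n else 0)" for n x
  have ev: "\<forall>\<^sub>F n in sequentially. \<bar>X n\<bar> < d"
    using tendstoD[OF X(2) d] by simp
  have s_meas [measurable]: "s n \<in> borel_measurable M" for n
    using int[THEN borel_measurable_integrable, of "r0 + X n"] int[THEN borel_measurable_integrable, of r0] d
    by (cases "\<bar>X n\<bar> < d") (auto simp: s_def[abs_def])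
  have lim: "(\<lambda>n. s n x) \<longlonglongrightarrow> k' r0 x" if "x \<in> space M" for x
  proof (rule Lim_transform_eventually)
    show "(\<lambda>n. (k (r0 + X n) x - k r0 x) / X n) \<longlonglongrightarrow> k' r0 x"
      using der[OF that, of r0] d X unfolding DERIV_def tendsto_at_iff_sequentially comp_def by auto
    show "\<forall>\<^sub>F n in sequentially. (k (r0 + X n) x - k r0 x) / X n = s n x"
      using ev by eventually_elim (simp add: s_def)
  qed
  have bnd: "norm (s n x) \<le> G x" if x: "x \<in> space M" for n x
  proof (cases "\<bar>X n\<bar> < d")
    case True
    have "norm (k (r0 + X n) x - k r0 x) \<le> G x * norm (r0 + X n - r0)"
    proof (rule field_differentiable_bound[where S="{r. \<bar>r - r0\<bar> < d}" and f'="\<lambda>r. k' r x"])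
      have "{r. \<bar>r - r0\<bar> < d} = {r0 - d<..<r0 + d}"
        by auto
      then show "convex {r. \<bar>r - r0\<bar> < d}"
        by simp
    qed (use True d x der bound in \<open>auto intro: has_field_derivative_at_within\<close>)
    then have "norm (k (r0 + X n) x - k r0 x) / norm (X n) \<le> G x"
      using X(1) by (auto simp: divide_le_eq)
    then show ?thesis
      using True by (simp add: s_def)
  next
    case False
    then show ?thesis
      using bound[OF x, of r0] d by (simp add: s_def)
  qed
  have k'_meas: "k' r0 \<in> borel_measurable M"
    by (rule borel_measurable_LIMSEQ_real[OF lim s_meas])
  have "(\<lambda>n. LINT x|M. s n x) \<longlonglongrightarrow> (LINT x|M. k' r0 x)"
    by (rule integral_dominated_convergence[OF k'_meas s_meas G]) (use lim bnd in auto)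
  moreover have "\<forall>\<^sub>F n in sequentially.
      (LINT x|M. s n x) = ((LINT x|M. k (r0 + X n) x) - (LINT x|M. k r0 x)) / X n"
    using ev by eventually_elim (use d in \<open>simp add: s_def int\<close>)
  ultimately show "((\<lambda>h. ((LINT x|M. k (r0 + h) x) - (LINT x|M. k r0 x)) / h) \<circ> X)
      \<longlonglongrightarrow> (LINT x|M. k' r0 x)"
    unfolding comp_def by (rule Lim_transform_eventually)
qed

lemma gauss_eq_exp:
  assumes "0 < s"
  shows "gauss s (x::'a::euclidean_space) = exp (- (norm x)\<^sup>2 / (2 * s) - real DIM('a) / 2 * ln (2 * pi * s))"
proof -
  have "sqrt ((2 * pi * s) ^ DIM('a)) = exp (real DIM('a) / 2 * ln (2 * pi * s))"
    using assms by (simp add: powr_half_sqrt[symmetric] powr_def ln_realpow mult_ac)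
  then show ?thesis
    by (simp add: gauss_def exp_diff)
qed

text \<open>A smaller variance absorbs a quadratic polynomial and a shift of the centre by at most
  1. The majorant depends neither on \<open>s\<close> nor on \<open>z\<close>, which is what
  differentiation under the integral asks for.\<close>

lemma gauss_bound:
  fixes z0 :: "'a::euclidean_space"
  assumes lo: "0 < lo" and hi: "lo \<le> hi" "hi < T"
  shows "\<exists>C\<ge>0. \<forall>s\<in>{lo..hi}. \<forall>z\<in>cball z0 1. \<forall>x.
     (1 + (norm (z - x))\<^sup>2) * gauss s (z - x) \<le> C * gauss T (z0 - x)"
proof -
  \<comment> \<open>The gap \<open>1 / (2 * hi) - 1 / (2 * T)\<close> between the exponents is
    \<open>2 * \<kappa>\<close>. One half pays for the polynomial factor; the other half equals
    \<open>\<eta> / (2 * T)\<close> and pays for the shift through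
    \<open>(y + 1)^2 \<le> (1 + \<eta>) * y^2 + 1 + 1 / \<eta>\<close>.\<close>
  define \<kappa> where "\<kappa> = (1 / hi - 1 / T) / 4"
  define \<eta> where "\<eta> = (T / hi - 1) / 2"
  have pos: "0 < hi" "0 < T" "0 < \<kappa>" "0 < \<eta>"
    using assms by (auto simp: \<kappa>_def \<eta>_def field_simps)
  define c where "c = max 1 (1 / \<kappa>)"
  define a where "a = (1 + 1 / \<eta>) / (2 * T)"
  define b where "b = sqrt ((2 * pi * T) ^ DIM('a)) / sqrt ((2 * pi * lo) ^ DIM('a))"
  have main: "(1 + (norm (z - x))\<^sup>2) * gauss s (z - x) \<le> (c * exp a * b) * gauss T (z0 - x)"
    if s: "s \<in> {lo..hi}" and z: "z \<in> cball z0 1" for s z and x :: 'a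
  proof -
    define y where "y = norm (z - x)"
    have "norm (z0 - x) \<le> y + 1"
      using z norm_triangle_ineq[of "z0 - z" "z - x"] by (simp add: y_def dist_norm)
    then have "(norm (z0 - x))\<^sup>2 \<le> (y + 1)\<^sup>2"
      by (intro power_mono) auto
    also have "\<dots> \<le> (1 + \<eta>) * y\<^sup>2 + (1 + 1 / \<eta>)"
    proof -
      have "0 \<le> (\<eta> * y - 1)\<^sup>2 / \<eta>"
        using pos by simp
      then show ?thesis
        using pos by (simp add: power2_eq_square field_simps)
    qed
    finally have n: "(norm (z0 - x))\<^sup>2 / (2 * T) \<le> (1 + \<eta>) / (2 * T) * y\<^sup>2 + a"
      using pos by (simp add: a_def divide_right_mono add_divide_distrib[symmetric])
    have "y\<^sup>2 / (2 * hi) \<le> y\<^sup>2 / (2 * s)"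
      using s lo by (intro divide_left_mono) auto
    moreover have "(1 + \<eta>) / (2 * T) = 1 / (2 * hi) - \<kappa>"
      using pos by (simp add: \<eta>_def \<kappa>_def field_simps)
    ultimately have ex: "\<kappa> * y\<^sup>2 - y\<^sup>2 / (2 * s) \<le> a - (norm (z0 - x))\<^sup>2 / (2 * T)"
      using n by (simp only: left_diff_distrib) simp
    have "1 + y\<^sup>2 \<le> c * (1 + \<kappa> * y\<^sup>2)"
    proof -
      have "1 \<le> c" "1 \<le> c * \<kappa>"
        using pos by (auto simp: c_def max_def field_simps)
      then have "1 + y\<^sup>2 \<le> c + (c * \<kappa>) * y\<^sup>2"
        by (intro add_mono) (auto simp: mult_le_cancel_right1)
      then show ?thesis
        by (simp add: algebra_simps)
    qed
    also have "\<dots> \<le> c * exp (\<kappa> * y\<^sup>2)"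
      by (intro mult_left_mono exp_ge_add_one_self) (auto simp: c_def)
    finally have "(1 + y\<^sup>2) * exp (- y\<^sup>2 / (2 * s)) \<le> c * exp (\<kappa> * y\<^sup>2) * exp (- y\<^sup>2 / (2 * s))"
      by (intro mult_right_mono) auto
    also have "\<dots> = c * exp (\<kappa> * y\<^sup>2 - y\<^sup>2 / (2 * s))"
      by (simp add: exp_diff exp_minus field_simps)
    also have "\<dots> \<le> c * exp (a - (norm (z0 - x))\<^sup>2 / (2 * T))"
      using ex by (intro mult_left_mono) (auto simp: c_def)
    finally have "(1 + y\<^sup>2) * exp (- y\<^sup>2 / (2 * s)) \<le> c * exp a * exp (- (norm (z0 - x))\<^sup>2 / (2 * T))"
      by (simp add: exp_diff exp_minus field_simps)
    then have "(1 + y\<^sup>2) * exp (- y\<^sup>2 / (2 * s)) / sqrt ((2 * pi * s) ^ DIM('a))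
        \<le> c * exp a * exp (- (norm (z0 - x))\<^sup>2 / (2 * T)) / sqrt ((2 * pi * lo) ^ DIM('a))"
      using s lo by (intro frac_le) (auto intro!: mult_nonneg_nonneg power_mono simp: c_def)
    also have "\<dots> = (c * exp a * b) * gauss T (z0 - x)"
      using pos by (simp add: b_def gauss_def)
    finally show ?thesis
      by (simp add: gauss_def y_def)
  qed
  show ?thesis
    by (rule exI[of _ "c * exp a * b"]) (use main lo pos in \<open>auto simp: c_def b_def\<close>)
qed

text \<open>Integrability is required at the last time \<open>T\<close>; smaller times inherit it.
  Derivatives are taken for \<open>s < T\<close>, where \<open>gauss_bound\<close> has room, and at
  \<open>T\<close> itself only limits in time.\<close>

locale heat_flow =
  fixes f :: "'a::euclidean_space \<Rightarrow> real" and T :: real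
  assumes T_pos: "0 < T"
    and f_meas [measurable]: "f \<in> borel_measurable borel"
    and f_nonneg: "\<And>x. 0 \<le> f x"
    and f_int: "\<And>z. integrable lborel (\<lambda>x. gauss T (z - x) * f x)"
begin

text \<open>\<open>D1\<close> and \<open>D2\<close> are the first and second derivatives of
  \<open>heat s f\<close> in direction \<open>b\<close>, with the differentiation carried out on the
  kernel.\<close>

definition D1 :: "real \<Rightarrow> 'a \<Rightarrow> 'a \<Rightarrow> real" where
  "D1 s b z = (LINT x|lborel. - ((z - x) \<bullet> b / s) * gauss s (z - x) * f x)"

definition D2 :: "real \<Rightarrow> 'a \<Rightarrow> 'a \<Rightarrow> real" where
  "D2 s b z = (LINT x|lborel. (((z - x) \<bullet> b / s)\<^sup>2 - 1 / s) * gauss s (z - x) * f x)"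

text \<open>One integrable majorant for all times in the window, all centres within distance 1 and
  all coefficients of quadratic growth: it serves all the derivatives and the joint
  continuity.\<close>

definition dominates_kernel :: "real \<Rightarrow> real \<Rightarrow> 'a \<Rightarrow> real \<Rightarrow> ('a \<Rightarrow> real) \<Rightarrow> bool" where
  "dominates_kernel lo hi z0 K G \<longleftrightarrow> integrable lborel G \<and>
    (\<forall>s z x c. s \<in> {lo..hi} \<longrightarrow> z \<in> cball z0 1 \<longrightarrow> \<bar>c\<bar> \<le> K * (1 + (norm (z - x))\<^sup>2) \<longrightarrow>
        \<bar>c * gauss s (z - x) * f x\<bar> \<le> G x)"

lemma dominates_kernelD:
  assumes "dominates_kernel lo hi z0 K G"
  shows "integrable lborel G"
    "s \<in> {lo..hi} \<Longrightarrow> z \<in> cball z0 1 \<Longrightarrow> \<bar>c\<bar> \<le> K * (1 + (norm (z - x))\<^sup>2) \<Longrightarrow>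
        \<bar>c * gauss s (z - x) * f x\<bar> \<le> G x"
  using assms unfolding dominates_kernel_def by (blast, blast)

text \<open>For \<open>m = heat s f\<close>, this is \<open>2 * sqrt m * \<Delta>(sqrt m)\<close>.\<close>

abbreviation sqrt_lap :: "real \<Rightarrow> 'a \<Rightarrow> real" where
  "sqrt_lap s z \<equiv> (\<Sum>b\<in>Basis. D2 s b z - (D1 s b z)\<^sup>2 / (2 * heat s f z))"

lemma sqrt_lap_eq: "sqrt_lap s z = (\<Sum>b\<in>Basis. D2 s b z) - (\<Sum>b\<in>Basis. (D1 s b z)\<^sup>2) / (2 * heat s f z)"
  by (simp add: sum_subtractf sum_divide_distrib)

lemma kernel_bound:
  assumes "0 < lo" "lo \<le> hi" "hi < T"
  obtains G where "dominates_kernel lo hi z0 K G"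
proof -
  obtain C where C: "0 \<le> C" "\<And>s z x. s \<in> {lo..hi} \<Longrightarrow> z \<in> cball z0 1 \<Longrightarrow>
     (1 + (norm (z - x))\<^sup>2) * gauss s (z - x) \<le> C * gauss T (z0 - x)"
    using gauss_bound[OF assms, of z0] by blast
  have "dominates_kernel lo hi z0 K (\<lambda>x. \<bar>K\<bar> * C * (gauss T (z0 - x) * f x))"
    unfolding dominates_kernel_def
  proof (intro conjI allI impI)
    show "integrable lborel (\<lambda>x. \<bar>K\<bar> * C * (gauss T (z0 - x) * f x))"
      using f_int by simp
    fix s z x and c :: real
    assume s: "s \<in> {lo..hi}" and z: "z \<in> cball z0 1" and c: "\<bar>c\<bar> \<le> K * (1 + (norm (z - x))\<^sup>2)"
    have g: "0 \<le> gauss s (z - x)"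
      using s assms by (auto intro!: gauss_nonneg)
    have "K * (1 + (norm (z - x))\<^sup>2) \<le> \<bar>K\<bar> * (1 + (norm (z - x))\<^sup>2)"
      by (intro mult_right_mono) auto
    then have "\<bar>c\<bar> * gauss s (z - x) \<le> \<bar>K\<bar> * (1 + (norm (z - x))\<^sup>2) * gauss s (z - x)"
      using c g by (intro mult_right_mono) auto
    also have "\<dots> \<le> \<bar>K\<bar> * (C * gauss T (z0 - x))"
      using C(2)[OF s z, of x] by (simp add: mult.assoc mult_left_mono)
    finally have "\<bar>c\<bar> * gauss s (z - x) * f x \<le> \<bar>K\<bar> * (C * gauss T (z0 - x)) * f x"
      using f_nonneg by (intro mult_right_mono)
    then show "\<bar>c * gauss s (z - x) * f x\<bar> \<le> \<bar>K\<bar> * C * (gauss T (z0 - x) * f x)"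
      using g f_nonneg[of x] by (simp add: abs_mult mult.assoc)
  qed
  then show ?thesis
    by (rule that)
qed

lemma kernel_integrable:
  assumes s: "0 < s" "s < T" and [measurable]: "c \<in> borel_measurable borel"
    and c: "\<And>x. \<bar>c x\<bar> \<le> K * (1 + (norm (z - x))\<^sup>2)"
  shows "integrable lborel (\<lambda>x. c x * gauss s (z - x) * f x)"
proof -
  obtain G where G: "dominates_kernel s s z K G"
    by (rule kernel_bound[OF s(1) order_refl s(2), of z K])
  note G = dominates_kernelD[OF G]
  show ?thesis
  proof (rule Bochner_Integration.integrable_bound[OF G(1)])
    show "AE x in lborel. norm (c x * gauss s (z - x) * f x) \<le> norm (G x)"
    proof (rule AE_I2)
      fix x
      show "norm (c x * gauss s (z - x) * f x) \<le> norm (G x)"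
        using G(2)[of s z "c x" x, OF _ _ c] by simp
    qed
  qed measurable
qed

lemma f_int_less:
  assumes "0 < s" "s \<le> T"
  shows "integrable lborel (\<lambda>x. gauss s (z - x) * f x)"
proof (cases "s = T")
  case False
  have "integrable lborel (\<lambda>x. 1 * gauss s (z - x) * f x)"
    by (rule kernel_integrable[where K=1]) (use assms False in auto)
  then show ?thesis
    by simp
qed (simp add: f_int)

lemma coef1_bound:
  fixes y :: 'a
  assumes "0 < s" "b \<in> Basis"
  shows "\<bar>- (y \<bullet> b / s)\<bar> \<le> 1 / s * (1 + (norm y)\<^sup>2)"
proof -
  have "\<bar>y \<bullet> b\<bar> \<le> norm y"
    using assms by (simp add: Basis_le_norm)
  also have "\<dots> \<le> 1 + (norm y)\<^sup>2"
  proof -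
    have "(0::real) \<le> n" "2 * n \<le> 1 + n\<^sup>2 \<Longrightarrow> n \<le> 1 + n\<^sup>2" if "0 \<le> n" for n :: real
      using that by auto
    moreover have "2 * n \<le> 1 + n\<^sup>2" for n :: real
      using zero_le_power2[of "n - 1"] by (simp add: power2_diff)
    ultimately show ?thesis
      using norm_ge_zero by blast
  qed
  finally show ?thesis
    using assms by (simp add: field_simps)
qed

lemma coef2_bound:
  fixes y :: 'a
  assumes "0 < s" "b \<in> Basis"
  shows "\<bar>(y \<bullet> b / s)\<^sup>2 - 1 / s\<bar> \<le> max (1 / s\<^sup>2) (1 / s) * (1 + (norm y)\<^sup>2)"
proof -
  have "(y \<bullet> b)\<^sup>2 \<le> (norm y)\<^sup>2"
    using assms by (metis Basis_le_norm abs_ge_zero power2_abs power_mono)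
  then have "(y \<bullet> b / s)\<^sup>2 \<le> 1 / s\<^sup>2 * (norm y)\<^sup>2"
    using assms by (simp add: power_divide divide_right_mono)
  also have "\<dots> \<le> max (1 / s\<^sup>2) (1 / s) * (norm y)\<^sup>2"
    by (intro mult_right_mono) auto
  finally have "(y \<bullet> b / s)\<^sup>2 \<le> max (1 / s\<^sup>2) (1 / s) * (norm y)\<^sup>2" .
  moreover have "\<bar>(y \<bullet> b / s)\<^sup>2 - 1 / s\<bar> \<le> (y \<bullet> b / s)\<^sup>2 + 1 / s"
    using assms by (simp add: abs_le_iff)
  ultimately show ?thesis
    by (simp add: algebra_simps)
qed

lemma gauss_line_deriv:
  fixes z x b :: 'a
  assumes "0 < s" "b \<in> Basis"
  shows "((\<lambda>r. gauss s (z + r *\<^sub>R b - x)) has_real_derivative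
     - ((z + r *\<^sub>R b - x) \<bullet> b / s) * gauss s (z + r *\<^sub>R b - x)) (at r)"
proof -
  have quad: "(norm (u + r *\<^sub>R b))\<^sup>2 = (norm u)\<^sup>2 + 2 * r * (u \<bullet> b) + r\<^sup>2" for u and r :: real
    using assms(2) unfolding power2_norm_eq_inner
    by (simp add: inner_add_left inner_add_right inner_commute[of b u] power2_eq_square algebra_simps)
  have eq: "gauss s (z + r *\<^sub>R b - x) = exp (- ((norm (z - x))\<^sup>2 + 2 * r * ((z - x) \<bullet> b) + r\<^sup>2) / (2 * s)
       - real DIM('a) / 2 * ln (2 * pi * s))" for r
  proof -
    have "z + r *\<^sub>R b - x = (z - x) + r *\<^sub>R b"
      by simp
    then have "(norm (z + r *\<^sub>R b - x))\<^sup>2 = (norm (z - x + r *\<^sub>R b))\<^sup>2"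
      by (rule arg_cong)
    also have "\<dots> = (norm (z - x))\<^sup>2 + 2 * r * ((z - x) \<bullet> b) + r\<^sup>2"
      using quad .
    finally show ?thesis
      unfolding gauss_eq_exp[OF assms(1)] by (rule arg_cong)
  qed
  have i: "(z + r *\<^sub>R b - x) \<bullet> b = (z - x) \<bullet> b + r"
    using assms by (simp add: inner_simps inner_Basis)
  show ?thesis
    unfolding eq i using assms
    by (auto intro!: derivative_eq_intros simp: field_simps)
qed

lemma heat_line_deriv:
  assumes s: "0 < s" "s < T" and b: "b \<in> Basis"
  shows "((\<lambda>r. heat s f (z + r *\<^sub>R b)) has_real_derivative D1 s b z) (at 0)"
proof -
  let ?y = "\<lambda>r x. z + r *\<^sub>R b - x"
  obtain G where G: "dominates_kernel s s z (1 / s) G"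
    by (rule kernel_bound[OF s(1) order_refl s(2), of z "1 / s"])
  note G = dominates_kernelD[OF G]
  have "((\<lambda>r. LINT x|lborel. gauss s (?y r x) * f x) has_real_derivative
     (LINT x|lborel. - ((z + 0 *\<^sub>R b - x) \<bullet> b / s) * gauss s (z + 0 *\<^sub>R b - x) * f x)) (at 0)"
  proof (rule has_real_derivative_integral[OF zero_less_one _ _ _ G(1)])
    fix r :: real and x
    assume r: "\<bar>r - 0\<bar> < 1"
    show "((\<lambda>r. gauss s (?y r x) * f x) has_real_derivative
        - ((?y r x) \<bullet> b / s) * gauss s (?y r x) * f x) (at r)"
      by (intro DERIV_cmult_right gauss_line_deriv s b)
    show "\<bar>- ((?y r x) \<bullet> b / s) * gauss s (?y r x) * f x\<bar> \<le> G x"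
      using r s b by (intro G(2) coef1_bound) (auto simp: dist_norm)
  qed (use f_int_less s in auto)
  then show ?thesis
    by (simp add: heat_def D1_def)
qed

lemma heat_line_deriv2:
  assumes s: "0 < s" "s < T" and b: "b \<in> Basis"
  shows "((\<lambda>r. D1 s b (z + r *\<^sub>R b)) has_real_derivative D2 s b z) (at 0)"
proof -
  let ?y = "\<lambda>r x. z + r *\<^sub>R b - x"
  define K where "K = max (1 / s\<^sup>2) (1 / s)"
  obtain G where G: "dominates_kernel s s z K G"
    by (rule kernel_bound[OF s(1) order_refl s(2), of z K])
  note G = dominates_kernelD[OF G]
  have "((\<lambda>r. LINT x|lborel. - ((?y r x) \<bullet> b / s) * gauss s (?y r x) * f x) has_real_derivative
     (LINT x|lborel. (((z + 0 *\<^sub>R b - x) \<bullet> b / s)\<^sup>2 - 1 / s) * gauss s (z + 0 *\<^sub>R b - x) * f x)) (at 0)"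
  proof (rule has_real_derivative_integral[OF zero_less_one _ _ _ G(1)])
    fix r :: real and x
    assume r: "\<bar>r - 0\<bar> < 1"
    have alg: "- (1 / s) * g + - (A / s) * g * - (A / s) = ((A / s)\<^sup>2 - 1 / s) * g" for A g :: real
      by (simp add: algebra_simps power2_eq_square)
    have "((\<lambda>r. - ((?y r x) \<bullet> b / s)) has_real_derivative - (1 / s)) (at r)"
      using b s by (auto intro!: derivative_eq_intros simp: inner_simps inner_Basis)
    from DERIV_mult[OF this gauss_line_deriv[OF s(1) b, of z x r]]
    have "((\<lambda>r. - ((?y r x) \<bullet> b / s) * gauss s (?y r x)) has_real_derivative
        (((?y r x) \<bullet> b / s)\<^sup>2 - 1 / s) * gauss s (?y r x)) (at r)"
      unfolding alg .
    then show "((\<lambda>r. - ((?y r x) \<bullet> b / s) * gauss s (?y r x) * f x) has_real_derivative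
        (((?y r x) \<bullet> b / s)\<^sup>2 - 1 / s) * gauss s (?y r x) * f x) (at r)"
      by (rule DERIV_cmult_right)
    show "\<bar>(((?y r x) \<bullet> b / s)\<^sup>2 - 1 / s) * gauss s (?y r x) * f x\<bar> \<le> G x"
      using r s b by (intro G(2) coef2_bound[OF s(1) b, folded K_def]) (auto simp: dist_norm)
  next
    fix r :: real
    show "integrable lborel (\<lambda>x. - ((?y r x) \<bullet> b / s) * gauss s (?y r x) * f x)"
      by (rule kernel_integrable[OF s _ coef1_bound[OF s(1) b]]) measurable
  qed
  then show ?thesis
    by (simp add: D1_def D2_def)
qed

text \<open>The coefficient on the right is the \<open>s\<close>-derivative of
  \<open>ln (gauss s (z - x))\<close>, so this is the heat equation of the kernel in integrated
  form.\<close>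

lemma sum_D2:
  assumes s: "0 < s" "s < T"
  shows "(\<Sum>b\<in>Basis. D2 s b z)
    = 2 * (LINT x|lborel. ((norm (z - x))\<^sup>2 / (2 * s\<^sup>2) - real DIM('a) / (2 * s)) * gauss s (z - x) * f x)"
proof -
  have "(\<Sum>b\<in>Basis. D2 s b z) = (LINT x|lborel. (\<Sum>b\<in>Basis. (((z - x) \<bullet> b / s)\<^sup>2 - 1 / s) * gauss s (z - x) * f x))"
    unfolding D2_def
    by (subst Bochner_Integration.integral_sum) (auto intro!: kernel_integrable[OF s _ coef2_bound[OF s(1)]])
  also have "\<dots> = (LINT x|lborel. 2 * (((norm (z - x))\<^sup>2 / (2 * s\<^sup>2) - real DIM('a) / (2 * s)) * gauss s (z - x) * f x))"
  proof (rule Bochner_Integration.integral_cong[OF refl])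
    fix x
    have sm: "(\<Sum>b\<in>Basis. ((z - x) \<bullet> b / s)\<^sup>2 - 1 / s) = (norm (z - x))\<^sup>2 / s\<^sup>2 - real DIM('a) / s"
      unfolding power2_norm_eq_inner euclidean_inner[of "z - x" "z - x"]
      by (simp add: sum_subtractf power_divide sum_divide_distrib power2_eq_square)
    show "(\<Sum>b\<in>Basis. (((z - x) \<bullet> b / s)\<^sup>2 - 1 / s) * gauss s (z - x) * f x)
       = 2 * (((norm (z - x))\<^sup>2 / (2 * s\<^sup>2) - real DIM('a) / (2 * s)) * gauss s (z - x) * f x)"
      unfolding sum_distrib_right[symmetric] sm by (simp add: field_simps)
  qed
  finally show ?thesis
    by simp
qed

lemma heat_time_deriv:
  assumes s: "0 < s" "s < T"
  shows "((\<lambda>s. heat s f z) has_real_derivative (\<Sum>b\<in>Basis. D2 s b z) / 2) (at s)"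
proof -
  \<comment> \<open>Half the distances to 0 and \<open>T\<close> keep the window
    \<open>{lo..hi}\<close> inside the range of \<open>kernel_bound\<close>.\<close>
  define d where "d = min (s / 2) ((T - s) / 2)"
  define lo hi where "lo = s - d" and "hi = s + d"
  have d: "0 < d" "0 < lo" "lo \<le> hi" "hi < T"
    using s by (auto simp: d_def lo_def hi_def min_def field_simps)
  define n where "n = real DIM('a)"
  define K where "K = max (1 / (2 * lo\<^sup>2)) (n / (2 * lo))"
  obtain G where G: "dominates_kernel lo hi z K G"
    by (rule kernel_bound[OF d(2-4), of z K])
  note G = dominates_kernelD[OF G]
  have c: "\<bar>(norm y)\<^sup>2 / (2 * r\<^sup>2) - n / (2 * r)\<bar> \<le> K * (1 + (norm y)\<^sup>2)" if r: "r \<in> {lo..hi}" for r and y :: 'a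
  proof -
    have r0: "0 < r"
      using r d by auto
    have "(norm y)\<^sup>2 / (2 * r\<^sup>2) \<le> 1 / (2 * lo\<^sup>2) * (norm y)\<^sup>2"
      using r d by (auto intro!: divide_left_mono power_mono)
    also have "\<dots> \<le> K * (norm y)\<^sup>2"
      by (intro mult_right_mono) (auto simp: K_def)
    finally have 1: "(norm y)\<^sup>2 / (2 * r\<^sup>2) \<le> K * (norm y)\<^sup>2" .
    have "n / (2 * r) \<le> n / (2 * lo)"
      using r d by (intro divide_left_mono) (auto simp: n_def)
    then have 2: "n / (2 * r) \<le> K"
      by (simp add: K_def)
    have "\<bar>(norm y)\<^sup>2 / (2 * r\<^sup>2) - n / (2 * r)\<bar> \<le> (norm y)\<^sup>2 / (2 * r\<^sup>2) + n / (2 * r)"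
      using r0 by (simp add: abs_le_iff n_def)
    with 1 2 show ?thesis
      by (simp add: algebra_simps)
  qed
  have der: "((\<lambda>r. LINT x|lborel. gauss r (z - x) * f x) has_real_derivative
     (LINT x|lborel. ((norm (z - x))\<^sup>2 / (2 * s\<^sup>2) - n / (2 * s)) * gauss s (z - x) * f x)) (at s)"
  proof (rule has_real_derivative_integral[OF d(1) _ _ _ G(1)])
    fix r :: real and x
    assume "\<bar>r - s\<bar> < d"
    then have r: "r \<in> {lo..hi}" "0 < r" "r \<le> T"
      using d by (auto simp: lo_def hi_def)
    show "integrable lborel (\<lambda>x. gauss r (z - x) * f x)"
      using f_int_less r by simp
    have "((\<lambda>s. exp (- (norm (z - x))\<^sup>2 / (2 * s) - real DIM('a) / 2 * ln (2 * pi * s))) has_real_derivative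
       ((norm (z - x))\<^sup>2 / (2 * r\<^sup>2) - n / (2 * r)) * gauss r (z - x)) (at r)"
      unfolding gauss_eq_exp[OF r(2)] using r
      by (auto intro!: derivative_eq_intros simp: n_def field_simps power2_eq_square)
    then have "((\<lambda>s. gauss s (z - x)) has_real_derivative
       ((norm (z - x))\<^sup>2 / (2 * r\<^sup>2) - n / (2 * r)) * gauss r (z - x)) (at r)"
    proof (rule has_field_derivative_transform_within_open[where S="{0<..}"])
      show "exp (- (norm (z - x))\<^sup>2 / (2 * y) - real DIM('a) / 2 * ln (2 * pi * y)) = gauss y (z - x)"
        if "y \<in> {0<..}" for y
        using that by (simp add: gauss_eq_exp)
    qed (use r in auto)
    then show "((\<lambda>r. gauss r (z - x) * f x) has_real_derivative
       ((norm (z - x))\<^sup>2 / (2 * r\<^sup>2) - n / (2 * r)) * gauss r (z - x) * f x) (at r)"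
      by (rule DERIV_cmult_right)
    show "\<bar>((norm (z - x))\<^sup>2 / (2 * r\<^sup>2) - n / (2 * r)) * gauss r (z - x) * f x\<bar> \<le> G x"
      using r by (intro G(2) c) auto
  qed
  show ?thesis
    using der by (simp add: heat_def[abs_def] sum_D2[OF s] n_def)
qed

lemma heat_continuous: "continuous_on (UNIV \<times> {0<..<T}) (\<lambda>(z, s). heat s f z)"
proof (rule continuous_on_sequentiallyI, clarsimp)
  fix u :: "nat \<Rightarrow> 'a \<times> real" and z s
  assume u: "\<forall>n. u n \<in> UNIV \<times> {0<..<T}" and lim: "u \<longlonglongrightarrow> (z, s)" and s: "0 < s" "s < T"
  let ?k = "\<lambda>n x. gauss (snd (u n)) (fst (u n) - x) * f x"
  define lo hi where "lo = s / 2" and "hi = (s + T) / 2"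
  have d: "0 < lo" "lo \<le> hi" "hi < T" "lo < s" "s < hi"
    using s by (auto simp: lo_def hi_def)
  obtain G where G: "dominates_kernel lo hi z 1 G"
    by (rule kernel_bound[OF d(1-3), of z 1])
  note G = dominates_kernelD[OF G]
  have l1: "(\<lambda>n. fst (u n)) \<longlonglongrightarrow> z" and l2: "(\<lambda>n. snd (u n)) \<longlonglongrightarrow> s"
    using tendsto_fst[OF lim] tendsto_snd[OF lim] by auto
  have "\<forall>\<^sub>F n in sequentially. fst (u n) \<in> cball z 1"
    using tendstoD[OF l1 zero_less_one] by eventually_elim (simp add: dist_commute)
  moreover have "\<forall>\<^sub>F n in sequentially. snd (u n) \<in> {lo<..<hi}"
    using l2 by (rule topological_tendstoD) (use d in auto)
  ultimately have ev: "\<forall>\<^sub>F n in sequentially. fst (u n) \<in> cball z 1 \<and> snd (u n) \<in> {lo..hi}"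
    by eventually_elim auto
  obtain N where N: "\<And>n. N \<le> n \<Longrightarrow> fst (u n) \<in> cball z 1 \<and> snd (u n) \<in> {lo..hi}"
    using ev unfolding eventually_sequentially by blast
  have "(\<lambda>n. LINT x|lborel. ?k (n + N) x)
     \<longlonglongrightarrow> (LINT x|lborel. gauss s (z - x) * f x)"
  proof (rule integral_dominated_convergence[OF _ _ G(1)])
    have l1': "(\<lambda>n. fst (u (n + N))) \<longlonglongrightarrow> z" and l2': "(\<lambda>n. snd (u (n + N))) \<longlonglongrightarrow> s"
      by (rule LIMSEQ_ignore_initial_segment[OF l1], rule LIMSEQ_ignore_initial_segment[OF l2])
    show "AE x in lborel. (\<lambda>n. ?k (n + N) x) \<longlonglongrightarrow> gauss s (z - x) * f x"
      unfolding gauss_def using s by (intro AE_I2 tendsto_intros l1' l2') auto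
    show "AE x in lborel. norm (?k (n + N) x) \<le> G x" for n
      using G(2)[of "snd (u (n + N))" "fst (u (n + N))" 1] N[of "n + N"] by auto
  qed measurable
  then have "(\<lambda>n. LINT x|lborel. ?k n x)
     \<longlonglongrightarrow> (LINT x|lborel. gauss s (z - x) * f x)"
    by (rule LIMSEQ_offset)
  then show "(\<lambda>n. case u n of (z, s) \<Rightarrow> heat s f z) \<longlonglongrightarrow> heat s f z"
    by (simp add: heat_def case_prod_beta)
qed

text \<open>The limit may be \<open>T\<close>, where \<open>gauss_bound\<close> gives nothing. But
  with \<open>z\<close> fixed and no polynomial factor there is nothing to pay for: for variances
  between \<open>lo\<close> and \<open>T\<close> the kernel is at most a constant times that of
  \<open>T\<close>.\<close>

lemma heat_tendsto_time:
  assumes S: "S \<longlonglongrightarrow> s" "\<And>n. 0 < S n" "\<And>n. S n \<le> T" and s: "0 < s"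
  shows "(\<lambda>n. heat (S n) f z) \<longlonglongrightarrow> heat s f z"
proof -
  define lo where "lo = s / 2"
  have lo: "0 < lo" "lo < s"
    using s by (auto simp: lo_def)
  have "\<forall>\<^sub>F n in sequentially. lo < S n"
    using S(1) lo by (auto intro: order_tendstoD)
  then obtain N where N: "\<And>n. N \<le> n \<Longrightarrow> lo < S n"
    unfolding eventually_sequentially by blast
  have "(\<lambda>n. LINT x|lborel. gauss (S (n + N)) (z - x) * f x) \<longlonglongrightarrow> (LINT x|lborel. gauss s (z - x) * f x)"
  proof (rule integral_dominated_convergence)
    define b where "b = sqrt ((2 * pi * T) ^ DIM('a)) / sqrt ((2 * pi * lo) ^ DIM('a))"
    show "integrable lborel (\<lambda>x. b * (gauss T (z - x) * f x))"
      using f_int by simp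
    show "AE x in lborel. (\<lambda>n. gauss (S (n + N)) (z - x) * f x) \<longlonglongrightarrow> gauss s (z - x) * f x"
      unfolding gauss_def using s by (intro AE_I2 tendsto_intros LIMSEQ_ignore_initial_segment[OF S(1)]) auto
    show "AE x in lborel. norm (gauss (S (n + N)) (z - x) * f x) \<le> b * (gauss T (z - x) * f x)" for n
    proof (rule AE_I2)
      fix x
      have "(norm (z - x))\<^sup>2 / (2 * T) \<le> (norm (z - x))\<^sup>2 / (2 * S (n + N))"
        using S by (intro divide_left_mono) (auto simp: T_pos)
      then have "exp (- (norm (z - x))\<^sup>2 / (2 * S (n + N))) / sqrt ((2 * pi * S (n + N)) ^ DIM('a))
        \<le> exp (- (norm (z - x))\<^sup>2 / (2 * T)) / sqrt ((2 * pi * lo) ^ DIM('a))"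
        using lo N[of "n + N"] by (intro frac_le) (auto intro!: power_mono)
      also have "\<dots> = b * gauss T (z - x)"
        using T_pos by (simp add: b_def gauss_def)
      finally have "gauss (S (n + N)) (z - x) \<le> b * gauss T (z - x)"
        by (simp add: gauss_def)
      then have "gauss (S (n + N)) (z - x) * f x \<le> b * gauss T (z - x) * f x"
        by (intro mult_right_mono f_nonneg)
      then show "norm (gauss (S (n + N)) (z - x) * f x) \<le> b * (gauss T (z - x) * f x)"
        using S(2) f_nonneg[of x] by (simp add: gauss_nonneg mult.assoc)
    qed
  qed measurable
  then have "(\<lambda>n. LINT x|lborel. gauss (S n) (z - x) * f x) \<longlonglongrightarrow> (LINT x|lborel. gauss s (z - x) * f x)"
    by (rule LIMSEQ_offset)
  then show ?thesis
    by (simp add: heat_def)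
qed

end

section \<open>The minimum principle for the backward heat equation\<close>

text \<open>Derivatives are requested at parameter 0 but at every base point; translation gives them
  along whole lines. Only pure second partials occur, since only Laplacians are formed.\<close>

definition has_partials ::
  "('a::euclidean_space \<Rightarrow> real) \<Rightarrow> ('a \<Rightarrow> 'a \<Rightarrow> real) \<Rightarrow> ('a \<Rightarrow> 'a \<Rightarrow> real) \<Rightarrow> bool" where
  "has_partials f g h \<longleftrightarrow> (\<forall>b\<in>Basis. \<forall>z.
     ((\<lambda>r. f (z + r *\<^sub>R b)) has_real_derivative g b z) (at 0) \<and>
     ((\<lambda>r. g b (z + r *\<^sub>R b)) has_real_derivative h b z) (at 0))"

lemma has_partialsD:
  assumes "has_partials f g h" "b \<in> Basis"
  shows "((\<lambda>r. f (z + r *\<^sub>R b)) has_real_derivative g b (z + r *\<^sub>R b)) (at r)"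
    and "((\<lambda>r. g b (z + r *\<^sub>R b)) has_real_derivative h b (z + r *\<^sub>R b)) (at r)"
proof -
  have *: "z + r *\<^sub>R b + t *\<^sub>R b = z + (t + r) *\<^sub>R b" for t
    by (simp add: algebra_simps)
  have "((\<lambda>t. f (z + r *\<^sub>R b + t *\<^sub>R b)) has_real_derivative g b (z + r *\<^sub>R b)) (at 0)"
    "((\<lambda>t. g b (z + r *\<^sub>R b + t *\<^sub>R b)) has_real_derivative h b (z + r *\<^sub>R b)) (at 0)"
    using assms unfolding has_partials_def by blast+
  then show "((\<lambda>r. f (z + r *\<^sub>R b)) has_real_derivative g b (z + r *\<^sub>R b)) (at r)"
    "((\<lambda>r. g b (z + r *\<^sub>R b)) has_real_derivative h b (z + r *\<^sub>R b)) (at r)"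
    unfolding * using DERIV_shift[of "\<lambda>r. f (z + r *\<^sub>R b)" _ 0 r] DERIV_shift[of "\<lambda>r. g b (z + r *\<^sub>R b)" _ 0 r]
    by simp_all
qed

lemma has_partials_add:
  "has_partials f g h \<Longrightarrow> has_partials f' g' h' \<Longrightarrow>
   has_partials (\<lambda>z. f z + f' z) (\<lambda>b z. g b z + g' b z) (\<lambda>b z. h b z + h' b z)"
  unfolding has_partials_def by (simp add: DERIV_add)

lemma has_partials_diff:
  "has_partials f g h \<Longrightarrow> has_partials f' g' h' \<Longrightarrow>
   has_partials (\<lambda>z. f z - f' z) (\<lambda>b z. g b z - g' b z) (\<lambda>b z. h b z - h' b z)"
  unfolding has_partials_def by (simp add: DERIV_diff)

lemma has_partials_quadratic:
  "has_partials (\<lambda>z. c + e * (norm z)\<^sup>2) (\<lambda>b z. 2 * e * (z \<bullet> b)) (\<lambda>_ _. 2 * e)"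
  unfolding has_partials_def
proof (intro ballI allI conjI)
  fix b z :: 'a assume b: "b \<in> Basis"
  have "(norm (z + r *\<^sub>R b))\<^sup>2 = (norm z)\<^sup>2 + 2 * r * (z \<bullet> b) + r\<^sup>2" for r
    using b unfolding power2_norm_eq_inner
    by (simp add: inner_add_left inner_add_right inner_commute[of b z] power2_eq_square algebra_simps)
  then show "((\<lambda>r. c + e * (norm (z + r *\<^sub>R b))\<^sup>2) has_real_derivative 2 * e * (z \<bullet> b)) (at 0)"
    by (auto intro!: derivative_eq_intros)
  show "((\<lambda>r. 2 * e * ((z + r *\<^sub>R b) \<bullet> b)) has_real_derivative 2 * e) (at 0)"
    using b by (auto intro!: derivative_eq_intros simp: inner_add_left)
qed

lemma has_partials_ln:
  assumes "has_partials f g h" and pos: "\<And>z. 0 < f z"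
  shows "has_partials (\<lambda>z. ln (f z)) (\<lambda>b z. g b z / f z) (\<lambda>b z. h b z / f z - (g b z / f z)\<^sup>2)"
  unfolding has_partials_def
proof (intro ballI allI conjI)
  fix b z :: 'a assume b: "b \<in> Basis"
  note d = has_partialsD[OF assms(1) b, of z 0, simplified]
  have p: "f z \<noteq> 0" "0 < f z"
    using pos[of z] by auto
  show "((\<lambda>r. ln (f (z + r *\<^sub>R b))) has_real_derivative g b z / f z) (at 0)"
    using p by (auto intro!: derivative_eq_intros d)
  show "((\<lambda>r. g b (z + r *\<^sub>R b) / f (z + r *\<^sub>R b)) has_real_derivative h b z / f z - (g b z / f z)\<^sup>2) (at 0)"
    by (rule DERIV_cong[OF DERIV_divide[OF d(2) d(1)]])
       (use p in \<open>auto simp: power2_eq_square field_simps\<close>)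
qed

lemma has_partials_sqrt:
  assumes "has_partials f g h" and pos: "\<And>z. 0 < f z"
  shows "has_partials (\<lambda>z. sqrt (f z)) (\<lambda>b z. g b z / (2 * sqrt (f z)))
    (\<lambda>b z. (h b z - (g b z)\<^sup>2 / (2 * f z)) / (2 * sqrt (f z)))"
  unfolding has_partials_def
proof (intro ballI allI conjI)
  fix b z :: 'a assume b: "b \<in> Basis"
  note d = has_partialsD[OF assms(1) b, of z 0, simplified]
  have p: "f z \<noteq> 0" "0 < f z" "sqrt (f z) \<noteq> 0"
    using pos[of z] by auto
  have sq: "((\<lambda>r. sqrt (f (z + r *\<^sub>R b))) has_real_derivative g b z / (2 * sqrt (f z))) (at 0)"
    using p by (auto intro!: derivative_eq_intros d simp: field_simps)
  then show "((\<lambda>r. sqrt (f (z + r *\<^sub>R b))) has_real_derivative g b z / (2 * sqrt (f z))) (at 0)" .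
  define q where "q = sqrt (f z)"
  have q: "f z = q * q" "q \<noteq> 0"
    using p by (auto simp: q_def)
  show "((\<lambda>r. g b (z + r *\<^sub>R b) / (2 * sqrt (f (z + r *\<^sub>R b)))) has_real_derivative
      (h b z - (g b z)\<^sup>2 / (2 * f z)) / (2 * sqrt (f z))) (at 0)"
    by (rule DERIV_cong[OF DERIV_divide[OF d(2) DERIV_cmult[OF sq]]])
       (use q(2) in \<open>auto simp: q_def[symmetric] q(1) power2_eq_square field_simps\<close>)
qed

text \<open>Were \<open>c < 0\<close>, then \<open>f'\<close>, which vanishes at the minimum, would
  be negative just to the right, and \<open>f\<close> would drop below \<open>f 0\<close>.\<close>

lemma second_deriv_nonneg_at_min:
  fixes f f' :: "real \<Rightarrow> real"
  assumes d: "0 < d" and min: "\<And>r. \<bar>r\<bar> < d \<Longrightarrow> f 0 \<le> f r"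
    and f: "\<And>r. (f has_real_derivative f' r) (at r)"
    and f': "(f' has_real_derivative c) (at 0)"
  shows "0 \<le> c"
proof (rule ccontr)
  assume "\<not> 0 \<le> c"
  then obtain e where e: "0 < e" "\<And>h. 0 < h \<Longrightarrow> h < e \<Longrightarrow> f' (0 + h) < f' 0"
    using DERIV_neg_dec_right[OF f'] by force
  have 0: "f' 0 = 0"
    by (rule DERIV_local_min[OF f d]) (use min in auto)
  define h where "h = min d e / 2"
  have h: "0 < h" "h < d" "h < e"
    using d e by (auto simp: h_def)
  have "f h < f 0"
  proof (rule DERIV_neg_imp_decreasing_open[OF h(1)])
    show "\<exists>y. (f has_real_derivative y) (at x) \<and> y < 0" if "0 < x" "x < h" for x
      using f[of x] e(2)[of x] that h 0 by auto
    show "continuous_on {0..h} f"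
      using f by (intro continuous_at_imp_continuous_on ballI DERIV_isCont) auto
  qed
  then show False
    using min[of h] h by auto
qed

text \<open>A negative minimum over the cylinder can lie neither at time \<open>s1\<close> nor
  beyond radius \<open>R\<close>. Anywhere else the spatial second derivatives and the time
  derivative are nonnegative at it, against the strict inequality. Data are given at the upper end
  because the equation runs backwards.\<close>

lemma min_principle:
  fixes \<Phi> :: "'a::euclidean_space \<Rightarrow> real \<Rightarrow> real"
  assumes s01: "s0 \<le> s1"
    and cont: "continuous_on (UNIV \<times> {s0..s1}) (\<lambda>(z, s). \<Phi> z s)"
    and part: "\<And>s. s \<in> {s0..<s1} \<Longrightarrow> has_partials (\<lambda>z. \<Phi> z s) (G s) (H s)"
    and time: "\<And>s z. s \<in> {s0..<s1} \<Longrightarrow> ((\<lambda>s. \<Phi> z s) has_real_derivative Dt s z) (at s)"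
    and super: "\<And>s z. s \<in> {s0..<s1} \<Longrightarrow> Dt s z + (\<Sum>b\<in>Basis. H s b z) / 2 < 0"
    and terminal: "\<And>z. 0 \<le> \<Phi> z s1"
    and far: "\<And>z s. s \<in> {s0..s1} \<Longrightarrow> R \<le> norm z \<Longrightarrow> 0 \<le> \<Phi> z s"
  shows "0 \<le> \<Phi> z s0"
proof (rule ccontr)
  assume neg: "\<not> 0 \<le> \<Phi> z s0"
  \<comment> \<open>The ball has to contain \<open>z\<close>, so that the minimum over the cylinder
    is negative.\<close>
  define R' where "R' = max R (norm z)"
  have "compact (cball (0::'a) R' \<times> {s0..s1})" "cball (0::'a) R' \<times> {s0..s1} \<noteq> {}"
    using s01 by (auto intro!: compact_Times simp: R'_def le_max_iff_disj)
  then have "\<exists>p\<in>cball (0::'a) R' \<times> {s0..s1}. \<forall>q\<in>cball (0::'a) R' \<times> {s0..s1}.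
      (\<lambda>(z, s). \<Phi> z s) p \<le> (\<lambda>(z, s). \<Phi> z s) q"
    by (rule continuous_attains_inf) (auto intro!: continuous_on_subset[OF cont])
  then obtain p where p: "p \<in> cball 0 R' \<times> {s0..s1}"
    and pmin: "\<And>q. q \<in> cball 0 R' \<times> {s0..s1} \<Longrightarrow> (\<lambda>(z, s). \<Phi> z s) p \<le> (\<lambda>(z, s). \<Phi> z s) q"
    by blast
  obtain y s where ps: "p = (y, s)"
    by (cases p)
  have le: "\<Phi> y s \<le> \<Phi> x t" if "norm x \<le> R'" "t \<in> {s0..s1}" for x t
    using pmin[of "(x, t)"] that by (auto simp: ps)
  have "\<Phi> y s \<le> \<Phi> z s0"
    by (rule le) (use s01 in \<open>auto simp: R'_def\<close>)
  with neg have lt0: "\<Phi> y s < 0"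
    by simp
  have s: "s \<in> {s0..<s1}"
    using p ps terminal[of y] lt0 by (cases "s = s1") auto
  have y: "norm y < R'"
    using far[of s y] lt0 s by (cases "R \<le> norm y") (auto simp: R'_def)
  have "0 \<le> H s b y" if b: "b \<in> Basis" for b
  proof (rule second_deriv_nonneg_at_min[where f="\<lambda>r. \<Phi> (y + r *\<^sub>R b) s" and f'="\<lambda>r. G s b (y + r *\<^sub>R b)"])
    show "0 < R' - norm y"
      using y by simp
    show "\<Phi> (y + 0 *\<^sub>R b) s \<le> \<Phi> (y + r *\<^sub>R b) s" if "\<bar>r\<bar> < R' - norm y" for r
      using le[of "y + r *\<^sub>R b" s] norm_triangle_ineq[of y "r *\<^sub>R b"] b that s by auto
    show "((\<lambda>r. G s b (y + r *\<^sub>R b)) has_real_derivative H s b y) (at 0)"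
      using has_partialsD(2)[OF part[OF s] b, of y 0] by simp
  qed (rule has_partialsD[OF part[OF s] b])
  then have "0 \<le> (\<Sum>b\<in>Basis. H s b y)"
    by (rule sum_nonneg)
  \<comment> \<open>The minimum may sit at the initial time \<open>s0\<close>, so it is compared
    with later times only.\<close>
  moreover have "0 \<le> Dt s y"
  proof (rule ccontr)
    assume "\<not> 0 \<le> Dt s y"
    then obtain e where e: "0 < e" "\<And>h. 0 < h \<Longrightarrow> h < e \<Longrightarrow> \<Phi> y (s + h) < \<Phi> y s"
      using DERIV_neg_dec_right[OF time[OF s, of y]] by force
    define h where "h = min e (s1 - s) / 2"
    have "0 < h" "h < e" "s + h \<in> {s0..s1}"
      using e(1) s by (auto simp: h_def min_def field_simps)
    then show False
      using e(2)[of h] le[of y "s + h"] y by auto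
  qed
  ultimately show False
    using super[OF s, of y] by simp
qed

text \<open>Substitution with the kernel fixed at variance 1. The right-hand side makes sense at
  \<open>s = 0\<close>, where it is \<open>g z\<close>; this gives continuity up to the terminal
  time and the approximate identity.\<close>

lemma heat_rescale:
  fixes g :: "'a::euclidean_space \<Rightarrow> real"
  assumes s: "0 < s" and [measurable]: "g \<in> borel_measurable borel"
  shows "heat s g z = (LINT x|lborel. gauss 1 x * g (z - sqrt s *\<^sub>R x))"
proof -
  have c: "- sqrt s \<noteq> 0"
    using s by simp
  have g: "sqrt s ^ DIM('a) * gauss s (sqrt s *\<^sub>R x) = gauss 1 x" for x :: 'a
    using s by (simp add: gauss_def power_mult_distrib real_sqrt_mult real_sqrt_power)
  have "heat s g z = (LINT x|density (distr lborel borel (\<lambda>x. z + (- sqrt s) *\<^sub>R x))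
      (\<lambda>_. \<bar>- sqrt s\<bar> ^ DIM('a)). gauss s (z - x) * g x)"
    unfolding heat_def by (subst lborel_affine[OF c, of z]) simp
  also have "\<dots> = (LINT x|lborel. sqrt s ^ DIM('a) * gauss s (sqrt s *\<^sub>R x) * g (z - sqrt s *\<^sub>R x))"
    using s by (subst integral_density, simp, simp, simp, subst integral_distr) (auto simp: mult.assoc)
  finally show ?thesis
    unfolding g .
qed

lemma heat_flow_bounded:
  fixes g :: "'a::euclidean_space \<Rightarrow> real"
  assumes "0 < T" and [measurable]: "g \<in> borel_measurable borel"
    and g: "\<And>x. 0 \<le> g x" "\<And>x. g x \<le> N"
  shows "heat_flow g T"
proof
  fix z :: 'a
  show "integrable lborel (\<lambda>x. gauss T (z - x) * g x)"
  proof (rule Bochner_Integration.integrable_bound)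
    show "integrable lborel (\<lambda>x. N * gauss T (z - x))"
      by (intro integrable_mult_right integrable_gauss assms(1))
    show "AE x in lborel. norm (gauss T (z - x) * g x) \<le> norm (N * gauss T (z - x))"
    proof (rule AE_I2)
      fix x
      have "0 \<le> N"
        using g[of x] by simp
      then show "norm (gauss T (z - x) * g x) \<le> norm (N * gauss T (z - x))"
        using g[of x] gauss_nonneg[OF assms(1), of "z - x"]
        by (simp add: abs_mult mult.commute mult_right_mono)
    qed
  qed measurable
qed (use assms in auto)

lemma (in heat_flow) heat_partials:
  "0 < s \<Longrightarrow> s < T \<Longrightarrow> has_partials (heat s f) (D1 s) (D2 s)"
  unfolding has_partials_def by (simp add: heat_line_deriv heat_line_deriv2)

lemma heat_nn_le_of_tendsto:
  fixes g :: "nat \<Rightarrow> 'a::euclidean_space \<Rightarrow> real"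
  assumes le: "\<And>n. heat_nn (t n) (\<lambda>x. ennreal (g n x)) z \<le> ennreal (c n)"
    and t: "t \<longlonglongrightarrow> t'" "0 < t'" and g: "\<And>x. (\<lambda>n. g n x) \<longlonglongrightarrow> g' x" and c: "c \<longlonglongrightarrow> c'"
    and [measurable]: "\<And>n. g n \<in> borel_measurable borel"
  shows "heat_nn t' (\<lambda>x. ennreal (g' x)) z \<le> ennreal c'"
proof -
  have "heat_nn t' (\<lambda>x. ennreal (g' x)) z
     = (\<integral>\<^sup>+x. liminf (\<lambda>n. ennreal (gauss (t n) (z - x)) * ennreal (g n x)) \<partial>lborel)"
    unfolding heat_nn_def
  proof (intro nn_integral_cong)
    fix x
    have "(\<lambda>n. gauss (t n) (z - x)) \<longlonglongrightarrow> gauss t' (z - x)"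
      unfolding gauss_def using t by (intro tendsto_intros) auto
    then have "(\<lambda>n. ennreal (gauss (t n) (z - x)) * ennreal (g n x))
        \<longlonglongrightarrow> ennreal (gauss t' (z - x)) * ennreal (g' x)"
      using g t(2) by (intro tendsto_mult_ennreal tendsto_ennrealI)
        (auto simp: gauss_pos ennreal_eq_0_iff not_le)
    then show "ennreal (gauss t' (z - x)) * ennreal (g' x)
        = liminf (\<lambda>n. ennreal (gauss (t n) (z - x)) * ennreal (g n x))"
      by (simp add: lim_imp_Liminf)
  qed
  also have "\<dots> \<le> liminf (\<lambda>n. heat_nn (t n) (\<lambda>x. ennreal (g n x)) z)"
    unfolding heat_nn_def by (rule nn_integral_liminf) measurable
  also have "\<dots> \<le> liminf (\<lambda>n. ennreal (c n))"
    by (rule Liminf_mono) (simp add: le)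
  also have "\<dots> = ennreal c'"
    by (rule lim_imp_Liminf) (auto intro!: tendsto_ennrealI c)
  finally show ?thesis .
qed

text \<open>
  The caloric function with terminal values \<open>min (V \<cdot> s1) N\<close> is compared with \<open>V\<close>; the exact solution
  \<open>1 + norm z ^ 2 + DIM * (s1 - s)\<close>, perturbed to a strict supersolution, serves as barrier at infinity.
\<close>

lemma supersolution_ge_heat_nn:
  fixes V :: "'a::euclidean_space \<Rightarrow> real \<Rightarrow> real"
  assumes s01: "s0 < s1"
    and cont: "continuous_on (UNIV \<times> {s0..s1}) (\<lambda>(z, s). V z s)"
    and nonneg: "\<And>z s. s \<in> {s0..s1} \<Longrightarrow> 0 \<le> V z s"
    and part: "\<And>s. s \<in> {s0..<s1} \<Longrightarrow> has_partials (\<lambda>z. V z s) (G s) (H s)"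
    and time: "\<And>s z. s \<in> {s0..<s1} \<Longrightarrow> ((\<lambda>s. V z s) has_real_derivative Dt s z) (at s)"
    and super: "\<And>s z. s \<in> {s0..<s1} \<Longrightarrow> Dt s z + (\<Sum>b\<in>Basis. H s b z) / 2 \<le> 0"
  shows "heat_nn (s1 - s0) (\<lambda>x. ennreal (V x s1)) z \<le> ennreal (V z s0)"
proof -
  have contV: "continuous_on UNIV (\<lambda>z. V z s1)"
  proof -
    have "continuous_on UNIV ((\<lambda>(z, s). V z s) \<circ> (\<lambda>z. (z, s1)))"
      by (rule continuous_on_compose) (use s01 in \<open>auto intro!: continuous_intros continuous_on_subset[OF cont]\<close>)
    then show ?thesis
      by (simp add: comp_def)
  qed
  \<comment> \<open>Truncation bounds the caloric function \<open>w\<close> by \<open>N\<close>, so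
    that \<open>V - w \<ge> - N\<close> and any positive multiple of the squared norm wins at
    infinity, whatever the growth of \<open>V\<close>.\<close>
  have trunc: "heat (s1 - s0) (\<lambda>x. min (V x s1) N) z \<le> V z s0" if N: "0 \<le> N" for N
  proof -
    define g where "g x = min (V x s1) N" for x
    have gcont: "continuous_on UNIV g"
      unfolding g_def by (intro continuous_intros contV)
    then have [measurable]: "g \<in> borel_measurable borel"
      by (rule borel_measurable_continuous_onI)
    have g0: "0 \<le> g x" "g x \<le> N" for x
      using nonneg[of s1 x] s01 N by (auto simp: g_def)
    \<comment> \<open>The extra 1 keeps the largest time in use, \<open>s1 - s0\<close>, strictly
      below \<open>T\<close>, as the derivatives demand.\<close>
    define T where "T = s1 - s0 + 1"
    interpret g: heat_flow g T
      by (rule heat_flow_bounded[of _ _ N]) (use s01 g0 in \<open>auto simp: T_def\<close>)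
    \<comment> \<open>The rescaled form defines \<open>w\<close> also at \<open>s1\<close>, with
      value \<open>g\<close>.\<close>
    define w where "w y s = (LINT x|lborel. gauss 1 x * g (y - sqrt (s1 - s) *\<^sub>R x))" for y s
    have w_heat: "w y s = heat (s1 - s) g y" if "s < s1" for y s
      unfolding w_def using that by (subst heat_rescale) auto
    have w_le: "w y s \<le> N" for y s
    proof -
      have "w y s \<le> (LINT x|lborel. gauss 1 ((0::'a) - x) * N)"
        unfolding w_def
        by (intro integral_mono' mult_mono)
           (use g0 N integrable_gauss[of 1 "0::'a"] in \<open>auto simp: gauss_nonneg\<close>)
      then show ?thesis
        using integral_gauss[of 1 "0::'a"] by simp
    qed
    have w_end: "w y s1 = g y" for y
      using integral_gauss[of 1 "0::'a"] by (simp add: w_def)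
    have w_cont: "continuous_on (UNIV \<times> {s0..s1}) (\<lambda>(y, s). w y s)"
    proof (rule continuous_on_sequentiallyI, clarsimp)
      fix u :: "nat \<Rightarrow> 'a \<times> real" and y s
      assume lim: "u \<longlonglongrightarrow> (y, s)"
      have l: "(\<lambda>n. fst (u n)) \<longlonglongrightarrow> y" "(\<lambda>n. snd (u n)) \<longlonglongrightarrow> s"
        using tendsto_fst[OF lim] tendsto_snd[OF lim] by auto
      have "(\<lambda>n. LINT x|lborel. gauss 1 x * g (fst (u n) - sqrt (s1 - snd (u n)) *\<^sub>R x))
         \<longlonglongrightarrow> (LINT x|lborel. gauss 1 x * g (y - sqrt (s1 - s) *\<^sub>R x))"
      proof (rule integral_dominated_convergence)
        show "integrable lborel (\<lambda>x::'a. gauss 1 x * N)"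
          using integrable_gauss[of 1 "0::'a"] by simp
        show "AE x in lborel. (\<lambda>n. gauss 1 x * g (fst (u n) - sqrt (s1 - snd (u n)) *\<^sub>R x))
            \<longlonglongrightarrow> gauss 1 x * g (y - sqrt (s1 - s) *\<^sub>R x)"
          by (intro AE_I2 tendsto_intros continuous_on_tendsto_compose[OF gcont] l) auto
        show "AE x in lborel. norm (gauss 1 x * g (fst (u n) - sqrt (s1 - snd (u n)) *\<^sub>R x)) \<le> gauss 1 x * N" for n
          using g0 by (intro AE_I2) (auto simp: gauss_nonneg abs_mult intro!: mult_left_mono)
      qed measurable
      then show "(\<lambda>n. case u n of (y, s) \<Rightarrow> w y s) \<longlonglongrightarrow> w y s"
        by (simp add: w_def case_prod_beta)
    qed
    have w_part: "has_partials (\<lambda>y. w y s) (g.D1 (s1 - s)) (g.D2 (s1 - s))" if "s \<in> {s0..<s1}" for s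
      using g.heat_partials[of "s1 - s"] that by (simp add: w_heat T_def)
    have w_time: "((\<lambda>s. w y s) has_real_derivative - ((\<Sum>b\<in>Basis. g.D2 (s1 - s) b y) / 2)) (at s)"
      if s: "s \<in> {s0..<s1}" for s y
    proof -
      have "((\<lambda>s. heat (s1 - s) g y) has_real_derivative (\<Sum>b\<in>Basis. g.D2 (s1 - s) b y) / 2 * (0 - 1)) (at s)"
        by (rule DERIV_chain2[where f="\<lambda>t. heat t g y"])
           (use s in \<open>auto intro!: g.heat_time_deriv derivative_eq_intros simp: T_def\<close>)
      then have "((\<lambda>s. w y s) has_real_derivative (\<Sum>b\<in>Basis. g.D2 (s1 - s) b y) / 2 * (0 - 1)) (at s)"
        by (rule has_field_derivative_transform_within_open[where S="{..<s1}"])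
           (use s in \<open>auto simp: w_heat\<close>)
      then show ?thesis
        by simp
    qed
    have le_eps: "w z s0 - V z s0 \<le> \<epsilon> * (1 + (norm z)\<^sup>2 + (real DIM('a) + 1) * (s1 - s0))" if \<epsilon>: "0 < \<epsilon>" for \<epsilon>
    proof -
      \<comment> \<open>\<open>DIM + 1\<close> instead of \<open>DIM\<close> makes the barrier
        contribute \<open>- \<epsilon> * (DIM + 1) + \<epsilon> * DIM = - \<epsilon>\<close>, hence
        the strict inequality.\<close>
      define \<Phi> where "\<Phi> y s = (V y s - w y s) + (\<epsilon> * (1 + (real DIM('a) + 1) * (s1 - s)) + \<epsilon> * (norm y)\<^sup>2)" for y s
      let ?D = "\<lambda>s y. (Dt s y - - ((\<Sum>b\<in>Basis. g.D2 (s1 - s) b y) / 2)) - \<epsilon> * (real DIM('a) + 1)"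
      have "0 \<le> \<Phi> z s0"
      proof (rule min_principle[where \<Phi>=\<Phi> and ?s1.0=s1 and R="sqrt (N / \<epsilon>)"
            and G="\<lambda>s b y. (G s b y - g.D1 (s1 - s) b y) + 2 * \<epsilon> * (y \<bullet> b)"
            and H="\<lambda>s b y. (H s b y - g.D2 (s1 - s) b y) + 2 * \<epsilon>"
            and Dt="?D"])
        show "continuous_on (UNIV \<times> {s0..s1}) (\<lambda>(y, s). \<Phi> y s)"
          unfolding \<Phi>_def using cont w_cont
          by (auto simp: case_prod_beta intro!: continuous_intros)
        show "has_partials (\<lambda>y. \<Phi> y s)
            (\<lambda>b y. (G s b y - g.D1 (s1 - s) b y) + 2 * \<epsilon> * (y \<bullet> b))
            (\<lambda>b y. (H s b y - g.D2 (s1 - s) b y) + 2 * \<epsilon>)" if "s \<in> {s0..<s1}" for s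
          unfolding \<Phi>_def
          by (intro has_partials_add has_partials_diff part w_part has_partials_quadratic that)
        show "((\<lambda>s. \<Phi> y s) has_real_derivative
            ?D s y) (at s)"
          if "s \<in> {s0..<s1}" for s y
          unfolding \<Phi>_def
          by (auto intro!: derivative_eq_intros time w_time that simp: algebra_simps)
        show "?D s y
            + (\<Sum>b\<in>Basis. (H s b y - g.D2 (s1 - s) b y) + 2 * \<epsilon>) / 2 < 0" if "s \<in> {s0..<s1}" for s y
          using super[OF that, of y] \<epsilon> by (simp add: sum.distrib sum_subtractf field_simps)
        show "0 \<le> \<Phi> y s1" for y
          using \<epsilon> by (auto simp: \<Phi>_def w_end g_def)
        show "0 \<le> \<Phi> y s" if s: "s \<in> {s0..s1}" and y: "sqrt (N / \<epsilon>) \<le> norm y" for y s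
        proof -
          have "N / \<epsilon> = (sqrt (N / \<epsilon>))\<^sup>2"
            using N \<epsilon> by simp
          also have "\<dots> \<le> (norm y)\<^sup>2"
            using y N \<epsilon> by (intro power_mono) auto
          finally have "N \<le> \<epsilon> * (norm y)\<^sup>2"
            using \<epsilon> by (simp add: field_simps)
          moreover have "0 \<le> \<epsilon> * (1 + (real DIM('a) + 1) * (s1 - s))"
            using \<epsilon> s by simp
          ultimately show ?thesis
            using nonneg[OF s, of y] w_le[of y s] by (simp add: \<Phi>_def)
        qed
      qed (use s01 in auto)
      then show ?thesis
        by (simp add: \<Phi>_def algebra_simps)
    qed
    have "w z s0 \<le> V z s0 + e" if e: "0 < e" for e
    proof -
      define k where "k = 1 + (norm z)\<^sup>2 + (real DIM('a) + 1) * (s1 - s0)"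
      have "0 < k"
        using s01 by (auto simp: k_def intro!: add_pos_nonneg)
      then show ?thesis
        using le_eps[of "e / k"] e by (simp add: k_def[symmetric])
    qed
    then have "w z s0 \<le> V z s0"
      by (rule field_le_epsilon)
    then show ?thesis
      using s01 by (simp add: w_heat g_def[abs_def])
  qed
  have V0: "0 \<le> V z s0" for z
    using nonneg s01 by auto
  have V1: "0 \<le> V x s1" for x
    using nonneg s01 by auto
  have V1_meas [measurable]: "(\<lambda>x. V x s1) \<in> borel_measurable borel"
    by (rule borel_measurable_continuous_onI[OF contV])
  have bound: "heat_nn (s1 - s0) (\<lambda>x. ennreal (min (V x s1) (real n))) z \<le> ennreal (V z s0)" for n
  proof -
    interpret g: heat_flow "\<lambda>x. min (V x s1) (real n)" "s1 - s0"
      by (rule heat_flow_bounded[of _ _ "real n"]) (use s01 V1 in auto)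
    show ?thesis
      using trunc[of "real n"] g.f_int s01 V1
      by (subst heat_nn_eq_heat) (auto intro!: ennreal_leI)
  qed
  have "(\<lambda>n. min (V x s1) (real n)) \<longlonglongrightarrow> V x s1" for x
  proof (rule Lim_transform_eventually[OF tendsto_const])
    show "\<forall>\<^sub>F n in sequentially. V x s1 = min (V x s1) (real n)"
      using eventually_ge_at_top[of "nat \<lceil>V x s1\<rceil>"]
      by eventually_elim (auto simp: min_def ceiling_le_iff nat_le_iff)
  qed
  then show ?thesis
    by (intro heat_nn_le_of_tendsto[OF bound tendsto_const]) (use s01 in auto)
qed

text \<open>The convolution of the constant 1 is constant, so its \<open>D1\<close> and
  \<open>D2\<close> vanish; up to scaling these are the first two centred moments of the kernel.
  Expanding the square of \<open>x \<bullet> b\<close> around \<open>z \<bullet> b\<close> reduces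
  everything to them.\<close>

lemma gauss_second_moment:
  fixes z :: "'a::euclidean_space"
  assumes s: "0 < s"
  shows "integrable lborel (\<lambda>x. gauss s (z - x) * (norm x)\<^sup>2)"
    and "(LINT x|lborel. gauss s (z - x) * (norm x)\<^sup>2) = (norm z)\<^sup>2 + real DIM('a) * s"
proof -
  interpret one: heat_flow "\<lambda>_::'a. 1" "s + 1"
    by (rule heat_flow_bounded[of _ _ 1]) (use s in auto)
  have h1: "heat s (\<lambda>_. 1) y = 1" for y :: 'a
    using s by (simp add: heat_def integral_gauss)
  have d1: "one.D1 s b y = 0" if "b \<in> Basis" for b y
    using one.heat_line_deriv[of s b y] that s DERIV_unique[OF _ DERIV_const] by (simp add: h1)
  have d2: "one.D2 s b y = 0" if "b \<in> Basis" for b y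
    using one.heat_line_deriv2[of s b y] that s DERIV_unique[OF _ DERIV_const] by (simp add: d1)
  have i1: "integrable lborel (\<lambda>x. - ((z - x) \<bullet> b / s) * gauss s (z - x) * 1)" if "b \<in> Basis" for b
    by (rule one.kernel_integrable[OF s _ _ one.coef1_bound[OF s that]]) auto
  have i2: "integrable lborel (\<lambda>x. (((z - x) \<bullet> b / s)\<^sup>2 - 1 / s) * gauss s (z - x) * 1)" if "b \<in> Basis" for b
    by (rule one.kernel_integrable[OF s _ _ one.coef2_bound[OF s that]]) auto
  have dec: "gauss s (z - x) * (x \<bullet> b)\<^sup>2 = ((z \<bullet> b)\<^sup>2 + s) * gauss s (z - x)
      + (2 * (z \<bullet> b) * s * (- ((z - x) \<bullet> b / s) * gauss s (z - x) * 1)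
      + s\<^sup>2 * ((((z - x) \<bullet> b / s)\<^sup>2 - 1 / s) * gauss s (z - x) * 1))" for x b
    using s by (simp add: inner_diff_left power2_eq_square field_simps)
  have ib: "integrable lborel (\<lambda>x. gauss s (z - x) * (x \<bullet> b)\<^sup>2)" if "b \<in> Basis" for b
    unfolding dec by (intro Bochner_Integration.integrable_add integrable_mult_right i1 i2 that integrable_gauss s)
  have eb: "(LINT x|lborel. gauss s (z - x) * (x \<bullet> b)\<^sup>2) = (z \<bullet> b)\<^sup>2 + s" if b: "b \<in> Basis" for b
  proof -
    have 1: "has_bochner_integral lborel (\<lambda>x. - ((z - x) \<bullet> b / s) * gauss s (z - x) * 1) 0"
      using d1[OF b, of z] i1[OF b] unfolding one.D1_def by (simp only: has_bochner_integral_iff)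
    have 2: "has_bochner_integral lborel (\<lambda>x. (((z - x) \<bullet> b / s)\<^sup>2 - 1 / s) * gauss s (z - x) * 1) 0"
      using d2[OF b, of z] i2[OF b] unfolding one.D2_def by (simp only: has_bochner_integral_iff)
    have 0: "has_bochner_integral lborel (\<lambda>x. gauss s (z - x)) 1"
      using s by (simp add: has_bochner_integral_iff integrable_gauss integral_gauss)
    have "has_bochner_integral lborel (\<lambda>x. gauss s (z - x) * (x \<bullet> b)\<^sup>2)
        (((z \<bullet> b)\<^sup>2 + s) * 1 + (2 * (z \<bullet> b) * s * 0 + s\<^sup>2 * 0))"
      unfolding dec by (intro has_bochner_integral_add has_bochner_integral_mult_right 0 1 2)
    then show ?thesis
      by (simp add: has_bochner_integral_iff)
  qed
  have norm: "gauss s (z - x) * (norm x)\<^sup>2 = (\<Sum>b\<in>Basis. gauss s (z - x) * (x \<bullet> b)\<^sup>2)" for x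
    unfolding power2_norm_eq_inner euclidean_inner[of x x] by (simp add: sum_distrib_left power2_eq_square)
  show "integrable lborel (\<lambda>x. gauss s (z - x) * (norm x)\<^sup>2)"
    unfolding norm by (intro Bochner_Integration.integrable_sum ib)
  have "(LINT x|lborel. gauss s (z - x) * (norm x)\<^sup>2) = (\<Sum>b\<in>Basis. (z \<bullet> b)\<^sup>2 + s)"
    unfolding norm by (subst Bochner_Integration.integral_sum) (auto simp: ib eb)
  also have "\<dots> = (norm z)\<^sup>2 + real DIM('a) * s"
    unfolding power2_norm_eq_inner euclidean_inner[of z z] by (simp add: sum.distrib power2_eq_square)
  finally show "(LINT x|lborel. gauss s (z - x) * (norm x)\<^sup>2) = (norm z)\<^sup>2 + real DIM('a) * s" .
qed

section \<open>The logarithm of a Gaussian convolution\<close>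

lemma AE_eq_imp_eq_continuous:
  fixes f g :: "'a::euclidean_space \<Rightarrow> real"
  assumes "continuous_on UNIV f" "continuous_on UNIV g" and ae: "AE x in lborel. f x = g x"
  shows "f x = g x"
proof (rule ccontr)
  assume "f x \<noteq> g x"
  moreover have "open {x. f x \<noteq> g x}"
    using assms by (intro open_Collect_neq)
  ultimately obtain e where e: "0 < e" "ball x e \<subseteq> {x. f x \<noteq> g x}"
    by (auto elim!: openE)
  have "{x. f x \<noteq> g x} \<in> null_sets lborel"
    using ae \<open>open _\<close> by (subst (asm) AE_iff_null) auto
  then have "ball x e \<in> null_sets lborel"
    by (rule null_sets_subset[OF _ _ e(2)]) auto
  then have "measure lborel (ball x e) = 0"
    by (auto simp: null_sets_def measure_def)
  then show False
    using content_ball_pos[OF e(1), of x] by simp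
qed

text \<open>The kernel is positive everywhere, so \<open>f < g\<close> on a set of positive measure
  would separate the averages strictly, the smaller one being finite.\<close>

lemma heat_nn_eq_imp_AE_eq:
  assumes s: "0 < s" and [measurable]: "f \<in> borel_measurable borel" "g \<in> borel_measurable borel"
    and le: "\<And>x. f x \<le> g x" and ge: "heat_nn s g z \<le> heat_nn s f z" and fin: "heat_nn s f z < \<infinity>"
  shows "AE x in lborel. f x = g x"
proof (rule ccontr)
  assume neq: "\<not> (AE x in lborel. f x = g x)"
  have pos: "ennreal (gauss s (z - x)) \<noteq> 0" "ennreal (gauss s (z - x)) < top" for x
    using gauss_pos[OF s, of "z - x"] by auto
  have "heat_nn s f z < heat_nn s g z"
    unfolding heat_nn_def
  proof (rule nn_integral_less)
    show "AE x in lborel. ennreal (gauss s (z - x)) * f x \<le> ennreal (gauss s (z - x)) * g x"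
      using le by (intro AE_I2 mult_left_mono) auto
    show "\<not> (AE x in lborel. ennreal (gauss s (z - x)) * g x \<le> ennreal (gauss s (z - x)) * f x)"
    proof
      assume "AE x in lborel. ennreal (gauss s (z - x)) * g x \<le> ennreal (gauss s (z - x)) * f x"
      then have "AE x in lborel. f x = g x"
      proof eventually_elim
        case (elim x)
        then have "g x \<le> f x"
          using pos[of x] by (simp add: ennreal_mult_le_mult_iff)
        then show ?case
          using le[of x] by simp
      qed
      with neq show False ..
    qed
  qed (use fin in \<open>auto simp: heat_nn_def\<close>)
  with ge show False
    by simp
qed

lemma ex_sequence_above:
  fixes a b :: real
  assumes "a < b"
  shows "\<exists>S. (\<forall>n. a < S n \<and> S n < b) \<and> S \<longlonglongrightarrow> a"
\<comment> \<open>The offset 2 keeps the first term strictly below \<open>b\<close>.\<close>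
proof (intro exI[of _ "\<lambda>n. a + (b - a) / real (n + 2)"] conjI allI)
  show "a + (b - a) / real (n + 2) < b" for n
    using divide_strict_left_mono[of 1 "real (n + 2)" "b - a"] assms by simp
  show "(\<lambda>n. a + (b - a) / real (n + 2)) \<longlonglongrightarrow> a"
    using tendsto_add[OF tendsto_const LIMSEQ_ignore_initial_segment[OF lim_const_over_n], of a "b - a" 2] by simp
qed (use assms in auto)

context heat_flow
begin

lemma heat_nn_eq: "0 < s \<Longrightarrow> s \<le> T \<Longrightarrow> heat_nn s (\<lambda>x. ennreal (f x)) z = ennreal (heat s f z)"
  by (intro heat_nn_eq_heat f_nonneg f_int_less)

lemma heat_pos:
  assumes "\<not> (AE x in lborel. f x = 0)" "0 < s" "s \<le> T"
  shows "0 < heat s f z"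
proof -
  have p: "gauss s (z - x) \<noteq> 0" for x
    using gauss_pos[OF assms(2), of "z - x"] by simp
  have "0 \<le> heat s f z"
    by (rule heat_nonneg[OF assms(2)]) (rule f_nonneg)
  moreover have "heat s f z \<noteq> 0"
    using assms(1) p unfolding heat_def
    by (subst integral_nonneg_eq_0_iff_AE[OF f_int_less[OF assms(2,3)]])
       (auto simp: gauss_nonneg f_nonneg assms)
  ultimately show ?thesis
    by simp
qed

lemma heat_continuous_space:
  assumes "0 < s" "s < T"
  shows "continuous_on UNIV (heat s f)"
proof -
  have "continuous_on UNIV ((\<lambda>(z, s). heat s f z) \<circ> (\<lambda>z. (z, s)))"
    by (rule continuous_on_compose)
       (use assms in \<open>auto intro!: continuous_intros continuous_on_subset[OF heat_continuous]\<close>)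
  then show ?thesis
    by (simp add: comp_def)
qed

end

text \<open>\<open>s0\<close> and \<open>T\<close> become \<open>sW\<close> and \<open>sX\<close>.
  By \<open>sup\<close> the function \<open>sqrt (heat s f)\<close> is superharmonic, on the open
  interval only, as in the conditions of the theorem.\<close>

locale superheat = heat_flow +
  fixes s0 :: real
  assumes s0: "0 < s0" "s0 < T"
    and nonzero: "\<not> (AE x in lborel. f x = 0)"
    and sup: "\<And>s z. s0 < s \<Longrightarrow> s < T \<Longrightarrow> sqrt_lap s z \<le> 0"
begin

abbreviation "m s z \<equiv> heat s f z"

text \<open>From \<open>(norm (z - x))^2 \<le> 2 * (norm z)^2 + 2 * (norm x)^2\<close> and
  \<open>s0 \<le> s\<close>, the exponential in the kernel at \<open>z - x\<close> is at least
  \<open>exp (- (norm z)^2 / s0)\<close> times that of variance \<open>s0 / 2\<close> at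
  \<open>x\<close>; \<open>c0\<close> collects the normalising constants and the integral against
  \<open>f\<close>.\<close>

definition "c0 = sqrt ((2 * pi * (s0 / 2)) ^ DIM('a)) / sqrt ((2 * pi * T) ^ DIM('a)) * m (s0 / 2) 0"

text \<open>An exact solution of the backward heat equation that dominates \<open>- ln m\<close>.\<close>

definition Q :: "real \<Rightarrow> 'a \<Rightarrow> real" where
  "Q s z = (- ln c0 + 1 / s0 * real DIM('a) * (T - s)) + 1 / s0 * (norm z)\<^sup>2"

text \<open>Adding \<open>Q\<close> makes the function nonnegative, so that it can be averaged in
  \<open>ennreal\<close>, and changes neither the supersolution property nor the difference of the
  two averages.\<close>

definition V :: "real \<Rightarrow> 'a \<Rightarrow> real" where
  "V s z = ln (m s z) + Q s z"

lemma m_pos: "0 < s \<Longrightarrow> s \<le> T \<Longrightarrow> 0 < m s z"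
  by (rule heat_pos[OF nonzero])

lemma c0_pos: "0 < c0"
  using s0 T_pos m_pos[of "s0 / 2" 0] by (simp add: c0_def)

lemma m_ge:
  assumes s: "s0 \<le> s" "s \<le> T"
  shows "c0 * exp (- (norm z)\<^sup>2 / s0) \<le> m s z"
proof -
  define C where "C = sqrt ((2 * pi * (s0 / 2)) ^ DIM('a)) / sqrt ((2 * pi * T) ^ DIM('a))"
  have g: "C * exp (- (norm z)\<^sup>2 / s0) * gauss (s0 / 2) (0 - x) \<le> gauss s (z - x)" for x
  proof -
    have "(norm (z - x))\<^sup>2 \<le> 2 * (norm z)\<^sup>2 + 2 * (norm x)\<^sup>2"
    proof -
      have "(norm (z - x))\<^sup>2 \<le> (norm z + norm x)\<^sup>2"
        by (intro power_mono norm_triangle_ineq4) auto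
      also have "\<dots> \<le> 2 * (norm z)\<^sup>2 + 2 * (norm x)\<^sup>2"
        using sum_squares_bound[of "norm z" "norm x"] by (simp add: power2_sum)
      finally show ?thesis .
    qed
    then have "(norm (z - x))\<^sup>2 / (2 * s) \<le> (2 * (norm z)\<^sup>2 + 2 * (norm x)\<^sup>2) / (2 * s0)"
      using s s0 by (intro frac_le) auto
    also have "\<dots> = (norm z)\<^sup>2 / s0 + (norm x)\<^sup>2 / s0"
      by (simp add: add_divide_distrib)
    finally have "exp (- (norm z)\<^sup>2 / s0) * exp (- (norm x)\<^sup>2 / s0) \<le> exp (- (norm (z - x))\<^sup>2 / (2 * s))"
      unfolding exp_add[symmetric] by simp
    then have "exp (- (norm z)\<^sup>2 / s0) * exp (- (norm x)\<^sup>2 / s0) / sqrt ((2 * pi * T) ^ DIM('a))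
       \<le> exp (- (norm (z - x))\<^sup>2 / (2 * s)) / sqrt ((2 * pi * s) ^ DIM('a))"
      using s s0 T_pos by (intro frac_le) (auto intro!: power_mono)
    then show ?thesis
      using s0 by (simp add: C_def gauss_def)
  qed
  have "c0 * exp (- (norm z)\<^sup>2 / s0) = (LINT x|lborel. C * exp (- (norm z)\<^sup>2 / s0) * (gauss (s0 / 2) (0 - x) * f x))"
    by (simp add: c0_def C_def heat_def)
  also have "\<dots> \<le> m s z"
    unfolding heat_def
  proof (rule integral_mono')
    show "integrable lborel (\<lambda>x. gauss s (z - x) * f x)"
      using s s0 by (intro f_int_less) auto
    show "C * exp (- (norm z)\<^sup>2 / s0) * (gauss (s0 / 2) (0 - x) * f x) \<le> gauss s (z - x) * f x" for x
      using mult_right_mono[OF g f_nonneg, of x x] by (simp add: mult.assoc)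
    show "0 \<le> gauss s (z - x) * f x" for x
      using s s0 by (simp add: gauss_nonneg f_nonneg)
  qed
  finally show ?thesis .
qed

lemma V_ge_0:
  assumes s: "s0 \<le> s" "s \<le> T"
  shows "0 \<le> V s z"
proof -
  have "ln (c0 * exp (- (norm z)\<^sup>2 / s0)) \<le> ln (m s z)"
    using m_ge[OF s, of z] c0_pos m_pos[of s z] s s0 by (subst ln_le_cancel_iff) auto
  moreover have "0 \<le> 1 / s0 * real DIM('a) * (T - s)"
    using s s0 by simp
  ultimately show ?thesis
    using c0_pos by (simp add: V_def Q_def ln_mult)
qed

lemma V_measurable [measurable]: "V s \<in> borel_measurable borel"
  unfolding V_def[abs_def] Q_def by measurable

lemma V_continuous: "continuous_on (UNIV \<times> {0<..<T}) (\<lambda>(z, s). V s z)"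
proof -
  have 1: "continuous_on (UNIV \<times> {0<..<T}) (\<lambda>p. heat (snd p) f (fst p))"
    using heat_continuous by (simp add: case_prod_beta)
  have 2: "heat (snd p) f (fst p) \<noteq> 0" if "p \<in> UNIV \<times> {0<..<T}" for p
    using m_pos[of "snd p" "fst p"] that by auto
  have "continuous_on (UNIV \<times> {0<..<T}) (\<lambda>p. ln (heat (snd p) f (fst p)) + Q (snd p) (fst p))"
    unfolding Q_def using 2 by (intro continuous_intros 1) blast
  then show ?thesis
    by (simp add: V_def case_prod_beta)
qed

definition V2 :: "real \<Rightarrow> 'a \<Rightarrow> 'a \<Rightarrow> real" where
  "V2 s b z = (D2 s b z / m s z - (D1 s b z / m s z)\<^sup>2) + 2 * (1 / s0)"

definition V1 :: "real \<Rightarrow> 'a \<Rightarrow> 'a \<Rightarrow> real" where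
  "V1 s b z = D1 s b z / m s z + 2 * (1 / s0) * (z \<bullet> b)"

definition Vt :: "real \<Rightarrow> 'a \<Rightarrow> real" where
  "Vt s z = (\<Sum>b\<in>Basis. D2 s b z) / 2 / m s z - 1 / s0 * real DIM('a)"

lemma V_partials:
  "0 < s \<Longrightarrow> s < T \<Longrightarrow> has_partials (V s) (V1 s) (V2 s)"
  unfolding V_def[abs_def] V1_def[abs_def] V2_def[abs_def] Q_def
  by (intro has_partials_add has_partials_ln heat_partials has_partials_quadratic m_pos) auto

lemma V_time:
  assumes "0 < s" "s < T"
  shows "((\<lambda>s. V s z) has_real_derivative Vt s z) (at s)"
  unfolding V_def Vt_def Q_def using m_pos[of s z] assms s0
  by (auto intro!: derivative_eq_intros heat_time_deriv simp: algebra_simps)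

text \<open>For \<open>ln m\<close> alone, \<open>d/ds + Delta/2\<close> gives
  \<open>Delta m / (2 m) + (Delta m / m - |grad m|^2 / m^2) / 2\<close>, which is
  \<open>sqrt_lap / m\<close>. The contributions of \<open>Q\<close>, minus and plus
  \<open>DIM / s0\<close>, cancel.\<close>

lemma V_super: "Vt s z + (\<Sum>b\<in>Basis. V2 s b z) / 2
    = sqrt_lap s z / m s z" if "0 < s" "s < T"
proof -
  have p: "m s z \<noteq> 0"
    using m_pos[of s z] that by simp
  have h1: "(\<Sum>b\<in>Basis. V2 s b z) = (\<Sum>b\<in>Basis. D2 s b z) / m s z
      - (\<Sum>b\<in>Basis. (D1 s b z)\<^sup>2) / (m s z)\<^sup>2 + 2 * (1 / s0) * real DIM('a)"
    by (simp add: V2_def sum.distrib sum_subtractf sum_divide_distrib power_divide)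
  show ?thesis
    unfolding h1 sqrt_lap_eq Vt_def using p s0 by (simp add: field_simps power2_eq_square)
qed

lemma V_supersolution_interior:
  assumes ab: "s0 < a" "a < b" "b < T"
  shows "heat_nn (b - a) (\<lambda>x. ennreal (V b x)) z \<le> ennreal (V a z)"
proof (rule supersolution_ge_heat_nn[where V="\<lambda>z s. V s z" and Dt=Vt and G=V1 and H=V2])
  show "continuous_on (UNIV \<times> {a..b}) (\<lambda>(z, s). V s z)"
    by (rule continuous_on_subset[OF V_continuous]) (use ab s0 in auto)
  show "Vt s z + (\<Sum>b\<in>Basis. V2 s b z) / 2 \<le> 0" if "s \<in> {a..<b}" for s z
    using that ab s0 sup[of s z] m_pos[of s z] by (subst V_super) (auto simp: divide_le_0_iff)
  show "has_partials (V s) (V1 s) (V2 s)" if "s \<in> {a..<b}" for s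
    using that ab s0 by (intro V_partials) auto
qed (use ab s0 in \<open>auto intro!: V_ge_0 V_time\<close>)

lemma V_tendsto:
  assumes "S \<longlonglongrightarrow> s" "\<And>n. 0 < S n" "\<And>n. S n \<le> T" "0 < s" "s \<le> T"
  shows "(\<lambda>n. V (S n) z) \<longlonglongrightarrow> V s z"
  unfolding V_def Q_def using m_pos[of s z] assms s0
  by (auto intro!: tendsto_intros heat_tendsto_time)

text \<open>Derivatives and \<open>sup\<close> are available inside the interval only, so both ends
  are pulled in by a null sequence and released by Fatou's lemma.\<close>

lemma V_supersolution:
  assumes ab: "s0 \<le> a" "a < b" "b \<le> T"
  shows "heat_nn (b - a) (\<lambda>x. ennreal (V b x)) z \<le> ennreal (V a z)"
proof -
  obtain e :: "nat \<Rightarrow> real" where e: "\<And>n. 0 < e n" "\<And>n. e n < (b - a) / 2" and e0: "e \<longlonglongrightarrow> 0"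
    using ex_sequence_above[of 0 "(b - a) / 2"] ab by auto
  have l: "(\<lambda>n. a + e n) \<longlonglongrightarrow> a" "(\<lambda>n. b - e n) \<longlonglongrightarrow> b"
    using tendsto_add[OF tendsto_const e0, of a] tendsto_diff[OF tendsto_const e0, of b] by auto
  have be: "s0 < a + e n" "a + e n < b - e n" "b - e n < T" "a + e n < T" "0 < b - e n" for n
    using e(1)[of n] e(2)[of n] ab s0 by (auto simp: field_simps)
  show ?thesis
  proof (rule heat_nn_le_of_tendsto)
    show "heat_nn ((b - e n) - (a + e n)) (\<lambda>x. ennreal (V (b - e n) x)) z \<le> ennreal (V (a + e n) z)" for n
      by (rule V_supersolution_interior[OF be(1-3)])
    show "(\<lambda>n. (b - e n) - (a + e n)) \<longlonglongrightarrow> b - a"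
      by (intro tendsto_intros l)
    show "(\<lambda>n. V (b - e n) x) \<longlonglongrightarrow> V b x" for x
      by (rule V_tendsto[OF l(2)]) (use be ab s0 in \<open>auto intro: less_imp_le\<close>)
    show "(\<lambda>n. V (a + e n) z) \<longlonglongrightarrow> V a z"
      by (rule V_tendsto[OF l(1)]) (use be ab s0 in \<open>auto intro: less_imp_le less_trans\<close>)
  qed (use ab in auto)
qed

text \<open>Frozen at one \<open>s\<close>, the square root is a supersolution that is constant in a
  fictitious time, so the comparison gives the Gaussian mean value inequality for every
  \<open>t\<close>.\<close>

lemma sqrt_superharmonic_interior:
  assumes s: "s0 < s" "s < T" and t: "0 < t"
  shows "heat_nn t (\<lambda>x. ennreal (sqrt (m s x))) z \<le> ennreal (sqrt (m s z))"
proof -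
  have p: "0 < m s x" for x
    using s s0 by (intro m_pos) auto
  have "heat_nn (t - 0) (\<lambda>x. ennreal (sqrt (m s x))) z \<le> ennreal (sqrt (m s z))"
  proof (rule supersolution_ge_heat_nn[where V="\<lambda>z _. sqrt (m s z)" and Dt="\<lambda>_ _. 0"
        and G="\<lambda>_ b z. D1 s b z / (2 * sqrt (m s z))"
        and H="\<lambda>_ b z. (D2 s b z - (D1 s b z)\<^sup>2 / (2 * m s z)) / (2 * sqrt (m s z))"])
    show "continuous_on (UNIV \<times> {0..t}) (\<lambda>(z, _). sqrt (m s z))"
      using s s0 unfolding case_prod_beta
      by (intro continuous_intros continuous_on_compose2[OF heat_continuous_space, of s _ fst]) auto
    show "has_partials (\<lambda>z. sqrt (m s z)) (\<lambda>b z. D1 s b z / (2 * sqrt (m s z)))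
        (\<lambda>b z. (D2 s b z - (D1 s b z)\<^sup>2 / (2 * m s z)) / (2 * sqrt (m s z)))"
      using s s0 by (intro has_partials_sqrt heat_partials p) auto
    show "0 + (\<Sum>b\<in>Basis. (D2 s b z - (D1 s b z)\<^sup>2 / (2 * m s z)) / (2 * sqrt (m s z))) / 2 \<le> 0" for z
      using sup[OF s, of z] p[of z] by (simp add: sum_divide_distrib[symmetric] divide_le_0_iff)
  qed (use t less_imp_le[OF p] in auto)
  then show ?thesis
    by simp
qed

lemma sqrt_superharmonic:
  assumes t: "0 < t"
  shows "heat_nn t (\<lambda>x. ennreal (sqrt (m s0 x))) z \<le> ennreal (sqrt (m s0 z))"
proof -
  obtain S where S: "\<And>n. s0 < S n" "\<And>n. S n < T" and l: "S \<longlonglongrightarrow> s0"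
    using ex_sequence_above[OF s0(2)] by blast
  have lm: "(\<lambda>n. m (S n) x) \<longlonglongrightarrow> m s0 x" for x
    by (rule heat_tendsto_time[OF l]) (use S s0 in \<open>auto intro: less_imp_le less_trans\<close>)
  show ?thesis
    by (rule heat_nn_le_of_tendsto[OF sqrt_superharmonic_interior[OF S t]])
       (auto intro!: tendsto_intros lm t)
qed

text \<open>The second moment contributes \<open>DIM * s\<close> and makes up for the term
  \<open>DIM * (T - s)\<close>: the average does not depend on \<open>s\<close>, as it must for an
  exact solution.\<close>

lemma heat_Q:
  assumes s: "0 < s"
  shows "integrable lborel (\<lambda>x. gauss s (z - x) * Q s x)"
    and "heat s (Q s) z = - ln c0 + 1 / s0 * (real DIM('a) * T + (norm z)\<^sup>2)"
proof -
  have eq: "gauss s (z - x) * Q s x = (- ln c0 + 1 / s0 * real DIM('a) * (T - s)) * gauss s (z - x)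
      + 1 / s0 * (gauss s (z - x) * (norm x)\<^sup>2)" for x
    by (simp add: Q_def algebra_simps)
  show "integrable lborel (\<lambda>x. gauss s (z - x) * Q s x)"
    unfolding eq by (intro Bochner_Integration.integrable_add integrable_mult_right integrable_gauss
        gauss_second_moment s)
  have "has_bochner_integral lborel (\<lambda>x. gauss s (z - x) * Q s x)
     ((- ln c0 + 1 / s0 * real DIM('a) * (T - s)) * 1 + 1 / s0 * ((norm z)\<^sup>2 + real DIM('a) * s))"
    unfolding eq using s
    by (intro has_bochner_integral_add has_bochner_integral_mult_right)
       (auto simp: has_bochner_integral_iff integrable_gauss integral_gauss gauss_second_moment)
  then have "heat s (Q s) z = (- ln c0 + 1 / s0 * real DIM('a) * (T - s)) * 1 + 1 / s0 * ((norm z)\<^sup>2 + real DIM('a) * s)"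
    by (simp only: has_bochner_integral_iff heat_def)
  also have "\<dots> = - ln c0 + 1 / s0 * (real DIM('a) * T + (norm z)\<^sup>2)"
    using s0 by (simp add: field_simps)
  finally show "heat s (Q s) z = - ln c0 + 1 / s0 * (real DIM('a) * T + (norm z)\<^sup>2)" .
qed

text \<open>Superharmonicity bounds the average of the square root by a point value, and
  \<open>ln m = 2 * ln (sqrt m) \<le> 2 * sqrt m\<close> passes this on to the logarithm.
  \<open>heat_nn_V_le\<close> then transfers finiteness from \<open>s0\<close> to
  \<open>T\<close>.\<close>

lemma heat_nn_V_s0_finite: "heat_nn s0 (\<lambda>x. ennreal (V s0 x)) z < \<infinity>"
proof -
  have "integrable lborel (\<lambda>x. gauss s0 (z - x) * sqrt (m s0 x))"
    using sqrt_superharmonic[OF s0(1), of z] s0 m_pos[of s0]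
    by (subst integrable_heat_iff) (auto intro: le_less_trans less_imp_le)
  then have i: "integrable lborel (\<lambda>x. 2 * (gauss s0 (z - x) * sqrt (m s0 x)) + gauss s0 (z - x) * Q s0 x)"
    using heat_Q(1)[OF s0(1)] by (intro Bochner_Integration.integrable_add integrable_mult_right)
  have "integrable lborel (\<lambda>x. gauss s0 (z - x) * V s0 x)"
  proof (rule Bochner_Integration.integrable_bound[OF i])
    show "AE x in lborel. norm (gauss s0 (z - x) * V s0 x)
        \<le> norm (2 * (gauss s0 (z - x) * sqrt (m s0 x)) + gauss s0 (z - x) * Q s0 x)"
    proof (rule AE_I2)
      fix x
      have p: "0 < m s0 x"
        using s0 by (intro m_pos) auto
      have "ln (m s0 x) = 2 * ln (sqrt (m s0 x))"
        using p by (simp add: ln_sqrt)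
      also have "\<dots> \<le> 2 * sqrt (m s0 x)"
        using ln_le_minus_one[of "sqrt (m s0 x)"] p by auto
      finally have "V s0 x \<le> 2 * sqrt (m s0 x) + Q s0 x"
        by (simp add: V_def)
      then have "gauss s0 (z - x) * V s0 x \<le> gauss s0 (z - x) * (2 * sqrt (m s0 x) + Q s0 x)"
        using s0 by (intro mult_left_mono) (auto simp: gauss_nonneg)
      moreover have "0 \<le> gauss s0 (z - x) * V s0 x"
        using s0 V_ge_0[of s0 x] by (auto simp: gauss_nonneg)
      ultimately show "norm (gauss s0 (z - x) * V s0 x)
        \<le> norm (2 * (gauss s0 (z - x) * sqrt (m s0 x)) + gauss s0 (z - x) * Q s0 x)"
        by (simp add: algebra_simps)
    qed
  qed measurable
  then show ?thesis
    using s0 V_ge_0[of s0] by (subst (asm) integrable_heat_iff) auto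
qed

lemma heat_nn_V_split:
  assumes "s0 \<le> s" "s < T"
  shows "heat_nn s (heat_nn (T - s) (\<lambda>x. ennreal (V T x))) z = heat_nn T (\<lambda>x. ennreal (V T x)) z"
  using assms s0 by (subst heat_nn_heat_nn) auto

lemma heat_nn_V_le: "heat_nn T (\<lambda>x. ennreal (V T x)) z \<le> heat_nn s0 (\<lambda>x. ennreal (V s0 x)) z"
  using s0 V_supersolution[of s0 T]
  by (subst heat_nn_V_split[of s0, symmetric]) (auto intro!: heat_nn_mono)

lemma heat_nn_V_finite: "heat_nn T (\<lambda>x. ennreal (V T x)) z < \<infinity>"
  using heat_nn_V_le heat_nn_V_s0_finite by (rule le_less_trans)

lemma integrable_V:
  "integrable lborel (\<lambda>x. gauss s0 (z - x) * V s0 x)" "integrable lborel (\<lambda>x. gauss T (z - x) * V T x)"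
  using heat_nn_V_finite heat_nn_V_s0_finite s0 T_pos V_ge_0
  by (auto simp: integrable_heat_iff)

lemma integrable_ln:
  "integrable lborel (\<lambda>x. gauss s0 (z - x) * ln (m s0 x))" "integrable lborel (\<lambda>x. gauss T (z - x) * ln (m T x))"
  using Bochner_Integration.integrable_diff[OF integrable_V(1) heat_Q(1)[OF s0(1)], of z z]
    Bochner_Integration.integrable_diff[OF integrable_V(2) heat_Q(1)[OF T_pos], of z z]
  by (simp_all add: V_def algebra_simps)

lemma heat_ln_eq:
  "heat s0 (\<lambda>x. ln (m s0 x)) z - heat T (\<lambda>x. ln (m T x)) z = heat s0 (V s0) z - heat T (V T) z"
proof -
  have "heat s0 (V s0) z = heat s0 (\<lambda>x. ln (m s0 x)) z + heat s0 (Q s0) z"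
    using Bochner_Integration.integral_add[OF integrable_ln(1)[of z] heat_Q(1)[OF s0(1), of z]]
    by (simp add: heat_def[of s0 "V s0"] heat_def[of s0 "\<lambda>x. ln (m s0 x)"] heat_def[of s0 "Q s0"]
        V_def distrib_left)
  moreover have "heat T (V T) z = heat T (\<lambda>x. ln (m T x)) z + heat T (Q T) z"
    using Bochner_Integration.integral_add[OF integrable_ln(2)[of z] heat_Q(1)[OF T_pos, of z]]
    by (simp add: heat_def[of T "V T"] heat_def[of T "\<lambda>x. ln (m T x)"] heat_def[of T "Q T"]
        V_def distrib_left)
  ultimately show ?thesis
    by (simp add: heat_Q(2) s0 T_pos)
qed

lemma heat_nn_V_eq:
  "heat_nn s0 (\<lambda>x. ennreal (V s0 x)) z = ennreal (heat s0 (V s0) z)"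
  "heat_nn T (\<lambda>x. ennreal (V T x)) z = ennreal (heat T (V T) z)"
  using s0 V_ge_0 integrable_V by (auto intro!: heat_nn_eq_heat)

text \<open>
  If the gap vanishes at one point, then the supersolution \<open>V\<close> agrees with the caloric function with
  terminal values \<open>V T\<close>, and is itself caloric.
\<close>

lemma log_gap_strict:
  assumes s: "s0 < s" "s < T"
    and strict: "sqrt_lap s y < 0"
  shows "heat T (\<lambda>x. ln (m T x)) z < heat s0 (\<lambda>x. ln (m s0 x)) z"
proof (rule ccontr)
  assume "\<not> ?thesis"
  then have ge: "heat_nn s0 (\<lambda>x. ennreal (V s0 x)) z \<le> heat_nn T (\<lambda>x. ennreal (V T x)) z"
    using heat_ln_eq[of z] by (simp add: heat_nn_V_eq ennreal_leI)
  define F where "F = (\<lambda>x. ennreal (V T x))"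
  have [measurable]: "F \<in> borel_measurable borel"
    unfolding F_def by measurable
  have "AE x in lborel. heat_nn (T - s0) F x = ennreal (V s0 x)"
  proof (rule heat_nn_eq_imp_AE_eq[OF s0(1)])
    show "heat_nn (T - s0) F x \<le> ennreal (V s0 x)" for x
      unfolding F_def using s0 by (intro V_supersolution) auto
    show "heat_nn s0 (\<lambda>x. ennreal (V s0 x)) z \<le> heat_nn s0 (heat_nn (T - s0) F) z"
      using ge s0 heat_nn_V_split[of s0 z] by (simp add: F_def)
    show "heat_nn s0 (heat_nn (T - s0) F) z < \<infinity>"
      using heat_nn_V_finite[of z] s0 heat_nn_V_split[of s0 z] by (simp add: F_def)
  qed measurable
  \<comment> \<open>One point of equality, with finite value \<open>V s0 z1\<close>, forces equality
    at all intermediate times \<open>r\<close>, because the inequalities from \<open>T\<close> to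
    \<open>r\<close> and from \<open>r\<close> to \<open>s0\<close> compose.\<close>
  then have "\<exists>z1. heat_nn (T - s0) F z1 = ennreal (V s0 z1)"
    by (rule eventually_happens'[rotated]) (simp add: ae_filter_eq_bot_iff)
  then obtain z1 where z1: "heat_nn (T - s0) F z1 = ennreal (V s0 z1)"
    by blast
  interpret F: heat_flow "V T" "T - s0"
  proof
    show "integrable lborel (\<lambda>x. gauss (T - s0) (z - x) * V T x)" for z
      using V_supersolution[of s0 T z] s0 V_ge_0
      by (subst integrable_heat_iff) (auto intro: le_less_trans)
  qed (use s0 V_ge_0 in auto)
  have eq: "heat (T - r) (V T) x = V r x" if r: "s0 < r" "r < T" for r x
  proof (rule AE_eq_imp_eq_continuous[where f="heat (T - r) (V T)" and g="V r"])
    show "continuous_on UNIV (heat (T - r) (V T))"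
      using r by (intro F.heat_continuous_space) auto
    have "continuous_on UNIV ((\<lambda>(z, s). V s z) \<circ> (\<lambda>z. (z, r)))"
      by (rule continuous_on_compose)
         (use r s0 in \<open>auto intro!: continuous_intros continuous_on_subset[OF V_continuous]\<close>)
    then show "continuous_on UNIV (V r)"
      by (simp add: comp_def)
    have le: "heat_nn (T - r) F x \<le> ennreal (V r x)" for x
      unfolding F_def using r by (intro V_supersolution) auto
    have e1: "heat_nn (r - s0) (heat_nn (T - r) F) z1 = ennreal (V s0 z1)"
      using r by (subst heat_nn_heat_nn) (auto simp: z1)
    have "AE x in lborel. heat_nn (T - r) F x = ennreal (V r x)"
    proof (rule heat_nn_eq_imp_AE_eq[where s="r - s0" and z=z1])
      show "heat_nn (r - s0) (\<lambda>x. ennreal (V r x)) z1 \<le> heat_nn (r - s0) (heat_nn (T - r) F) z1"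
        unfolding e1 using r by (intro V_supersolution) auto
    qed (use r le in \<open>auto simp: e1\<close>)
    then show "AE x in lborel. heat (T - r) (V T) x = V r x"
    proof eventually_elim
      case (elim x)
      have "heat_nn (T - r) F x = ennreal (heat (T - r) (V T) x)"
        unfolding F_def using r s0 by (intro F.heat_nn_eq) auto
      moreover have "0 \<le> heat (T - r) (V T) x" "0 \<le> V r x"
        using r s0 V_ge_0 by (auto intro!: heat_nonneg)
      ultimately show ?case
        using elim by simp
    qed
  qed
  have sT: "0 < T - s" "T - s < T - s0" "0 < s"
    using s s0 by auto
  have p1: "has_partials (V s) (F.D1 (T - s)) (F.D2 (T - s))"
  proof -
    have "heat (T - s) (V T) = V s"
      by (rule ext) (rule eq[OF s])
    then show ?thesis
      using F.heat_partials[OF sT(1,2)] by simp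
  qed
  note p2 = V_partials[OF sT(3) s(2)]
  have e1: "F.D1 (T - s) b = V1 s b" if "b \<in> Basis" for b
  proof
    show "F.D1 (T - s) b x = V1 s b x" for x
      using DERIV_unique[OF has_partialsD(1)[OF p1 that, of x 0] has_partialsD(1)[OF p2 that, of x 0]] by simp
  qed
  have "F.D2 (T - s) b y = V2 s b y" if b: "b \<in> Basis" for b
    using DERIV_unique[OF has_partialsD(2)[OF p1 b, of y 0, unfolded e1[OF b]] has_partialsD(2)[OF p2 b, of y 0]]
    by simp
  moreover have "((\<lambda>r. V r y) has_real_derivative (\<Sum>b\<in>Basis. F.D2 (T - s) b y) / 2 * (0 - 1)) (at s)"
  proof (rule has_field_derivative_transform_within_open[where S="{s0<..<T}"])
    show "((\<lambda>r. heat (T - r) (V T) y) has_real_derivative (\<Sum>b\<in>Basis. F.D2 (T - s) b y) / 2 * (0 - 1)) (at s)"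
      by (rule DERIV_chain2[where f="\<lambda>t. heat t (V T) y"])
         (use sT in \<open>auto intro!: F.heat_time_deriv derivative_eq_intros\<close>)
  qed (use s eq in auto)
  then have "Vt s y = (\<Sum>b\<in>Basis. F.D2 (T - s) b y) / 2 * (0 - 1)"
    using V_time[OF sT(3) s(2), of y] by (rule DERIV_unique[rotated])
  \<comment> \<open>The heat equation holds in the remaining time \<open>T - s\<close>; hence the
    minus sign, and the time derivative cancels half the Laplacian.\<close>
  ultimately have "Vt s y + (\<Sum>b\<in>Basis. V2 s b y) / 2 = 0"
    by simp
  then show False
    using strict m_pos[of s y] s sT by (simp add: V_super)
qed

end

section \<open>Weak superharmonicity\<close>

lemma sum_Basis_vec: "(\<Sum>b\<in>(Basis :: (real^'m) set). F b) = (\<Sum>i\<in>UNIV. F (axis i 1))"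
proof -
  have "(Basis :: (real^'m) set) = range (\<lambda>i. axis i 1)"
    by (auto simp: Basis_vec_def)
  then have "(\<Sum>b\<in>(Basis :: (real^'m) set). F b) = (\<Sum>b\<in>range (\<lambda>i. axis i (1::real) :: real^'m). F b)"
    by (rule arg_cong)
  also have "\<dots> = (\<Sum>i\<in>UNIV. F (axis i 1))"
    by (subst sum.reindex) (auto simp: inj_on_def axis_eq_axis)
  finally show ?thesis .
qed

lemma laplacian_eq:
  fixes f :: "real^'m \<Rightarrow> real"
  assumes "has_partials f g h"
  shows "laplacian f z = (\<Sum>b\<in>Basis. h b z)"
proof -
  have "deriv (deriv (\<lambda>s. f (z + s *\<^sub>R b))) 0 = h b z" if b: "b \<in> Basis" for b
  proof -
    have "deriv (\<lambda>s. f (z + s *\<^sub>R b)) = (\<lambda>r. g b (z + r *\<^sub>R b))"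
      by (rule ext) (rule DERIV_imp_deriv[OF has_partialsD(1)[OF assms b]])
    then show ?thesis
      using DERIV_imp_deriv[OF has_partialsD(2)[OF assms b, of z 0]] by simp
  qed
  then show ?thesis
    unfolding laplacian_def sum_Basis_vec by (intro sum.cong) (auto simp: axis_in_Basis_iff)
qed

text \<open>Away from 0 one of two smooth branches applies; at 0 the difference quotient is at most
  \<open>\<bar>h\<bar> ^ (k + 1)\<close>, and this exponent is positive.\<close>

lemma pos_part_power_deriv:
  "((\<lambda>u::real. max 0 u ^ (k + 2)) has_real_derivative (real (k + 2) * max 0 u ^ (k + 1))) (at u)"
proof (cases u "0::real" rule: linorder_cases)
  case less
  have "((\<lambda>u::real. 0) has_real_derivative (real (k + 2) * max 0 u ^ (k + 1))) (at u)"
    using less by (auto intro!: derivative_eq_intros)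
  then show ?thesis
    by (rule has_field_derivative_transform_within_open[where S="{..<0}"]) (use less in auto)
next
  case greater
  have "((\<lambda>u::real. u ^ (k + 2)) has_real_derivative (real (k + 2) * max 0 u ^ (k + 1))) (at u)"
    by (rule DERIV_cong[OF DERIV_pow]) (use greater in \<open>simp add: max_def\<close>)
  then show ?thesis
    by (rule has_field_derivative_transform_within_open[where S="{0<..}"]) (use greater in auto)
next
  case equal
  have "((\<lambda>h::real. max 0 h ^ (k + 2) / h) \<longlongrightarrow> 0) (at 0)"
  proof (rule Lim_null_comparison)
    show "\<forall>\<^sub>F h in at (0::real). norm (max 0 h ^ (k + 2) / h) \<le> \<bar>h\<bar> ^ (k + 1)"
    proof (intro always_eventually allI)
      fix h :: real
      show "norm (max 0 h ^ (k + 2) / h) \<le> \<bar>h\<bar> ^ (k + 1)"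
      proof (cases "0 < h")
        case False
        then have "norm (max 0 h ^ (k + 2) / h) = 0"
          by simp
        also have "0 \<le> \<bar>h\<bar> ^ (k + 1)"
          by (rule zero_le_power) simp
        finally show ?thesis .
      qed simp
    qed
    show "((\<lambda>h::real. \<bar>h\<bar> ^ (k + 1)) \<longlongrightarrow> 0) (at 0)"
      by (auto intro!: tendsto_eq_intros)
  qed
  then show ?thesis
    by (simp add: DERIV_def equal)
qed

lemma radial_derivs:
  fixes h h1 h2 :: "real \<Rightarrow> real" and z :: "real^'m"
  assumes h1: "\<And>u. (h has_real_derivative h1 u) (at u)"
    and h2: "\<And>u. (h1 has_real_derivative h2 u) (at u)"
    and cont: "continuous_on UNIV h2"
  shows "C2_function (\<lambda>x. h ((norm (x - z))\<^sup>2))"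
    and "laplacian (\<lambda>x. h ((norm (x - z))\<^sup>2)) x
      = 4 * h2 ((norm (x - z))\<^sup>2) * (norm (x - z))\<^sup>2 + 2 * real CARD('m) * h1 ((norm (x - z))\<^sup>2)"
proof -
  let ?n = "\<lambda>x. (norm (x - z))\<^sup>2"
  have n_deriv: "(?n has_derivative (\<lambda>k. 2 * ((x - z) \<bullet> k))) (at x)" for x
    unfolding power2_norm_eq_inner
    by (auto intro!: derivative_eq_intros simp: inner_commute)
  have hn: "((\<lambda>x. h (?n x)) has_derivative (\<lambda>k. h1 (?n x) * (2 * ((x - z) \<bullet> k)))) (at x)" for x
    using has_derivative_compose[OF n_deriv, of h "(*) (h1 (?n x))" x] h1[of "?n x"]
    by (simp add: has_field_derivative_def)
  have h1n: "((\<lambda>x. h1 (?n x)) has_derivative (\<lambda>k. h2 (?n x) * (2 * ((x - z) \<bullet> k)))) (at x)" for x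
    using has_derivative_compose[OF n_deriv, of h1 "(*) (h2 (?n x))" x] h2[of "?n x"]
    by (simp add: has_field_derivative_def)
  define grad where "grad x = (2 * h1 (?n x)) *\<^sub>R (x - z)" for x
  \<comment> \<open>The Hessian as a linear map: \<open>4 * h2\<close> times the outer product of
    \<open>x - z\<close> with itself plus \<open>2 * h1\<close> times the identity. Its trace is the
    Laplacian.\<close>
  define A where "A x k = (2 * (h2 (?n x) * (2 * ((x - z) \<bullet> k)))) *\<^sub>R (x - z) + (2 * h1 (?n x)) *\<^sub>R k" for x k
  define hess where "hess x = matrix (A x)" for x
  have "linear (A x)" for x
    by (rule linearI) (simp_all add: A_def inner_add_right algebra_simps)
  then have hess_mult: "hess x *v k = (2 * (h2 (?n x) * (2 * ((x - z) \<bullet> k)))) *\<^sub>R (x - z) + (2 * h1 (?n x)) *\<^sub>R k" for x k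
    unfolding hess_def by (simp add: matrix_works) (simp add: A_def)
  have grad_deriv: "(grad has_derivative (\<lambda>k. hess x *v k)) (at x)" for x
    unfolding grad_def[abs_def] hess_mult
    by (auto intro!: derivative_eq_intros h1n simp: algebra_simps)
  have n_cont: "continuous_on UNIV ?n"
    by (intro continuous_intros)
  have h1_cont: "continuous_on UNIV h1"
    using h2 by (intro continuous_at_imp_continuous_on ballI DERIV_isCont) auto
  have c1: "continuous_on UNIV (\<lambda>x. h1 (?n x))" and c2: "continuous_on UNIV (\<lambda>x. h2 (?n x))"
    by (auto intro!: continuous_on_compose2[OF h1_cont n_cont] continuous_on_compose2[OF cont n_cont])
  show "C2_function (\<lambda>x. h (?n x))"
    unfolding C2_function_def
  proof (rule exI[of _ grad], rule exI[of _ hess], intro conjI allI)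
    show "((\<lambda>x. h (?n x)) has_derivative (\<lambda>k. grad x \<bullet> k)) (at x)" for x
      using hn[of x] by (simp add: grad_def mult_ac)
    show "(grad has_derivative (\<lambda>k. hess x *v k)) (at x)" for x
      by (rule grad_deriv)
    show "continuous_on UNIV hess"
      unfolding hess_def matrix_def A_def
      by (intro continuous_on_vec_lambda) (auto intro!: continuous_intros c1 c2)
  qed
  have "has_partials (\<lambda>x. h (?n x)) (\<lambda>b x. grad x \<bullet> b) (\<lambda>b x. (hess x *v b) \<bullet> b)"
    unfolding has_partials_def
  proof (intro ballI allI conjI)
    fix b x :: "real^'m"
    have l: "((\<lambda>r. x + r *\<^sub>R b) has_derivative (\<lambda>r. r *\<^sub>R b)) (at 0)"
      by (auto intro!: derivative_eq_intros)
    have "((\<lambda>r. h (?n (x + r *\<^sub>R b))) has_derivative (\<lambda>r. grad x \<bullet> (r *\<^sub>R b))) (at 0)"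
      using has_derivative_compose[OF l, of "\<lambda>x. h (?n x)" "\<lambda>k. grad x \<bullet> k"] hn[of x]
      by (simp add: grad_def mult_ac)
    then show "((\<lambda>r. h (?n (x + r *\<^sub>R b))) has_real_derivative grad x \<bullet> b) (at 0)"
      by (rule has_derivative_imp_has_field_derivative) simp
    have "((\<lambda>x. grad x \<bullet> b) has_derivative (\<lambda>k. (hess x *v k) \<bullet> b)) (at x)"
      by (auto intro!: derivative_eq_intros grad_deriv)
    then have "((\<lambda>r. grad (x + r *\<^sub>R b) \<bullet> b) has_derivative (\<lambda>r. (hess x *v (r *\<^sub>R b)) \<bullet> b)) (at 0)"
      using has_derivative_compose[OF l, of "\<lambda>x. grad x \<bullet> b" "\<lambda>k. (hess x *v k) \<bullet> b"] by simp
    then show "((\<lambda>r. grad (x + r *\<^sub>R b) \<bullet> b) has_real_derivative (hess x *v b) \<bullet> b) (at 0)"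
      by (rule has_derivative_imp_has_field_derivative) (simp add: hess_mult inner_add_left algebra_simps)
  qed
  then have "laplacian (\<lambda>x. h (?n x)) x = (\<Sum>b\<in>Basis. (hess x *v b) \<bullet> b)"
    by (rule laplacian_eq)
  also have "\<dots> = (\<Sum>b\<in>Basis. 4 * h2 (?n x) * ((x - z) \<bullet> b * ((x - z) \<bullet> b)) + 2 * h1 (?n x))"
    unfolding hess_mult by (intro sum.cong) (auto simp: inner_add_left algebra_simps)
  also have "\<dots> = 4 * h2 (?n x) * ?n x + 2 * real CARD('m) * h1 (?n x)"
    unfolding power2_norm_eq_inner euclidean_inner[of "x - z" "x - z"]
    by (simp add: sum.distrib sum_distrib_left)
  finally show "laplacian (\<lambda>x. h (?n x)) x = 4 * h2 (?n x) * ?n x + 2 * real CARD('m) * h1 (?n x)" .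
qed

text \<open>Eventually the truncation is inactive, and removing \<open>j\<close> factors, each
  tending to 1, does not change the limit. Two derivatives cost two factors, whence
  \<open>j \<le> 2\<close>.\<close>

lemma truncated_exp_tendsto:
  fixes v :: real
  assumes "j \<le> 2"
  shows "(\<lambda>k. max 0 (1 - v / real (k + 3)) ^ (k + 3 - j)) \<longlonglongrightarrow> exp (- v)"
proof -
  define a where "a k = 1 - v / real (k + 3)" for k
  have a1: "a \<longlonglongrightarrow> 1 - 0"
    unfolding a_def by (intro tendsto_intros LIMSEQ_ignore_initial_segment[OF lim_const_over_n])
  have a2: "(\<lambda>k. a k ^ (k + 3)) \<longlonglongrightarrow> exp (- v)"
    using LIMSEQ_ignore_initial_segment[OF tendsto_exp_limit_sequentially[of "- v"], of 3]
    by (simp add: a_def)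
  have "(\<lambda>k. a k ^ (k + 3) / a k ^ j) \<longlonglongrightarrow> exp (- v) / (1 - 0) ^ j"
    by (intro tendsto_intros a1 a2) auto
  moreover have "\<forall>\<^sub>F k in sequentially. 0 < a k"
    using a1 by (rule order_tendstoD) simp
  then have "\<forall>\<^sub>F k in sequentially. a k ^ (k + 3) / a k ^ j = max 0 (a k) ^ (k + 3 - j)"
    by eventually_elim (use assms in \<open>simp add: power_diff max_def\<close>)
  ultimately show ?thesis
    unfolding a_def by (simp add: Lim_transform_eventually)
qed

text \<open>This is \<open>1 - t \<le> exp (- t)\<close> raised to a power. After differentiation
  the power \<open>j\<close> falls short of \<open>k + 3\<close>, so the decay rate is slightly
  below that of the limit.\<close>

lemma truncated_exp_le:
  fixes v :: real
  assumes "0 \<le> v"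
  shows "max 0 (1 - v / real (k + 3)) ^ j \<le> exp (- (v * real j / real (k + 3)))"
proof -
  have "max 0 (1 - v / real (k + 3)) \<le> exp (- (v / real (k + 3)))"
    using exp_ge_add_one_self[of "- (v / real (k + 3))"] by simp
  then have "max 0 (1 - v / real (k + 3)) ^ j \<le> exp (- (v / real (k + 3))) ^ j"
    by (intro power_mono) auto
  also have "\<dots> = exp (- (v * real j / real (k + 3)))"
    by (simp add: exp_of_nat_mult[symmetric] mult.commute)
  finally show ?thesis .
qed

text \<open>
  The test functions \<open>max 0 (1 - norm (x - z) ^ 2 / (2 * s * n)) ^ n\<close> are \<open>C2\<close> with compact support and tend,
  together with their Laplacians, to \<open>exp (- norm (x - z) ^ 2 / (2 * s))\<close>.
\<close>

lemma weak_laplacian_imp_heat: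
  fixes f :: "real^'m \<Rightarrow> real"
  assumes "heat_flow f T" and weak: "weak_laplacian_nonpos f" and s: "0 < s" "s < T"
  shows "(\<Sum>b\<in>Basis. heat_flow.D2 f s b z) \<le> 0"
proof -
  interpret heat_flow f T by fact
  \<comment> \<open>The square of the support radius. The power \<open>k + 3\<close> is at least 3,
    so that the second derivative is still continuous.\<close>
  define c where "c k = 2 * s * real (k + 3)" for k
  have c_pos: "0 < c k" for k
    using s by (simp add: c_def)
  define h where "h k u = max 0 (1 - u / c k) ^ (k + 3)" for k and u :: real
  define h1 where "h1 k u = - (1 / (2 * s)) * max 0 (1 - u / c k) ^ (k + 2)" for k and u :: real
  define h2 where "h2 k u = real (k + 2) / real (k + 3) / (4 * s\<^sup>2) * max 0 (1 - u / c k) ^ (k + 1)" for k and u :: real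
  have inner: "((\<lambda>u. 1 - u / c k) has_real_derivative - (1 / c k)) (at u)" for k u
    using c_pos[of k] by (auto intro!: derivative_eq_intros)
  have p3: "((\<lambda>u. max 0 u ^ (k + 3)) has_real_derivative real (k + 3) * max 0 u ^ (k + 2)) (at u)" for k and u :: real
    using pos_part_power_deriv[of "Suc k" u] by (simp add: eval_nat_numeral)
  have d1: "(h k has_real_derivative h1 k u) (at u)" for k u
  proof -
    have a: "r * M * - (1 / (2 * s * r)) = - (1 / (2 * s)) * M" if "0 < r" for r M
      using s that by (simp add: field_simps)
    have alg: "real (k + 3) * M * - (1 / c k) = - (1 / (2 * s)) * M" for M
      unfolding c_def by (rule a) simp
    show ?thesis
      unfolding h_def[abs_def] h1_def by (rule DERIV_cong[OF DERIV_chain2[OF p3 inner] alg])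
  qed
  have d2: "(h1 k has_real_derivative h2 k u) (at u)" for k u
  proof -
    have a: "- (1 / (2 * s)) * (q * M * - (1 / (2 * s * r))) = q / r / (4 * s\<^sup>2) * M" if "0 < r" for q r M
      using s that by (simp add: field_simps power2_eq_square)
    have alg: "- (1 / (2 * s)) * (real (k + 2) * M * - (1 / c k)) = real (k + 2) / real (k + 3) / (4 * s\<^sup>2) * M" for M
      unfolding c_def by (rule a) simp
    show ?thesis
      unfolding h1_def[abs_def] h2_def
      by (rule DERIV_cong[OF DERIV_cmult[OF DERIV_chain2[OF pos_part_power_deriv inner]] alg])
  qed
  have h2_cont: "continuous_on UNIV (h2 k)" for k
    unfolding h2_def[abs_def] using c_pos[of k] by (intro continuous_intros) auto
  define \<psi> where "\<psi> k x = h k ((norm (x - z))\<^sup>2)" for k x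
  define N where "N = real CARD('m)"
  have lap: "laplacian (\<psi> k) x = 4 * h2 k ((norm (x - z))\<^sup>2) * (norm (x - z))\<^sup>2 + 2 * N * h1 k ((norm (x - z))\<^sup>2)" for k x
    unfolding \<psi>_def[abs_def] N_def by (rule radial_derivs(2)[OF d1 d2 h2_cont])
  have le0: "(LINT x|lborel. f x * laplacian (\<psi> k) x) \<le> 0" for k
  proof -
    have "C2_function (\<psi> k)"
      unfolding \<psi>_def[abs_def] by (rule radial_derivs(1)[OF d1 d2 h2_cont])
    moreover have "\<forall>x. 0 \<le> \<psi> k x"
      by (simp add: \<psi>_def h_def)
    moreover have "bounded {x. \<psi> k x \<noteq> 0}"
    proof (rule bounded_subset[OF bounded_cball])
      show "{x. \<psi> k x \<noteq> 0} \<subseteq> cball z (sqrt (c k))"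
      proof clarsimp
        fix x assume "\<psi> k x \<noteq> 0"
        then have "0 \<le> 1 - (norm (x - z))\<^sup>2 / c k"
          by (auto simp: \<psi>_def h_def max_def split: if_splits)
        then have "(norm (x - z))\<^sup>2 \<le> c k"
          using c_pos[of k] by (simp add: field_simps)
        then have "norm (x - z) \<le> sqrt (c k)"
          by (rule real_le_rsqrt)
        then show "dist z x \<le> sqrt (c k)"
          by (simp add: dist_norm norm_minus_commute)
      qed
    qed
    ultimately show ?thesis
      using weak unfolding weak_laplacian_nonpos_def by blast
  qed
  \<comment> \<open>The Laplacian of the limit function, the same in \<open>x\<close> as in
    \<open>z\<close>; up to the normalising constant it is the kernel in the sum of
    \<open>D2\<close>.\<close>
  define L where "L x = ((norm (z - x))\<^sup>2 / s\<^sup>2 - N / s) * exp (- ((norm (z - x))\<^sup>2 / (2 * s)))" for x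
  \<comment> \<open>The smaller decay rate is matched by a larger variance: once
    \<open>(k + 1) / (k + 3) > s / s'\<close>, the kernel of variance \<open>s'\<close> majorises,
    and \<open>s' < T\<close> leaves room for the quadratic factor.\<close>
  define s' where "s' = (s + T) / 2"
  have s': "s < s'" "0 < s'" "s' < T"
    using s by (auto simp: s'_def)
  have ratio: "(\<lambda>k. real (k + j) / real (k + 3)) \<longlonglongrightarrow> 1" for j
  proof -
    have "(\<lambda>k. 1 + (real j - 3) / real (k + 3)) \<longlonglongrightarrow> 1 + 0"
      by (intro tendsto_intros LIMSEQ_ignore_initial_segment[OF lim_const_over_n])
    moreover have "1 + (real j - 3) / real (k + 3) = real (k + j) / real (k + 3)" for k
      by (simp add: field_simps)
    ultimately show ?thesis
      by simp
  qed
  then have "\<forall>\<^sub>F k in sequentially. s / s' < real (k + 1) / real (k + 3)"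
    by (rule order_tendstoD) (use s s' in simp)
  then obtain K where K: "\<And>k. K \<le> k \<Longrightarrow> s / s' < real (k + 1) / real (k + 3)"
    unfolding eventually_sequentially by blast
  have "(\<lambda>k. LINT x|lborel. f x * laplacian (\<psi> (k + K)) x) \<longlonglongrightarrow> (LINT x|lborel. f x * L x)"
  proof (rule integral_dominated_convergence)
    define C where "C = sqrt ((2 * pi * s') ^ DIM(real^'m))"
    define B where "B = max (1 / s\<^sup>2) (N / s)"
    have BN: "1 / s\<^sup>2 \<le> B" "N / s \<le> B" "0 \<le> B" "0 \<le> N"
      using s by (auto simp: B_def N_def le_max_iff_disj)
    have ik: "integrable lborel (\<lambda>x. (1 + (norm (z - x))\<^sup>2) * gauss s' (z - x) * f x)"
      by (rule kernel_integrable[where K=1]) (use s' in \<open>auto simp: abs_of_nonneg\<close>)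
    then show "integrable lborel (\<lambda>x. B * C * ((1 + (norm (z - x))\<^sup>2) * gauss s' (z - x) * f x))"
      by (rule integrable_mult_right)
    show "AE x in lborel. norm (f x * laplacian (\<psi> (k + K)) x)
        \<le> B * C * ((1 + (norm (z - x))\<^sup>2) * gauss s' (z - x) * f x)" for k
    proof (rule AE_I2)
      fix x
      define u where "u = (norm (z - x))\<^sup>2"
      define i where "i = k + K"
      have u: "0 \<le> u" "(norm (x - z))\<^sup>2 = u"
        by (auto simp: u_def norm_minus_commute)
      define A where "A = max 0 (1 - u / c i)"
      have A: "0 \<le> A" "A \<le> 1" "A = max 0 (1 - u / (2 * s) / real (i + 3))"
        using u c_pos[of i] by (auto simp: A_def c_def)
      have ex: "A ^ (i + 1) \<le> exp (- (u / (2 * s')))"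
      proof -
        have "A ^ (i + 1) \<le> exp (- (u / (2 * s) * real (i + 1) / real (i + 3)))"
          unfolding A(3) by (rule truncated_exp_le) (use u s in simp)
        also have "\<dots> \<le> exp (- (u / (2 * s')))"
        proof -
          have "u / (2 * s') = u / (2 * s) * (s / s')"
            using s by simp
          also have "\<dots> \<le> u / (2 * s) * (real (i + 1) / real (i + 3))"
            using K[of i] u s by (intro mult_left_mono) (auto simp: i_def)
          finally show ?thesis
            by simp
        qed
        finally show ?thesis .
      qed
      have "A ^ (i + 2) \<le> A ^ (i + 1)"
        using A by (intro power_decreasing) auto
      then have b1: "\<bar>2 * N * h1 i u\<bar> \<le> N / s * A ^ (i + 1)"
        using s A BN by (auto simp: h1_def A_def[symmetric] abs_mult field_simps mult_left_mono)
      have "real (i + 2) / real (i + 3) / (4 * s\<^sup>2) \<le> 1 / (4 * s\<^sup>2)"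
        by (intro divide_right_mono) auto
      then have "real (i + 2) / real (i + 3) / (4 * s\<^sup>2) * A ^ (i + 1) \<le> 1 / (4 * s\<^sup>2) * A ^ (i + 1)"
        using A by (intro mult_right_mono) auto
      then have "h2 i u \<le> 1 / (4 * s\<^sup>2) * A ^ (i + 1)"
        by (simp add: h2_def A_def)
      moreover have "0 \<le> h2 i u"
        by (simp add: h2_def)
      ultimately have "\<bar>4 * h2 i u * u\<bar> \<le> 4 * (1 / (4 * s\<^sup>2) * A ^ (i + 1)) * u"
        using u by (simp only: abs_of_nonneg mult_nonneg_nonneg zero_le_numeral)
          (intro mult_right_mono mult_left_mono, auto)
      then have b2: "\<bar>4 * h2 i u * u\<bar> \<le> 1 / s\<^sup>2 * A ^ (i + 1) * u"
        by simp
      have "\<bar>laplacian (\<psi> i) x\<bar> \<le> 1 / s\<^sup>2 * A ^ (i + 1) * u + N / s * A ^ (i + 1)"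
        unfolding lap u(2) using b1 b2 by linarith
      also have "\<dots> \<le> B * A ^ (i + 1) * u + B * A ^ (i + 1)"
        using BN A u by (intro add_mono mult_right_mono) auto
      also have "\<dots> = B * (1 + u) * A ^ (i + 1)"
        by (simp add: algebra_simps)
      also have "\<dots> \<le> B * (1 + u) * exp (- (u / (2 * s')))"
        using ex BN u by (intro mult_left_mono) auto
      also have "\<dots> = B * C * ((1 + u) * gauss s' (z - x))"
        using s' by (simp add: gauss_def C_def u_def)
      finally have "\<bar>laplacian (\<psi> i) x\<bar> * f x \<le> B * C * ((1 + u) * gauss s' (z - x)) * f x"
        by (rule mult_right_mono[OF _ f_nonneg])
      then show "norm (f x * laplacian (\<psi> (k + K)) x)
          \<le> B * C * ((1 + (norm (z - x))\<^sup>2) * gauss s' (z - x) * f x)"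
        using f_nonneg[of x] by (simp add: i_def u_def abs_mult mult_ac)
    qed
    show "AE x in lborel. (\<lambda>k. f x * laplacian (\<psi> (k + K)) x) \<longlonglongrightarrow> f x * L x"
    proof (rule AE_I2)
      fix x
      define u where "u = (norm (z - x))\<^sup>2"
      have u: "(norm (x - z))\<^sup>2 = u"
        by (auto simp: u_def norm_minus_commute)
      have c: "u / c k = (u / (2 * s)) / real (k + 3)" for k
        by (simp add: c_def)
      have t1: "(\<lambda>k. h1 k u) \<longlonglongrightarrow> - (1 / (2 * s)) * exp (- (u / (2 * s)))"
        unfolding h1_def c using truncated_exp_tendsto[of 1 "u / (2 * s)"] by (intro tendsto_intros) simp
      have q: "(\<lambda>k. real (k + 2) / real (k + 3) / (4 * s\<^sup>2)) \<longlonglongrightarrow> 1 / (4 * s\<^sup>2)"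
        by (intro tendsto_intros ratio) (use s in auto)
      have t2: "(\<lambda>k. h2 k u) \<longlonglongrightarrow> 1 / (4 * s\<^sup>2) * exp (- (u / (2 * s)))"
        unfolding h2_def c using truncated_exp_tendsto[of 2 "u / (2 * s)"] q by (intro tendsto_mult) simp_all
      have "(\<lambda>k. laplacian (\<psi> k) x) \<longlonglongrightarrow> 4 * (1 / (4 * s\<^sup>2) * exp (- (u / (2 * s)))) * u
          + 2 * N * (- (1 / (2 * s)) * exp (- (u / (2 * s))))"
        unfolding lap u by (intro tendsto_intros t1 t2)
      also have "4 * (1 / (4 * s\<^sup>2) * exp (- (u / (2 * s)))) * u
          + 2 * N * (- (1 / (2 * s)) * exp (- (u / (2 * s)))) = L x"
        using s by (simp add: L_def u_def[symmetric] field_simps)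
      finally have "(\<lambda>k. laplacian (\<psi> (k + K)) x) \<longlonglongrightarrow> L x"
        by (rule LIMSEQ_ignore_initial_segment)
      then show "(\<lambda>k. f x * laplacian (\<psi> (k + K)) x) \<longlonglongrightarrow> f x * L x"
        by (intro tendsto_intros)
    qed
    show "(\<lambda>x. f x * L x) \<in> borel_measurable lborel"
      unfolding L_def by measurable
    show "(\<lambda>x. f x * laplacian (\<psi> (k + K)) x) \<in> borel_measurable lborel" for k
      unfolding lap h1_def h2_def by measurable
  qed
  then have L0: "(LINT x|lborel. f x * L x) \<le> 0"
    by (rule LIMSEQ_le_const2) (simp add: le0)
  define D where "D = sqrt ((2 * pi * s) ^ DIM(real^'m))"
  have D: "0 < D"
    using s by (simp add: D_def)
  have g: "gauss s (z - x) = exp (- ((norm (z - x))\<^sup>2 / (2 * s))) / D" for x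
    by (simp add: gauss_def D_def)
  have "((norm (z - x))\<^sup>2 / (2 * s\<^sup>2) - real DIM(real^'m) / (2 * s)) * gauss s (z - x) * f x
      = 1 / (2 * D) * (f x * L x)" for x
    unfolding g L_def N_def using s D by (simp add: field_simps)
  then have "(\<Sum>b\<in>Basis. D2 s b z) = 2 * (LINT x|lborel. 1 / (2 * D) * (f x * L x))"
    unfolding sum_D2[OF s] by simp
  also have "\<dots> = 1 / D * (LINT x|lborel. f x * L x)"
    using D by simp
  also have "\<dots> \<le> 0"
    using D L0 by (simp add: divide_le_0_iff)
  finally show ?thesis .
qed

lemma partials_zero_imp_const:
  fixes f :: "'a::euclidean_space \<Rightarrow> real"
  assumes f: "has_partials f g h" and 0: "\<And>b z. b \<in> Basis \<Longrightarrow> g b z = 0"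
  shows "f x = f y"
proof -
  have step: "f (z + r *\<^sub>R b) = f z" if "b \<in> Basis" for z r b
    using DERIV_isconst_all[of "\<lambda>r. f (z + r *\<^sub>R b)" r 0] has_partialsD(1)[OF f that, of z] 0[OF that] by auto
  have "f (z + (\<Sum>b\<in>A. c b *\<^sub>R b)) = f z" if "finite A" "A \<subseteq> Basis" for A c z
    using that
  proof (induction A)
    case (insert b A)
    have "f (z + (\<Sum>b\<in>insert b A. c b *\<^sub>R b)) = f ((z + (\<Sum>b\<in>A. c b *\<^sub>R b)) + c b *\<^sub>R b)"
      using insert by (simp add: algebra_simps)
    then show ?case
      using insert step by simp
  qed simp
  from this[of Basis y "\<lambda>b. (x - y) \<bullet> b"] show ?thesis
    by (simp add: euclidean_representation)
qed

context heat_flow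
begin

text \<open>
  If \<open>heat s f\<close> decreases in \<open>s\<close> and is constant for one \<open>s\<close>, then it equals the same constant for all
  smaller \<open>s\<close>; letting \<open>s\<close> tend to \<open>0\<close> against open sets gives \<open>f \<le> c\<close>, hence \<open>f = c\<close>.
\<close>

lemma heat_const_imp_const:
  assumes mono: "\<And>s z. 0 < s \<Longrightarrow> s < T \<Longrightarrow> (\<Sum>b\<in>Basis. D2 s b z) \<le> 0"
    and s: "0 < s" "s < T" and const: "\<And>z. heat s f z = c"
  shows "AE x in lborel. f x = c"
proof -
  have c0: "0 \<le> c"
    using heat_nonneg[OF s(1), of f 0] f_nonneg const by simp
  \<comment> \<open>The convolution decreases in \<open>s\<close>, so it is at least
    \<open>c\<close> at the earlier time \<open>t\<close>, while its average with variance
    \<open>s - t\<close> is \<open>c\<close>; hence equality almost everywhere.\<close>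
  have heat_t: "AE z in lborel. heat t f z = c" if t: "0 < t" "t < s" for t
  proof -
    have ge: "c \<le> heat t f z" for z
    proof -
      have "heat s f z \<le> heat t f z"
      proof (rule DERIV_nonpos_imp_nonincreasing[where f="\<lambda>s. heat s f z"])
        show "\<exists>y. ((\<lambda>s. heat s f z) has_real_derivative y) (at r) \<and> y \<le> 0" if "t \<le> r" "r \<le> s" for r
          using heat_time_deriv[of r z] mono[of r z] that t s
          by (intro exI[of _ "(\<Sum>b\<in>Basis. D2 r b z) / 2"]) auto
      qed (use t in auto)
      then show ?thesis
        using const by simp
    qed
    have "heat_nn (s - t) (heat_nn t (\<lambda>x. ennreal (f x))) 0 = ennreal c"
      using t s by (subst heat_nn_heat_nn) (auto simp: heat_nn_eq const)
    moreover have "heat_nn t (\<lambda>x. ennreal (f x)) = (\<lambda>z. ennreal (heat t f z))"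
      using t s by (auto simp: heat_nn_eq)
    ultimately have "AE z in lborel. ennreal c = ennreal (heat t f z)"
      using t by (intro heat_nn_eq_imp_AE_eq[where s="s - t" and z=0]) (auto simp: heat_nn_const intro!: ennreal_leI ge)
    then show ?thesis
    proof eventually_elim
      case (elim x)
      then show ?case
        using c0 ge[of x] by simp
    qed
  qed
  \<comment> \<open>By symmetry of the kernel, the integral of \<open>f\<close> against the smoothed
    indicator of \<open>U\<close> is that of the convolution of \<open>f\<close>, hence of
    \<open>c\<close>, over \<open>U\<close>. As the variance tends to 0 the smoothed indicator tends
    to 1 on the open set \<open>U\<close>, and Fatou's lemma gives the bound.\<close>
  have open_le: "(\<integral>\<^sup>+x\<in>U. ennreal (f x) \<partial>lborel) \<le> ennreal c * emeasure lborel U" if U: "open U" for U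
  proof -
    have [measurable]: "U \<in> sets borel"
      using U by simp
    obtain t where t: "\<And>n. 0 < t n" "\<And>n. t n < s" and t0: "t \<longlonglongrightarrow> 0"
      using ex_sequence_above[OF s(1)] by blast
    have lim: "(\<lambda>n. heat (t n) (indicator U) x) \<longlonglongrightarrow> 1" if x: "x \<in> U" for x
    proof -
      have "(\<lambda>n. LINT w|lborel. gauss 1 w * indicator U (x - sqrt (t n) *\<^sub>R w)) \<longlonglongrightarrow> (LINT w|lborel. gauss 1 (w::'a))"
      proof (rule integral_dominated_convergence)
        show "integrable lborel (gauss 1 :: 'a \<Rightarrow> real)"
          using integrable_gauss[of 1 "0::'a"] by simp
        show "AE w in lborel. (\<lambda>n. gauss 1 w * indicator U (x - sqrt (t n) *\<^sub>R w)) \<longlonglongrightarrow> gauss 1 w"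
        proof (rule AE_I2)
          fix w
          have "(\<lambda>n. x - sqrt (t n) *\<^sub>R w) \<longlonglongrightarrow> x - sqrt 0 *\<^sub>R w"
            by (intro tendsto_intros t0)
          then have "\<forall>\<^sub>F n in sequentially. x - sqrt (t n) *\<^sub>R w \<in> U"
            by (rule topological_tendstoD) (use U x in auto)
          then have "\<forall>\<^sub>F n in sequentially. gauss 1 w = gauss 1 w * indicator U (x - sqrt (t n) *\<^sub>R w)"
            by eventually_elim simp
          then show "(\<lambda>n. gauss 1 w * indicator U (x - sqrt (t n) *\<^sub>R w)) \<longlonglongrightarrow> gauss 1 w"
            by (rule Lim_transform_eventually[OF tendsto_const])
        qed
        show "AE w in lborel. norm (gauss 1 w * indicator U (x - sqrt (t n) *\<^sub>R w)) \<le> gauss 1 w" for n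
          by (intro AE_I2) (auto simp: indicator_def gauss_nonneg)
      qed measurable
      then show ?thesis
        using t integral_gauss[of 1 "0::'a"] by (simp add: heat_rescale)
    qed
    have ind: "heat_nn (t n) (indicator U) x = ennreal (heat (t n) (indicator U) x)" for n x
    proof -
      interpret i: heat_flow "indicator U :: 'a \<Rightarrow> real" "t n"
        by (rule heat_flow_bounded[of _ _ 1]) (use t in auto)
      show ?thesis
        using i.heat_nn_eq[of "t n" x] t by (simp add: ennreal_indicator)
    qed
    have "(\<integral>\<^sup>+x\<in>U. ennreal (f x) \<partial>lborel) \<le> (\<integral>\<^sup>+x. liminf (\<lambda>n. ennreal (f x) * heat_nn (t n) (indicator U) x) \<partial>lborel)"
    proof (rule nn_integral_mono)
      fix x
      show "ennreal (f x) * indicator U x \<le> liminf (\<lambda>n. ennreal (f x) * heat_nn (t n) (indicator U) x)"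
      proof (cases "x \<in> U")
        case True
        have "(\<lambda>n. ennreal (f x * heat (t n) (indicator U) x)) \<longlonglongrightarrow> ennreal (f x * 1)"
          by (intro tendsto_ennrealI tendsto_intros lim True)
        then have "liminf (\<lambda>n. ennreal (f x * heat (t n) (indicator U) x)) = ennreal (f x)"
          by (simp add: lim_imp_Liminf)
        then show ?thesis
          using True by (simp add: ind ennreal_mult' f_nonneg)
      qed simp
    qed
    also have "\<dots> \<le> liminf (\<lambda>n. \<integral>\<^sup>+x. ennreal (f x) * heat_nn (t n) (indicator U) x \<partial>lborel)"
      by (rule nn_integral_liminf) measurable
    also have "\<dots> \<le> liminf (\<lambda>n. ennreal c * emeasure lborel U)"
    proof (rule Liminf_mono, rule always_eventually, rule allI)
      fix n
      let ?k = "\<lambda>x y. ennreal (f x) * (ennreal (gauss (t n) (x - y)) * indicator U y)"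
      have "(\<integral>\<^sup>+x. ennreal (f x) * heat_nn (t n) (indicator U) x \<partial>lborel)
         = (\<integral>\<^sup>+x. \<integral>\<^sup>+y. ?k x y \<partial>lborel \<partial>lborel)"
        unfolding heat_nn_def by (simp add: nn_integral_cmult)
      also have "\<dots> = (\<integral>\<^sup>+y. \<integral>\<^sup>+x. ?k x y \<partial>lborel \<partial>lborel)"
        by (rule lborel_pair.Fubini') measurable
      also have "\<dots> = (\<integral>\<^sup>+y. heat_nn (t n) (\<lambda>x. ennreal (f x)) y * indicator U y \<partial>lborel)"
        unfolding heat_nn_def
        by (subst nn_integral_multc[symmetric])
           (auto simp: gauss_minus_commute mult_ac intro!: nn_integral_cong)
      also have "\<dots> = (\<integral>\<^sup>+y. ennreal (heat (t n) f y) * indicator U y \<partial>lborel)"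
        using t s by (simp add: heat_nn_eq less_imp_le[OF less_trans[OF t(2) s(2)]])
      also have "\<dots> = (\<integral>\<^sup>+y. ennreal c * indicator U y \<partial>lborel)"
      proof (rule nn_integral_cong_AE)
        show "AE y in lborel. ennreal (heat (t n) f y) * indicator U y = ennreal c * indicator U y"
          using heat_t[OF t(1)[of n] t(2)[of n]] by eventually_elim simp
      qed
      also have "\<dots> = ennreal c * emeasure lborel U"
        by (simp add: nn_integral_cmult_indicator)
      finally show "(\<integral>\<^sup>+x. ennreal (f x) * heat_nn (t n) (indicator U) x \<partial>lborel) \<le> ennreal c * emeasure lborel U"
        by simp
    qed
    also have "\<dots> = ennreal c * emeasure lborel U"
      by (simp add: Liminf_const)
    finally show ?thesis .
  qed
  \<comment> \<open>Restriction to a ball keeps the measures finite, so that an excess of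
    \<open>f\<close> over \<open>c\<close> yields a strict inequality.\<close>
  have ball: "AE x in lborel. x \<in> cball 0 (real R) \<longrightarrow> f x \<le> c" for R :: nat
  proof (rule ccontr)
    assume not_le: "\<not> ?thesis"
    define B where "B = {x \<in> cball (0::'a) (real R). c < f x}"
    have [measurable]: "B \<in> sets borel"
      unfolding B_def by measurable
    have "emeasure lborel B < \<infinity>"
      by (rule emeasure_bounded_finite, rule bounded_subset[OF bounded_cball[of 0 "real R"]]) (auto simp: B_def)
    then have fin: "ennreal c * emeasure lborel B < \<infinity>"
      by (simp add: ennreal_mult_less_top)
    have "(\<integral>\<^sup>+x\<in>B. ennreal c \<partial>lborel) < (\<integral>\<^sup>+x\<in>B. ennreal (f x) \<partial>lborel)"
    proof (rule nn_integral_less)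
      show "(\<integral>\<^sup>+x\<in>B. ennreal c \<partial>lborel) \<noteq> \<infinity>"
        using fin by (simp add: nn_integral_cmult_indicator)
      show "AE x in lborel. ennreal c * indicator B x \<le> ennreal (f x) * indicator B x"
        by (intro AE_I2) (auto simp: B_def indicator_def intro!: ennreal_leI)
      show "\<not> (AE x in lborel. ennreal (f x) * indicator B x \<le> ennreal c * indicator B x)"
      proof
        assume "AE x in lborel. ennreal (f x) * indicator B x \<le> ennreal c * indicator B x"
        then have "AE x in lborel. x \<in> cball 0 (real R) \<longrightarrow> f x \<le> c"
        proof eventually_elim
          case (elim x)
          then show ?case
            using c0 by (cases "c < f x") (auto simp: B_def)
        qed
        with not_le show False ..
      qed
    qed measurable
    moreover have "(\<integral>\<^sup>+x\<in>B. ennreal (f x) \<partial>lborel) \<le> ennreal c * emeasure lborel B"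
    proof (rule ennreal_le_epsilon)
      fix e :: real assume e: "0 < e"
      \<comment> \<open>Outer regularity extends the bound from open sets to \<open>B\<close>;
        \<open>c + 1\<close> avoids a division by 0 when \<open>c = 0\<close>.\<close>
      then obtain U where U: "open U" "B \<subseteq> U" "emeasure lebesgue (U - B) < ennreal (e / (c + 1))"
        using sets_lebesgue_outer_open[of B "e / (c + 1)"] c0 by auto
      have [measurable]: "U \<in> sets borel"
        using U(1) by simp
      have "(\<integral>\<^sup>+x\<in>B. ennreal (f x) \<partial>lborel) \<le> (\<integral>\<^sup>+x\<in>U. ennreal (f x) \<partial>lborel)"
        using U(2) by (intro nn_integral_mono) (auto simp: indicator_def)
      also have "\<dots> \<le> ennreal c * emeasure lborel U"
        by (rule open_le[OF U(1)])
      also have "emeasure lborel U = emeasure lborel B + emeasure lborel (U - B)"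
        using U(2) by (subst plus_emeasure) (auto intro!: arg_cong[where f="emeasure lborel"])
      also have "ennreal c * \<dots> \<le> ennreal c * emeasure lborel B + ennreal c * ennreal (e / (c + 1))"
        unfolding distrib_left using U(3) by (intro add_left_mono mult_left_mono) auto
      also have "\<dots> \<le> ennreal c * emeasure lborel B + ennreal e"
        using c0 e by (intro add_left_mono) (auto simp: field_simps simp flip: ennreal_mult intro!: ennreal_leI)
      finally show "(\<integral>\<^sup>+x\<in>B. ennreal (f x) \<partial>lborel) \<le> ennreal c * emeasure lborel B + ennreal e" .
    qed
    ultimately show False
      by (simp add: nn_integral_cmult_indicator)
  qed
  then have "AE x in lborel. \<forall>R. x \<in> cball 0 (real R) \<longrightarrow> f x \<le> c"
    unfolding AE_all_countable by blast
  then have le: "AE x in lborel. f x \<le> c"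
    by eventually_elim (use real_arch_simple in auto)
  \<comment> \<open>With \<open>min (f x) c\<close> the inequality holds everywhere, as the equality
    case of averaging requires.\<close>
  have "heat_nn s (\<lambda>x. ennreal (min (f x) c)) 0 = heat_nn s (\<lambda>x. ennreal (f x)) 0"
    unfolding heat_nn_def using le by (intro nn_integral_cong_AE) (auto simp: min_def)
  also have "\<dots> = ennreal c"
    using s const by (simp add: heat_nn_eq)
  finally have "AE x in lborel. ennreal (min (f x) c) = ennreal c"
    using s by (intro heat_nn_eq_imp_AE_eq[where s=s and z=0]) (auto simp: heat_nn_const intro!: ennreal_leI)
  then show ?thesis
    using le
  proof eventually_elim
    case (elim x)
    then show ?case
      using f_nonneg[of x] c0 by (simp add: min_def split: if_splits)
  qed
qed

end

section \<open>Projections of Gaussian measures\<close>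

lemma nn_integral_lborel_translation:
  fixes g :: "'a::euclidean_space \<Rightarrow> ennreal"
  assumes [measurable]: "g \<in> borel_measurable borel"
  shows "(\<integral>\<^sup>+x. g (c + x) \<partial>lborel) = (\<integral>\<^sup>+x. g x \<partial>lborel)"
proof -
  have "(\<integral>\<^sup>+x. g x \<partial>lborel) = (\<integral>\<^sup>+x. g x \<partial>distr lborel borel ((+) c))"
    by (simp add: lborel_distr_plus)
  also have "\<dots> = (\<integral>\<^sup>+x. g (c + x) \<partial>lborel)"
    by (subst nn_integral_distr) auto
  finally show ?thesis
    by simp
qed

lemma borel_measurable_linear:
  fixes T :: "'a::euclidean_space \<Rightarrow> 'b::euclidean_space"
  shows "linear T \<Longrightarrow> T \<in> borel_measurable borel"
  by (intro borel_measurable_continuous_onI linear_continuous_on) (simp add: linear_conv_bounded_linear)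

text \<open>
  The uniqueness argument for Haar measure: by translation invariance, \<open>distr lborel borel T\<close> and \<open>lborel\<close>
  are proportional, and they agree on balls.
\<close>

lemma distr_lborel_isometry:
  fixes T :: "'a::euclidean_space \<Rightarrow> 'b::euclidean_space"
  assumes T: "linear T" "surj T" and norm: "\<And>x. norm (T x) = norm x" and dim: "DIM('a) = DIM('b)"
  shows "distr lborel borel T = lborel"
proof (rule measure_eqI)
  have [measurable]: "T \<in> borel_measurable borel"
    by (rule borel_measurable_linear[OF T(1)])
  show "sets (distr lborel borel T) = sets lborel"
    by simp
  fix A assume "A \<in> sets (distr lborel borel T)"
  then have [measurable]: "A \<in> sets borel"
    by simp
  define B where "B = ball (0::'b) 1"
  have [measurable]: "B \<in> sets borel"
    by (simp add: B_def)
  have vol: "emeasure lborel (ball y 1) = emeasure lborel B" for y :: 'a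
    using dim by (simp add: B_def emeasure_ball)
  have finite: "emeasure lborel B \<noteq> 0" "emeasure lborel B \<noteq> top"
    using emeasure_lborel_ball_finite[of "0::'b" 1] content_ball_pos[of 1 "0::'b"]
    by (auto simp: B_def measure_def)
  have shiftT: "(\<integral>\<^sup>+x. indicator A (T x) \<partial>lborel) = (\<integral>\<^sup>+x. indicator A (T x + y) \<partial>lborel)" for y
  proof -
    obtain c where c: "y = T c"
      using T(2) by auto
    show ?thesis
      using nn_integral_lborel_translation[of "\<lambda>x. indicator A (T x)" c]
      by (simp add: c linear_add[OF T(1)] add.commute)
  qed
  \<comment> \<open>The isometry pulls a unit ball back to a unit ball, whose volume depends on the
    dimension only.\<close>
  have ballT: "(\<integral>\<^sup>+x. indicator B (y - T x) \<partial>lborel) = emeasure lborel B" for y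
  proof -
    obtain c where c: "y = T c"
      using T(2) by auto
    have "indicator B (y - T x) = (indicator (ball c 1) x :: ennreal)" for x
      by (simp add: c linear_diff[OF T(1), symmetric] B_def norm dist_norm indicator_def)
    then show ?thesis
      by (simp add: vol)
  qed
  \<comment> \<open>Average over shifts \<open>y\<close> in \<open>B\<close>; translation invariance
    and Fubini move the shift from \<open>A\<close> to \<open>B\<close>.\<close>
  have "emeasure (distr lborel borel T) A * emeasure lborel B
      = (\<integral>\<^sup>+y. (\<integral>\<^sup>+x. indicator A (T x) \<partial>lborel) * indicator B y \<partial>lborel)"
    by (simp add: nn_integral_cmult nn_integral_indicator[symmetric] nn_integral_distr
        del: nn_integral_indicator)
  also have "\<dots> = (\<integral>\<^sup>+y. \<integral>\<^sup>+x. indicator A (T x + y) * indicator B y \<partial>lborel \<partial>lborel)"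
  proof (rule nn_integral_cong)
    show "(\<integral>\<^sup>+x. indicator A (T x) \<partial>lborel) * indicator B y = (\<integral>\<^sup>+x. indicator A (T x + y) * indicator B y \<partial>lborel)" for y
      by (subst shiftT[of y]) (simp add: nn_integral_multc)
  qed
  also have "\<dots> = (\<integral>\<^sup>+x. \<integral>\<^sup>+y. indicator A (T x + y) * indicator B y \<partial>lborel \<partial>lborel)"
    by (rule lborel_pair.Fubini') measurable
  also have "\<dots> = (\<integral>\<^sup>+x. \<integral>\<^sup>+y. indicator A y * indicator B (y - T x) \<partial>lborel \<partial>lborel)"
  proof (rule nn_integral_cong)
    fix x
    show "(\<integral>\<^sup>+y. indicator A (T x + y) * indicator B y \<partial>lborel) = (\<integral>\<^sup>+y. indicator A y * indicator B (y - T x) \<partial>lborel)"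
      using nn_integral_lborel_translation[of "\<lambda>y. indicator A y * indicator B (y - T x)" "T x"] by simp
  qed
  also have "\<dots> = (\<integral>\<^sup>+y. \<integral>\<^sup>+x. indicator A y * indicator B (y - T x) \<partial>lborel \<partial>lborel)"
    by (rule lborel_pair.Fubini'[symmetric]) measurable
  also have "\<dots> = emeasure lborel A * emeasure lborel B"
    by (simp add: nn_integral_cmult ballT nn_integral_multc)
  finally have "emeasure (distr lborel borel T) A * emeasure lborel B / emeasure lborel B
      = emeasure lborel A * emeasure lborel B / emeasure lborel B"
    by (rule arg_cong)
  then show "emeasure (distr lborel borel T) A = emeasure lborel A"
    using finite by (simp add: mult_divide_eq_ennreal)
qed

lemma gauss_scale:
  fixes u :: "'a::euclidean_space"
  assumes "0 < s" "0 < c"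
  shows "c ^ DIM('a) * gauss s (c *\<^sub>R u) = gauss (s / c\<^sup>2) u"
proof -
  have "(c\<^sup>2) ^ DIM('a) = (c ^ DIM('a))\<^sup>2"
    by (metis power_mult mult.commute)
  then have "(2 * pi * (s / c\<^sup>2)) ^ DIM('a) = (2 * pi * s) ^ DIM('a) / (c ^ DIM('a))\<^sup>2"
    by (metis power_divide times_divide_eq_right)
  then have "sqrt ((2 * pi * (s / c\<^sup>2)) ^ DIM('a)) = sqrt ((2 * pi * s) ^ DIM('a)) / c ^ DIM('a)"
    using assms by (simp add: real_sqrt_divide)
  then show ?thesis
    using assms by (simp add: gauss_def power_mult_distrib field_simps)
qed

lemma nn_integral_lborel_scale:
  fixes g :: "'a::euclidean_space \<Rightarrow> ennreal"
  assumes c: "0 < c" and [measurable]: "g \<in> borel_measurable borel"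
  shows "(\<integral>\<^sup>+x. g x \<partial>lborel) = ennreal (c ^ DIM('a)) * (\<integral>\<^sup>+x. g (t + c *\<^sub>R x) \<partial>lborel)"
proof -
  have "(\<integral>\<^sup>+x. g x \<partial>lborel) = (\<integral>\<^sup>+x. g x \<partial>density (distr lborel borel (\<lambda>x. t + c *\<^sub>R x)) (\<lambda>_. \<bar>c\<bar> ^ DIM('a)))"
    using c by (subst lborel_affine[of c t]) auto
  also have "\<dots> = ennreal (c ^ DIM('a)) * (\<integral>\<^sup>+x. g (t + c *\<^sub>R x) \<partial>lborel)"
    using c by (subst nn_integral_density, simp, simp, subst nn_integral_distr)
      (auto simp: nn_integral_cmult)
  finally show ?thesis .
qed

text \<open>For independent normals around \<open>\<zeta>\<close> the weighted mean has variance
  \<open>(t^2 * s + s^2 * t) / (s + t)^2 = s * t / (s + t)\<close>. In terms of densities,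
  \<open>gauss_mult\<close> splits the pair into difference and mean, and the mean replaces
  \<open>y\<close> as variable.\<close>

lemma weighted_mean_law:
  fixes g :: "'a::euclidean_space \<Rightarrow> ennreal"
  assumes s: "0 < s" and t: "0 < t" and [measurable]: "g \<in> borel_measurable borel"
  shows "heat_nn s (\<lambda>x. heat_nn t (\<lambda>y. g ((t / (s + t)) *\<^sub>R x + (s / (s + t)) *\<^sub>R y)) \<zeta>) \<zeta>
    = heat_nn (s * t / (s + t)) g \<zeta>"
proof -
  let ?M = "\<lambda>x y. (t / (s + t)) *\<^sub>R x + (s / (s + t)) *\<^sub>R y"
  define W where "W = s * t / (s + t)"
  \<comment> \<open>For fixed \<open>x\<close>, the weighted mean equals \<open>w\<close> when
    \<open>y = - (t / s) x + c w\<close>; \<open>\<tau> = s^2 / (s + t)\<close> is then the variance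
    of \<open>x\<close> around \<open>w\<close>.\<close>
  define c where "c = (s + t) / s"
  define \<tau> where "\<tau> = (s + t) / c\<^sup>2"
  have pos: "0 < W" "0 < c" "0 < \<tau>"
    using s t by (auto simp: W_def c_def \<tau>_def)
  have w: "?M x (- (t / s) *\<^sub>R x + c *\<^sub>R w) = w" for x w :: 'a
  proof -
    have "s / (s + t) * c = 1" "s / (s + t) * (t / s) = t / (s + t)"
      using s t by (auto simp: c_def)
    then show ?thesis
      by (simp add: scaleR_add_right scaleR_diff_right del: times_divide_eq_left times_divide_eq_right)
  qed
  have d: "x - (- (t / s) *\<^sub>R x + c *\<^sub>R w) = c *\<^sub>R (x - w)" for x w :: 'a
  proof -
    have "x - (- (t / s) *\<^sub>R x + c *\<^sub>R w) = (1 + t / s) *\<^sub>R x - c *\<^sub>R w"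
      by (simp add: algebra_simps)
    also have "1 + t / s = c"
      using s by (simp add: c_def field_simps)
    finally show ?thesis
      by (simp add: scaleR_diff_right)
  qed
  have inner: "ennreal (gauss s (\<zeta> - x)) * heat_nn t (\<lambda>y. g (?M x y)) \<zeta>
      = (\<integral>\<^sup>+w. ennreal (gauss \<tau> (w - x)) * (ennreal (gauss W (\<zeta> - w)) * g w) \<partial>lborel)" for x
  proof -
    have "ennreal (gauss s (\<zeta> - x)) * heat_nn t (\<lambda>y. g (?M x y)) \<zeta>
      = (\<integral>\<^sup>+y. ennreal (gauss s (x - \<zeta>) * gauss t (y - \<zeta>)) * g (?M x y) \<partial>lborel)"
      unfolding heat_nn_def using s t
      by (simp add: nn_integral_cmult[symmetric] ennreal_mult gauss_nonneg mult.assoc gauss_minus_commute[of _ \<zeta>])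
    also have "\<dots> = (\<integral>\<^sup>+y. ennreal (gauss (s + t) (x - y) * gauss W (?M x y - \<zeta>))
        * g (?M x y) \<partial>lborel)"
      by (simp only: gauss_mult[OF s t] W_def)
    also have "\<dots> = ennreal (c ^ DIM('a)) * (\<integral>\<^sup>+w. ennreal (gauss (s + t) (c *\<^sub>R (x - w)) * gauss W (w - \<zeta>)) * g w \<partial>lborel)"
      by (subst nn_integral_lborel_scale[OF pos(2), where t="- (t / s) *\<^sub>R x"]) (simp_all only: w d, measurable)
    also have "\<dots> = (\<integral>\<^sup>+w. ennreal (c ^ DIM('a) * gauss (s + t) (c *\<^sub>R (x - w))) * (ennreal (gauss W (\<zeta> - w)) * g w) \<partial>lborel)"
      using s t pos
      by (simp add: nn_integral_cmult[symmetric] ennreal_mult gauss_nonneg mult.assoc gauss_minus_commute[of _ \<zeta>])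
    also have "\<dots> = (\<integral>\<^sup>+w. ennreal (gauss \<tau> (w - x)) * (ennreal (gauss W (\<zeta> - w)) * g w) \<partial>lborel)"
      using s t pos by (subst gauss_scale) (auto simp: \<tau>_def gauss_minus_commute)
    finally show ?thesis .
  qed
  have "heat_nn s (\<lambda>x. heat_nn t (\<lambda>y. g (?M x y)) \<zeta>) \<zeta>
     = (\<integral>\<^sup>+x. \<integral>\<^sup>+w. ennreal (gauss \<tau> (w - x)) * (ennreal (gauss W (\<zeta> - w)) * g w) \<partial>lborel \<partial>lborel)"
    by (subst heat_nn_def) (simp add: inner)
  also have "\<dots> = (\<integral>\<^sup>+w. \<integral>\<^sup>+x. ennreal (gauss \<tau> (w - x)) * (ennreal (gauss W (\<zeta> - w)) * g w) \<partial>lborel \<partial>lborel)"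
    by (rule lborel_pair.Fubini') measurable
  also have "\<dots> = heat_nn W g \<zeta>"
    using pos by (simp add: nn_integral_multc nn_integral_gauss heat_nn_def)
  finally show ?thesis
    by (simp add: W_def)
qed

text \<open>The coordinate \<open>None\<close> of \<open>H *v x\<close> is the one along \<open>a\<close>.\<close>

definition vcons :: "real \<Rightarrow> real^'m \<Rightarrow> real^('m::finite option)" where
  "vcons t y = (\<chi> k. case k of None \<Rightarrow> t | Some i \<Rightarrow> y $ i)"

lemma sum_option: "(\<Sum>k\<in>(UNIV :: ('m::finite) option set). F k) = F None + (\<Sum>i\<in>UNIV. F (Some i))"
  by (simp add: UNIV_option_conv sum.reindex)

locale orthogonal_split =
  fixes H :: "real^('m::finite option)^('m option)" and H2 :: "real^('m option)^'m"
  assumes H: "orthogonal_matrix H" and rows: "\<And>i. row (Some i) H = row i H2"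
begin

lemmas [simp del] = transpose_matrix_vector

lemma H_mult_Some: "(H *v x) $ Some i = (H2 *v x) $ i"
  using rows[of i] by (simp add: matrix_vector_mul_component row_def)

lemma H_transpose: "H *v (transpose H *v x) = x" "transpose H *v (H *v x) = x"
  using H by (auto simp: orthogonal_matrix_def matrix_vector_mul_assoc)

lemma norm_H: "norm (H *v x) = norm x" "norm (transpose H *v x) = norm x"
proof -
  have *: "norm (A *v x) = norm x" if "orthogonal_matrix A" for A :: "real^('m option)^('m option)"
    using that orthogonal_transformation_matrix[of "\<lambda>x. A *v x"]
    by (auto simp: matrix_vector_mul_linear orthogonal_transformation_norm)
  show "norm (H *v x) = norm x" "norm (transpose H *v x) = norm x"
    using * H by auto
qed

lemma H_split: "H *v x = vcons ((H *v x) $ None) (H2 *v x)"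
  by (auto simp: vec_eq_iff vcons_def H_mult_Some split: option.split)

text \<open>Inverse of the isometry that sends \<open>x\<close> to the \<open>None\<close>
  coordinate of its rotation and its image under \<open>H2\<close>.\<close>

definition merge :: "real \<times> (real^'m) \<Rightarrow> real^('m option)" where
  "merge p = transpose H *v vcons (fst p) (snd p)"

lemma H2_merge: "H2 *v merge p = snd p"
proof -
  have "(H2 *v merge p) $ i = vcons (fst p) (snd p) $ Some i" for i
    by (simp add: merge_def H_transpose flip: H_mult_Some)
  then show ?thesis
    by (simp add: vec_eq_iff vcons_def)
qed

lemma norm_vcons: "(norm (vcons t y))\<^sup>2 = t\<^sup>2 + (norm y)\<^sup>2"
  unfolding power2_norm_eq_inner by (simp add: inner_vec_def sum_option vcons_def power2_eq_square)

lemma norm_diff_merge: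
  "(norm (x - merge (t, y)))\<^sup>2 = ((H *v x) $ None - t)\<^sup>2 + (norm (H2 *v x - y))\<^sup>2"
proof -
  have "norm (x - merge (t, y)) = norm (H *v (x - merge (t, y)))"
    by (simp add: norm_H)
  also have "H *v (x - merge (t, y)) = vcons ((H *v x) $ None) (H2 *v x) - vcons t y"
    by (subst H_split[symmetric]) (simp add: matrix_vector_mult_diff_distrib merge_def H_transpose)
  also have "\<dots> = vcons ((H *v x) $ None - t) (H2 *v x - y)"
    by (auto simp: vec_eq_iff vcons_def split: option.split)
  finally show ?thesis
    by (simp add: norm_vcons)
qed

lemma linear_merge: "linear merge"
proof -
  have "linear (\<lambda>p::real \<times> (real^'m). vcons (fst p) (snd p))"
    by (rule linearI) (auto simp: vec_eq_iff vcons_def split: option.split)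
  then show ?thesis
    unfolding merge_def[abs_def]
    using linear_compose[of "\<lambda>p. vcons (fst p) (snd p)" "\<lambda>x. transpose H *v x"]
    by (simp add: comp_def matrix_vector_mul_linear)
qed

lemma distr_merge: "distr lborel borel merge = lborel"
proof (rule distr_lborel_isometry[OF linear_merge])
  show "surj merge"
  proof (rule surjI)
    show "merge ((H *v x) $ None, H2 *v x) = x" for x
      by (simp add: merge_def H_split[symmetric] H_transpose)
  qed
  show "norm (merge p) = norm p" for p
  proof -
    have "(norm (merge p))\<^sup>2 = (norm p)\<^sup>2"
      by (simp add: merge_def norm_H norm_vcons norm_prod_def)
    then show ?thesis
      by simp
  qed
qed simp

lemma gauss_merge: "0 < s \<Longrightarrow> gauss s (x - merge (t, y)) = gauss s ((H *v x) $ None - t) * gauss s (H2 *v x - y)"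
  by (simp add: gauss_def norm_diff_merge exp_add[symmetric] diff_divide_distrib real_sqrt_mult[symmetric])

lemma H2_measurable [measurable]: "(*v) H2 \<in> borel_measurable borel"
  by (rule borel_measurable_linear[OF matrix_vector_mul_linear])

text \<open>In rotated coordinates the isotropic kernel is a product, and the factor in the
  \<open>None\<close> coordinate integrates to 1.\<close>

lemma heat_nn_project:
  fixes f :: "real^'m \<Rightarrow> ennreal"
  assumes s: "0 < s" and [measurable]: "f \<in> borel_measurable borel"
  shows "heat_nn s (\<lambda>x. f (H2 *v x)) w = heat_nn s f (H2 *v w)"
proof -
  have [measurable]: "merge \<in> borel_measurable borel"
    by (rule borel_measurable_linear[OF linear_merge])
  have [measurable]: "(snd :: real \<times> (real^'m) \<Rightarrow> _) \<in> borel_measurable borel"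
    by (intro borel_measurable_continuous_onI continuous_intros)
  have "heat_nn s (\<lambda>x. f (H2 *v x)) w = (\<integral>\<^sup>+x. ennreal (gauss s (w - x)) * f (H2 *v x) \<partial>distr lborel borel merge)"
    by (simp add: heat_nn_def distr_merge)
  also have "\<dots> = (\<integral>\<^sup>+p. ennreal (gauss s (w - merge p)) * f (snd p) \<partial>(lborel \<Otimes>\<^sub>M lborel))"
    by (subst nn_integral_distr) (simp_all add: H2_merge lborel_prod)
  also have "\<dots> = (\<integral>\<^sup>+y. \<integral>\<^sup>+t. ennreal (gauss s (w - merge (t, y))) * f y \<partial>lborel \<partial>lborel)"
    by (subst lborel_pair.nn_integral_snd[symmetric]) (auto simp: lborel_prod)
  also have "\<dots> = (\<integral>\<^sup>+y. \<integral>\<^sup>+t. ennreal (gauss s ((H *v w) $ None - t)) * (ennreal (gauss s (H2 *v w - y)) * f y) \<partial>lborel \<partial>lborel)"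
    using s by (simp add: gauss_merge ennreal_mult gauss_nonneg mult.assoc)
  also have "\<dots> = heat_nn s f (H2 *v w)"
    using s by (simp add: nn_integral_multc nn_integral_gauss heat_nn_def)
  finally show ?thesis .
qed

text \<open>The rows of \<open>H2\<close> are orthogonal to the \<open>None\<close> row of
  \<open>H\<close>, a multiple of \<open>a\<close>. It is this that hides the mixing variables from
  the prior.\<close>

lemma H2_zero:
  assumes "a \<noteq> 0" "row None H = (1 / norm a) *\<^sub>R a"
  shows "H2 *v a = 0"
proof -
  have "(H2 *v a) $ i = 0" for i
  proof -
    have "a = norm a *\<^sub>R row None H"
      using assms by simp
    then have "row (Some i) H \<bullet> a = norm a * (row (Some i) H \<bullet> row None H)"
      by (metis inner_scaleR_right)
    moreover have "(H2 *v a) $ i = row (Some i) H \<bullet> a"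
      unfolding rows by (simp add: matrix_vector_mul_component row_def)
    ultimately have "(H2 *v a) $ i = norm a * (row (Some i) H \<bullet> row None H)"
      by simp
    also have "row (Some i) H \<bullet> row None H = 0"
      using H unfolding orthogonal_matrix_orthonormal_rows by (auto simp: orthogonal_def)
    finally show ?thesis
      by simp
  qed
  then show ?thesis
    by (simp add: vec_eq_iff)
qed

end

section \<open>Predictive densities in mean mixtures of normals\<close>

lemma (in prob_space) integral_pos_bounded:
  fixes f :: "'a \<Rightarrow> real"
  assumes [measurable]: "f \<in> borel_measurable M" and f: "\<And>x. 0 < f x" "\<And>x. f x \<le> B"
  shows "integrable M f" and "0 < integral\<^sup>L M f" and "integral\<^sup>L M f \<le> B"
proof -
  have f0: "0 \<le> f x" "f x \<noteq> 0" for x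
    using f(1)[of x] by auto
  show i: "integrable M f"
    by (rule integrable_const_bound[of _ B]) (use f f0 in auto)
  have "integral\<^sup>L M f \<noteq> 0"
    by (subst integral_nonneg_eq_0_iff_AE[OF i]) (simp_all add: f0 AE_False)
  moreover have "0 \<le> integral\<^sup>L M f"
    by (intro Bochner_Integration.integral_nonneg f0)
  ultimately show "0 < integral\<^sup>L M f"
    by simp
  have "integral\<^sup>L M f \<le> (LINT x|M. B)"
    by (intro integral_mono i f) auto
  then show "integral\<^sup>L M f \<le> B"
    by (simp add: prob_space)
qed

locale mixture = real_distribution M for M :: "real measure" +
  fixes s :: real and a :: "'a::euclidean_space"
  assumes s_pos: "0 < s"
begin

definition dens :: "'a \<Rightarrow> real" where
  "dens u = (LINT v|M. gauss s (u - v *\<^sub>R a))"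

lemma gauss_int: "integrable M (\<lambda>v. gauss s (u - v *\<^sub>R a))"
  by (rule integral_pos_bounded(1)[OF _ gauss_pos[OF s_pos] gauss_le[OF s_pos]]) measurable

lemma dens_nn: "ennreal (dens u) = (\<integral>\<^sup>+v. ennreal (gauss s (u - v *\<^sub>R a)) \<partial>M)"
  unfolding dens_def by (rule nn_integral_eq_integral[symmetric, OF gauss_int]) (simp add: gauss_nonneg s_pos)

lemma dens_diff_nn:
  "ennreal (dens (x - y)) = (\<integral>\<^sup>+v. ennreal (gauss s (x - v *\<^sub>R a - y)) \<partial>M)"
  "ennreal (dens (y - x)) = (\<integral>\<^sup>+v. ennreal (gauss s (x + v *\<^sub>R a - y)) \<partial>M)"
proof -
  show "ennreal (dens (x - y)) = (\<integral>\<^sup>+v. ennreal (gauss s (x - v *\<^sub>R a - y)) \<partial>M)"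
    unfolding dens_nn by (simp add: algebra_simps)
  have "gauss s (y - x - v *\<^sub>R a) = gauss s (x + v *\<^sub>R a - y)" for v
    using gauss_minus_commute[of s y "x + v *\<^sub>R a"] by (simp add: diff_diff_add)
  then show "ennreal (dens (y - x)) = (\<integral>\<^sup>+v. ennreal (gauss s (x + v *\<^sub>R a - y)) \<partial>M)"
    unfolding dens_nn by simp
qed

lemma dens_pos [simp]: "0 < dens u"
  unfolding dens_def
  by (rule integral_pos_bounded(2)[OF _ gauss_pos[OF s_pos] gauss_le[OF s_pos]]) measurable

lemma dens_nonneg [simp]: "0 \<le> dens u"
  by (rule less_imp_le) simp

lemma dens_measurable [measurable]: "dens \<in> borel_measurable borel"
  unfolding dens_def[abs_def] by measurable

text \<open>After Fubini each value of the mixing variable only shifts the centre along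
  \<open>a\<close>, which by \<open>inv\<close> changes nothing, and the mixing law has mass 1. The
  first form integrates over the parameter, the second over the observation.\<close>

lemma nn_integral_dens:
  fixes F :: "'a \<Rightarrow> ennreal"
  assumes [measurable]: "F \<in> borel_measurable borel" and inv: "\<And>x v. heat_nn s F (x + v *\<^sub>R a) = heat_nn s F x"
  shows "(\<integral>\<^sup>+\<theta>. ennreal (dens (x - \<theta>)) * F \<theta> \<partial>lborel) = heat_nn s F x"
    and "(\<integral>\<^sup>+\<theta>. ennreal (dens (\<theta> - x)) * F \<theta> \<partial>lborel) = heat_nn s F x"
proof -
  interpret P: pair_sigma_finite M "lborel :: 'a measure" ..
  have "(\<integral>\<^sup>+\<theta>. ennreal (dens (x - \<theta>)) * F \<theta> \<partial>lborel)
     = (\<integral>\<^sup>+\<theta>. \<integral>\<^sup>+v. ennreal (gauss s (x - v *\<^sub>R a - \<theta>)) * F \<theta> \<partial>M \<partial>lborel)"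
    by (simp add: dens_diff_nn(1)[of x] nn_integral_multc)
  also have "\<dots> = (\<integral>\<^sup>+v. heat_nn s F (x + (- v) *\<^sub>R a) \<partial>M)"
    unfolding heat_nn_def by (subst P.Fubini') simp_all
  finally show "(\<integral>\<^sup>+\<theta>. ennreal (dens (x - \<theta>)) * F \<theta> \<partial>lborel) = heat_nn s F x"
    unfolding inv using emeasure_space_1 by (simp add: space_eq_univ)
  have "(\<integral>\<^sup>+\<theta>. ennreal (dens (\<theta> - x)) * F \<theta> \<partial>lborel)
     = (\<integral>\<^sup>+\<theta>. \<integral>\<^sup>+v. ennreal (gauss s (x + v *\<^sub>R a - \<theta>)) * F \<theta> \<partial>M \<partial>lborel)"
    by (simp add: dens_diff_nn(2)[of _ x] nn_integral_multc)
  also have "\<dots> = (\<integral>\<^sup>+v. heat_nn s F (x + v *\<^sub>R a) \<partial>M)"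
    unfolding heat_nn_def by (subst P.Fubini') simp_all
  finally show "(\<integral>\<^sup>+\<theta>. ennreal (dens (\<theta> - x)) * F \<theta> \<partial>lborel) = heat_nn s F x"
    unfolding inv using emeasure_space_1 by (simp add: space_eq_univ)
qed

lemma nn_integral_dens_1:
  "(\<integral>\<^sup>+\<theta>. ennreal (dens (x - \<theta>)) \<partial>lborel) = 1" "(\<integral>\<^sup>+\<theta>. ennreal (dens (\<theta> - x)) \<partial>lborel) = 1"
  using nn_integral_dens[of "\<lambda>_. 1" x] by (simp_all add: heat_nn_const s_pos)

end

section \<open>The posterior for a prior that depends on \<open>H2 \<theta>\<close>\<close>

locale model = orthogonal_split H H2 + MX: mixture MX sX a + MY: mixture MY sY a
  for H :: "real^('m::finite option)^('m option)" and H2 MX MY sX sY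
    and a :: "real^('m option)" +
  assumes H2a: "H2 *v a = 0"
begin

text \<open>The posterior variance: precisions add, \<open>1 / sW = 1 / sX + 1 / sY\<close>, and
  \<open>W\<close> is the mean with precision weights.\<close>

definition "sW = sX * sY / (sX + sY)"

definition W :: "real^'m \<Rightarrow> real^'m \<Rightarrow> real^'m" where
  "W x y = (sY / (sX + sY)) *\<^sub>R x + (sX / (sX + sY)) *\<^sub>R y"

abbreviation "p x \<theta> \<equiv> MX.dens (x - \<theta>)"
abbreviation "q y \<theta> \<equiv> MY.dens (y - \<theta>)"

abbreviation "bayes f \<equiv> bayes_pred_density p q (\<lambda>\<theta>. f (H2 *v \<theta>))"
abbreviation "mre \<equiv> mre_pred_density p q"
abbreviation "k u v v' \<equiv> gauss (sX + sY) (u - v *\<^sub>R a + v' *\<^sub>R a)"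

text \<open>The density of the MRE predictive distribution at \<open>y\<close> given \<open>x\<close> is \<open>r (x - y)\<close>.\<close>

definition r :: "real^('m option) \<Rightarrow> real" where
  "r u = (LINT v|MX. LINT v'|MY. k u v v')"

lemma pos: "0 < sX" "0 < sY" "0 < sX + sY" "0 < sW" "sW < sX"
  using MX.s_pos MY.s_pos by (auto simp: sW_def field_simps)

lemma W_measurable [measurable]: "(\<lambda>z. W (F z) (G z)) \<in> borel_measurable N"
  if [measurable]: "F \<in> borel_measurable N" "G \<in> borel_measurable N"
  unfolding W_def by measurable

lemma H2_shift: "H2 *v (x + v *\<^sub>R a) = H2 *v x" "H2 *v (x - v *\<^sub>R a) = H2 *v x"
  by (simp_all add: matrix_vector_right_distrib matrix_vector_mult_diff_distrib matrix_vector_mult_scaleR H2a)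

lemma H2_W: "H2 *v ((sY / (sX + sY)) *\<^sub>R (x - v *\<^sub>R a) + (sX / (sX + sY)) *\<^sub>R (y - v' *\<^sub>R a)) = W (H2 *v x) (H2 *v y)"
  by (simp add: W_def matrix_vector_right_distrib matrix_vector_mult_scaleR H2_shift)

lemma r_inner:
  "integrable MY (\<lambda>v'. k u v v')" "0 < (LINT v'|MY. k u v v')"
  "(LINT v'|MY. k u v v') \<le> 1 / sqrt ((2 * pi * (sX + sY)) ^ DIM(real^('m option)))"
  by (rule MY.integral_pos_bounded[OF _ gauss_pos[OF pos(3)] gauss_le[OF pos(3)]], measurable)+

lemma r_outer: "integrable MX (\<lambda>v. LINT v'|MY. k u v v')" "0 < r u"
  unfolding r_def by (rule MX.integral_pos_bounded[OF _ r_inner(2,3)], measurable)+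

lemma r_nn: "ennreal (r u) = (\<integral>\<^sup>+v. \<integral>\<^sup>+v'. ennreal (k u v v') \<partial>MY \<partial>MX)"
  unfolding r_def using pos
  by (simp add: nn_integral_eq_integral r_inner r_outer gauss_nonneg less_imp_le)

lemma r_measurable [measurable]: "r \<in> borel_measurable borel"
  unfolding r_def[abs_def] by measurable

lemma heat_nn_project_shift:
  assumes "0 < s" "f \<in> borel_measurable borel"
  shows "heat_nn s (\<lambda>\<theta>. f (H2 *v \<theta>)) (x + v *\<^sub>R a) = heat_nn s (\<lambda>\<theta>. f (H2 *v \<theta>)) x"
  using assms by (simp add: heat_nn_project H2_shift)

lemma marginal_X:
  assumes [measurable]: "g \<in> borel_measurable borel"
  shows "(\<integral>\<^sup>+\<theta>. ennreal (p x \<theta>) * g (H2 *v \<theta>) \<partial>lborel) = heat_nn sX g (H2 *v x)"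
    and "(\<integral>\<^sup>+x. ennreal (p x \<theta>) * g (H2 *v x) \<partial>lborel) = heat_nn sX g (H2 *v \<theta>)"
  using heat_nn_project_shift[OF pos(1) assms] pos(1)
  by (simp_all add: MX.nn_integral_dens heat_nn_project)

lemma marginal_Y:
  assumes [measurable]: "g \<in> borel_measurable borel"
  shows "(\<integral>\<^sup>+y. ennreal (q y \<theta>) * g (H2 *v y) \<partial>lborel) = heat_nn sY g (H2 *v \<theta>)"
  using heat_nn_project_shift[OF pos(2) assms] pos(2)
  by (simp_all add: MY.nn_integral_dens heat_nn_project)

text \<open>Projecting first \<open>y\<close>, then \<open>x\<close>, leaves independent normals
  around \<open>H2 \<theta>\<close> with variances \<open>sY\<close> and \<open>sX\<close>, to which
  \<open>weighted_mean_law\<close> applies.\<close>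

lemma joint_law:
  assumes [measurable]: "g \<in> borel_measurable borel"
  shows "(\<integral>\<^sup>+x. \<integral>\<^sup>+y. ennreal (p x \<theta>) * (ennreal (q y \<theta>) * g (W (H2 *v x) (H2 *v y))) \<partial>lborel \<partial>lborel)
    = heat_nn sW g (H2 *v \<theta>)"
proof -
  have m: "(\<lambda>\<xi>. heat_nn sY (\<lambda>\<eta>. g (W \<xi> \<eta>)) (H2 *v \<theta>)) \<in> borel_measurable borel"
    unfolding heat_nn_def by measurable
  have "(\<integral>\<^sup>+x. \<integral>\<^sup>+y. ennreal (p x \<theta>) * (ennreal (q y \<theta>) * g (W (H2 *v x) (H2 *v y))) \<partial>lborel \<partial>lborel)
     = (\<integral>\<^sup>+x. ennreal (p x \<theta>) * heat_nn sY (\<lambda>\<eta>. g (W (H2 *v x) \<eta>)) (H2 *v \<theta>) \<partial>lborel)"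
  proof (rule nn_integral_cong)
    fix x
    have "(\<lambda>\<eta>. g (W (H2 *v x) \<eta>)) \<in> borel_measurable borel"
      by measurable
    from marginal_Y[OF this, of \<theta>]
    show "(\<integral>\<^sup>+y. ennreal (p x \<theta>) * (ennreal (q y \<theta>) * g (W (H2 *v x) (H2 *v y))) \<partial>lborel)
        = ennreal (p x \<theta>) * heat_nn sY (\<lambda>\<eta>. g (W (H2 *v x) \<eta>)) (H2 *v \<theta>)"
      by (simp add: nn_integral_cmult)
  qed
  also have "\<dots> = heat_nn sX (\<lambda>\<xi>. heat_nn sY (\<lambda>\<eta>. g (W \<xi> \<eta>)) (H2 *v \<theta>)) (H2 *v \<theta>)"
    by (rule marginal_X(2)[OF m])
  also have "\<dots> = heat_nn sW g (H2 *v \<theta>)"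
    unfolding W_def sW_def by (rule weighted_mean_law[OF pos(1,2) assms])
  finally show ?thesis .
qed

text \<open>For fixed \<open>v\<close> and \<open>v'\<close> the product of kernels splits by
  \<open>gauss_mult\<close>. The mixing variables move the posterior mean along \<open>a\<close>
  only, so by \<open>H2_W\<close> the average of \<open>g\<close> does not see them and can be
  pulled out; the other factors mix to \<open>r\<close>.\<close>

lemma posterior_numerator:
  assumes [measurable]: "g \<in> borel_measurable borel"
  shows "(\<integral>\<^sup>+\<theta>. ennreal (p x \<theta>) * (ennreal (q y \<theta>) * g (H2 *v \<theta>)) \<partial>lborel)
    = ennreal (r (x - y)) * heat_nn sW g (W (H2 *v x) (H2 *v y))"
proof -
  let ?A = "\<lambda>v \<theta>. ennreal (gauss sX (x - v *\<^sub>R a - \<theta>))"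
  let ?B = "\<lambda>v' \<theta>. ennreal (gauss sY (y - v' *\<^sub>R a - \<theta>))"
  interpret PX: pair_sigma_finite MX "lborel :: (real^('m option)) measure" ..
  interpret PY: pair_sigma_finite MY "lborel :: (real^('m option)) measure" ..
  have inner: "(\<integral>\<^sup>+\<theta>. ?A v \<theta> * (?B v' \<theta> * g (H2 *v \<theta>)) \<partial>lborel)
     = ennreal (k (x - y) v v') * heat_nn sW g (W (H2 *v x) (H2 *v y))" for v v'
  proof -
    let ?w = "(sY / (sX + sY)) *\<^sub>R (x - v *\<^sub>R a) + (sX / (sX + sY)) *\<^sub>R (y - v' *\<^sub>R a)"
    have "?A v \<theta> * (?B v' \<theta> * g (H2 *v \<theta>))
       = ennreal (gauss (sX + sY) (x - v *\<^sub>R a - (y - v' *\<^sub>R a))) * (ennreal (gauss sW (?w - \<theta>)) * g (H2 *v \<theta>))" for \<theta>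
      using gauss_mult[OF pos(1,2), of "x - v *\<^sub>R a" \<theta> "y - v' *\<^sub>R a"] pos
      by (simp add: sW_def mult.assoc[symmetric] gauss_nonneg flip: ennreal_mult)
    then have "(\<integral>\<^sup>+\<theta>. ?A v \<theta> * (?B v' \<theta> * g (H2 *v \<theta>)) \<partial>lborel)
       = ennreal (gauss (sX + sY) (x - v *\<^sub>R a - (y - v' *\<^sub>R a))) * heat_nn sW (\<lambda>\<theta>. g (H2 *v \<theta>)) ?w"
      unfolding heat_nn_def by (simp add: nn_integral_cmult)
    also have "x - v *\<^sub>R a - (y - v' *\<^sub>R a) = x - y - v *\<^sub>R a + v' *\<^sub>R a"
      by simp
    finally show ?thesis
      using pos by (simp add: heat_nn_project H2_W)
  qed
  have "(\<integral>\<^sup>+\<theta>. ennreal (p x \<theta>) * (ennreal (q y \<theta>) * g (H2 *v \<theta>)) \<partial>lborel)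
     = (\<integral>\<^sup>+\<theta>. \<integral>\<^sup>+v. ?A v \<theta> * (ennreal (q y \<theta>) * g (H2 *v \<theta>)) \<partial>MX \<partial>lborel)"
    by (simp add: MX.dens_diff_nn(1) nn_integral_multc)
  also have "\<dots> = (\<integral>\<^sup>+v. \<integral>\<^sup>+\<theta>. ?A v \<theta> * (ennreal (q y \<theta>) * g (H2 *v \<theta>)) \<partial>lborel \<partial>MX)"
    by (subst PX.Fubini') simp_all
  also have "\<dots> = (\<integral>\<^sup>+v. \<integral>\<^sup>+\<theta>. \<integral>\<^sup>+v'. ?A v \<theta> * (?B v' \<theta> * g (H2 *v \<theta>)) \<partial>MY \<partial>lborel \<partial>MX)"
    by (simp add: MY.dens_diff_nn(1) nn_integral_multc nn_integral_cmult)
  also have "\<dots> = (\<integral>\<^sup>+v. \<integral>\<^sup>+v'. \<integral>\<^sup>+\<theta>. ?A v \<theta> * (?B v' \<theta> * g (H2 *v \<theta>)) \<partial>lborel \<partial>MY \<partial>MX)"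
    by (intro nn_integral_cong) (subst PY.Fubini', simp_all)
  also have "\<dots> = ennreal (r (x - y)) * heat_nn sW g (W (H2 *v x) (H2 *v y))"
    by (simp add: inner r_nn nn_integral_multc)
  finally show ?thesis .
qed

text \<open>The factor \<open>r\<close> is common to all priors of this form. For the constant prior
  1 the quotient is 1, so \<open>r\<close> is the MRE density, and in general the quotient is the
  ratio of the two predictive densities.\<close>

lemma bayes_pred_eq:
  assumes f: "heat_flow f sX" and nonzero: "\<not> (AE \<zeta> in lborel. f \<zeta> = 0)"
  shows "bayes f y x
    = r (x - y) * (heat sW f (W (H2 *v x) (H2 *v y)) / heat sX f (H2 *v x))"
proof -
  interpret heat_flow f sX by fact
  define D where "D = heat sX f (H2 *v x)"
  have D: "0 < D"
    unfolding D_def using nonzero pos by (intro heat_pos) auto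
  have "(LINT t|lborel. p x t * f (H2 *v t)) = enn2real (\<integral>\<^sup>+t. ennreal (p x t * f (H2 *v t)) \<partial>lborel)"
    by (rule integral_eq_nn_integral) (auto intro!: AE_I2 mult_nonneg_nonneg simp: f_nonneg)
  also have "(\<integral>\<^sup>+t. ennreal (p x t * f (H2 *v t)) \<partial>lborel) = (\<integral>\<^sup>+t. ennreal (p x t) * ennreal (f (H2 *v t)) \<partial>lborel)"
    by (simp add: ennreal_mult f_nonneg)
  also have "\<dots> = ennreal D"
    using marginal_X(1)[of "\<lambda>z. ennreal (f z)" x] pos by (simp add: heat_nn_eq D_def)
  finally have den: "(LINT t|lborel. p x t * f (H2 *v t)) = D"
    using D by simp
  have "(LINT \<theta>|lborel. p x \<theta> * (q y \<theta> * f (H2 *v \<theta>))) = enn2real (\<integral>\<^sup>+\<theta>. ennreal (p x \<theta> * (q y \<theta> * f (H2 *v \<theta>))) \<partial>lborel)"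
    by (rule integral_eq_nn_integral)
       (auto intro!: AE_I2 mult_nonneg_nonneg simp: f_nonneg)
  also have "(\<integral>\<^sup>+\<theta>. ennreal (p x \<theta> * (q y \<theta> * f (H2 *v \<theta>))) \<partial>lborel)
     = (\<integral>\<^sup>+\<theta>. ennreal (p x \<theta>) * (ennreal (q y \<theta>) * ennreal (f (H2 *v \<theta>))) \<partial>lborel)"
    by (simp add: ennreal_mult f_nonneg)
  also have "\<dots> = ennreal (r (x - y)) * ennreal (heat sW f (W (H2 *v x) (H2 *v y)))"
    using posterior_numerator[of "\<lambda>z. ennreal (f z)" x y] pos by (simp add: heat_nn_eq)
  also have "\<dots> = ennreal (r (x - y) * heat sW f (W (H2 *v x) (H2 *v y)))"
    using r_outer(2)[of "x - y"] by (simp add: ennreal_mult')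
  finally have num: "(LINT \<theta>|lborel. p x \<theta> * (q y \<theta> * f (H2 *v \<theta>))) = r (x - y) * heat sW f (W (H2 *v x) (H2 *v y))"
    using r_outer(2)[of "x - y"] heat_pos[OF nonzero, of sW] pos by (simp add: less_imp_le)
  have "bayes f y x = (LINT \<theta>|lborel. 1 / D * (p x \<theta> * (q y \<theta> * f (H2 *v \<theta>))))"
    unfolding bayes_pred_density_def posterior_density_def den by (simp add: mult_ac)
  also have "\<dots> = 1 / D * (r (x - y) * heat sW f (W (H2 *v x) (H2 *v y)))"
    using num by simp
  finally show ?thesis
    by (simp add: D_def)
qed

text \<open>Integrating the posterior numerator over \<open>y\<close> before \<open>\<theta>\<close>
  leaves its denominator.\<close>

lemma nn_integral_bayes_pred:
  assumes f: "heat_flow f sX" and nonzero: "\<not> (AE \<zeta> in lborel. f \<zeta> = 0)"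
  shows "(\<integral>\<^sup>+y. ennreal (bayes f y x) \<partial>lborel) = 1"
proof -
  interpret heat_flow f sX by fact
  define D where "D = heat sX f (H2 *v x)"
  have D: "0 < D"
    unfolding D_def using nonzero pos by (intro heat_pos) auto
  have hW: "0 \<le> heat sW f z" for z
    using heat_pos[OF nonzero, of sW z] pos by simp
  have "(\<integral>\<^sup>+y. ennreal (r (x - y)) * heat_nn sW (\<lambda>z. ennreal (f z)) (W (H2 *v x) (H2 *v y)) \<partial>lborel)
     = (\<integral>\<^sup>+y. \<integral>\<^sup>+\<theta>. ennreal (p x \<theta>) * (ennreal (q y \<theta>) * ennreal (f (H2 *v \<theta>))) \<partial>lborel \<partial>lborel)"
    by (subst posterior_numerator[of "\<lambda>z. ennreal (f z)", symmetric]) simp_all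
  also have "\<dots> = (\<integral>\<^sup>+\<theta>. \<integral>\<^sup>+y. ennreal (p x \<theta>) * (ennreal (q y \<theta>) * ennreal (f (H2 *v \<theta>))) \<partial>lborel \<partial>lborel)"
    by (rule lborel_pair.Fubini') measurable
  also have "\<dots> = (\<integral>\<^sup>+\<theta>. ennreal (p x \<theta>) * ennreal (f (H2 *v \<theta>)) \<partial>lborel)"
    by (simp add: nn_integral_cmult nn_integral_multc MY.nn_integral_dens_1)
  also have "\<dots> = ennreal D"
    using marginal_X(1)[of "\<lambda>z. ennreal (f z)" x] pos by (simp add: heat_nn_eq D_def)
  finally have total: "(\<integral>\<^sup>+y. ennreal (r (x - y) * heat sW f (W (H2 *v x) (H2 *v y))) \<partial>lborel) = ennreal D"
    using r_outer(2) pos by (simp add: heat_nn_eq ennreal_mult less_imp_le hW)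
  have "ennreal (bayes f y x)
      = ennreal (r (x - y) * heat sW f (W (H2 *v x) (H2 *v y))) * ennreal (1 / D)" for y
    unfolding bayes_pred_eq[OF f nonzero] D_def[symmetric] using D r_outer(2)[of "x - y"] hW
    by (subst ennreal_mult[symmetric]) auto
  then have "(\<integral>\<^sup>+y. ennreal (bayes f y x) \<partial>lborel) = ennreal D * ennreal (1 / D)"
    by (simp add: nn_integral_multc total)
  also have "\<dots> = 1"
    using D by (simp flip: ennreal_mult)
  finally show ?thesis .
qed

end

section \<open>Comparison of the Kullback-Leibler risks\<close>

lemma ext_integral_cong_AE: "AE x in M. f x = g x \<Longrightarrow> ext_integral M f = ext_integral M g"
  unfolding ext_integral_def
  by (intro arg_cong2[where f="(-)"] arg_cong[where f=enn2ereal] nn_integral_cong_AE) auto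

lemma ext_integral_ereal:
  assumes "integrable M f"
  shows "ext_integral M (\<lambda>x. ereal (f x)) = ereal (integral\<^sup>L M f)"
proof -
  have fin: "(\<integral>\<^sup>+x. ennreal (f x) \<partial>M) < \<infinity>" "(\<integral>\<^sup>+x. ennreal (- f x) \<partial>M) < \<infinity>"
    using assms by (auto simp: real_integrable_def less_top)
  obtain A where A: "0 \<le> A" "(\<integral>\<^sup>+x. ennreal (f x) \<partial>M) = ennreal A"
    using fin(1) by (cases "\<integral>\<^sup>+x. ennreal (f x) \<partial>M") auto
  obtain B where B: "0 \<le> B" "(\<integral>\<^sup>+x. ennreal (- f x) \<partial>M) = ennreal B"
    using fin(2) by (cases "\<integral>\<^sup>+x. ennreal (- f x) \<partial>M") auto
  show ?thesis
    unfolding ext_integral_def real_lebesgue_integral_def[OF assms]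
    by (simp add: A B)
qed

text \<open>Gibbs' inequality also shows that the negative part is integrable, so no \<open>\<infinity> - \<infinity>\<close> occurs.\<close>

lemma kl_divergence_nonneg:
  fixes q d :: "'a::euclidean_space \<Rightarrow> real"
  assumes [measurable]: "q \<in> borel_measurable borel" "d \<in> borel_measurable borel"
    and q: "\<And>y. 0 < q y" "(\<integral>\<^sup>+y. ennreal (q y) \<partial>lborel) = 1"
    and d: "\<And>y. 0 < d y" "(\<integral>\<^sup>+y. ennreal (d y) \<partial>lborel) = 1"
  shows "0 \<le> ext_integral lborel (\<lambda>y. ereal (q y * ln (q y / d y)))"
    and "ext_integral lborel (\<lambda>y. ereal (q y * ln (q y / d y))) < \<infinity> \<Longrightarrow> integrable lborel (\<lambda>y. q y * ln (q y / d y))"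
proof -
  let ?K = "ext_integral lborel (\<lambda>y. ereal (q y * ln (q y / d y)))"
  define g where "g y = q y * ln (q y / d y)" for y
  have [measurable]: "g \<in> borel_measurable borel"
    unfolding g_def by measurable
  have ge: "q y - d y \<le> g y" for y
  proof -
    have "ln (d y / q y) \<le> d y / q y - 1"
      using q(1)[of y] d(1)[of y] by (intro ln_le_minus_one) auto
    then have "q y * ln (d y / q y) \<le> q y * (d y / q y - 1)"
      using q(1)[of y] by (intro mult_left_mono) auto
    also have "\<dots> = d y - q y"
      using q(1)[of y] by (simp add: field_simps)
    finally show ?thesis
      using q(1)[of y] d(1)[of y] by (simp add: g_def ln_div algebra_simps)
  qed
  have "(\<integral>\<^sup>+y. ennreal (- g y) \<partial>lborel) \<le> (\<integral>\<^sup>+y. ennreal (d y) \<partial>lborel)"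
  proof (intro nn_integral_mono ennreal_leI)
    show "- g y \<le> d y" for y
      using ge[of y] q(1)[of y] by linarith
  qed
  then have neg: "(\<integral>\<^sup>+y. ennreal (- g y) \<partial>lborel) < \<infinity>"
    using d(2) by (simp add: le_less_trans[OF _ ennreal_one_less_top])
  have K: "?K = enn2ereal (\<integral>\<^sup>+y. ennreal (g y) \<partial>lborel) - enn2ereal (\<integral>\<^sup>+y. ennreal (- g y) \<partial>lborel)"
    unfolding ext_integral_def g_def by simp
  have inf: "?K = \<infinity>" if "(\<integral>\<^sup>+y. ennreal (g y) \<partial>lborel) = \<infinity>"
    using neg unfolding K that by (cases "\<integral>\<^sup>+y. ennreal (- g y) \<partial>lborel") auto
  have int: "integrable lborel g" if "(\<integral>\<^sup>+y. ennreal (g y) \<partial>lborel) \<noteq> \<infinity>"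
    using that neg by (auto simp: real_integrable_def)
  show "0 \<le> ?K"
  proof (cases "(\<integral>\<^sup>+y. ennreal (g y) \<partial>lborel) = \<infinity>")
    case False
    have hq: "has_bochner_integral lborel q 1" and hd: "has_bochner_integral lborel d 1"
      using q d by (auto intro!: has_bochner_integral_nn_integral less_imp_le)
    have "(LINT y|lborel. q y - d y) \<le> integral\<^sup>L lborel g"
      using hq hd by (intro integral_mono int False ge Bochner_Integration.integrable_diff)
        (auto simp: has_bochner_integral_iff)
    then have "0 \<le> integral\<^sup>L lborel g"
      using hq hd by (simp add: has_bochner_integral_iff)
    moreover have "?K = ereal (integral\<^sup>L lborel g)"
      using ext_integral_ereal[OF int[OF False]] by (simp add: g_def)
    ultimately show ?thesis
      by simp
  qed (simp add: inf)
  show "integrable lborel (\<lambda>y. q y * ln (q y / d y))" if "?K < \<infinity>"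
    using int inf that unfolding g_def by fastforce
qed

text \<open>Finiteness of the first risk makes the inner divergence finite for almost every
  \<open>x\<close>, because \<open>p\<close> is positive; then both risks are integrals of
  integrable functions, and they differ by that of the log ratio \<open>l\<close>.\<close>

lemma risk_difference:
  fixes p :: "'x::euclidean_space \<Rightarrow> real" and q :: "'y::euclidean_space \<Rightarrow> real" and dU dP :: "'y \<Rightarrow> 'x \<Rightarrow> real"
  assumes [measurable]: "p \<in> borel_measurable borel" "q \<in> borel_measurable borel"
      "(\<lambda>(x, y). dU y x) \<in> borel_measurable (borel \<Otimes>\<^sub>M borel)"
    and p: "\<And>x. 0 < p x" and q: "\<And>y. 0 < q y" "(\<integral>\<^sup>+y. ennreal (q y) \<partial>lborel) = 1"
    and dU: "\<And>x y. 0 < dU y x" "\<And>x. (\<integral>\<^sup>+y. ennreal (dU y x) \<partial>lborel) = 1"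
    and dP: "\<And>x y. dP y x = dU y x * exp (l x y)"
    and l: "has_bochner_integral (lborel \<Otimes>\<^sub>M lborel) (\<lambda>(x, y). p x * (q y * l x y)) D"
    and fin: "ext_integral lborel (\<lambda>x. ext_integral lborel (\<lambda>y. ereal (q y * ln (q y / dU y x))) * ereal (p x)) < \<infinity>"
      (is "?RU < \<infinity>")
  shows "\<exists>A. ?RU = ereal A \<and>
    ext_integral lborel (\<lambda>x. ext_integral lborel (\<lambda>y. ereal (q y * ln (q y / dP y x))) * ereal (p x)) = ereal (A - D)"
proof -
  let ?K = "\<lambda>x. ext_integral lborel (\<lambda>y. ereal (q y * ln (q y / dP y x)))"
  define g where "g x y = q y * ln (q y / dU y x)" for x y
  have [measurable]: "(\<lambda>(x, y). g x y) \<in> borel_measurable (borel \<Otimes>\<^sub>M borel)"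
    unfolding g_def by measurable
  define K where "K x = ext_integral lborel (\<lambda>y. ereal (g x y))" for x
  have dU_meas: "(\<lambda>y. dU y x) \<in> borel_measurable borel" for x
    using measurable_Pair2[of "\<lambda>(x, y). dU y x" borel borel borel x] by simp
  have K0: "0 \<le> K x" for x
    unfolding K_def g_def using q dU dU_meas by (intro kl_divergence_nonneg(1)) auto
  have Kint: "integrable lborel (g x)" if "K x < \<infinity>" for x
    using that unfolding K_def g_def[abs_def] using q dU dU_meas by (intro kl_divergence_nonneg(2)) auto
  have [measurable]: "K \<in> borel_measurable borel"
    unfolding K_def[abs_def] ext_integral_def by simp measurable
  have Kp0: "0 \<le> K x * ereal (p x)" for x
    using K0[of x] p[of x] by simp
  \<comment> \<open>Gibbs' inequality removes the negative part of the outer integral as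
    well.\<close>
  have "(\<integral>\<^sup>+x. e2ennreal (- (K x * ereal (p x))) \<partial>lborel) = 0"
    using Kp0 by (simp add: e2ennreal_neg)
  then have RU: "?RU = enn2ereal (\<integral>\<^sup>+x. e2ennreal (K x * ereal (p x)) \<partial>lborel)"
    unfolding ext_integral_def[of _ "\<lambda>x. _ x * ereal (p x)"] K_def[symmetric] g_def[symmetric]
    by (simp add: zero_ennreal.rep_eq)
  then have fin': "(\<integral>\<^sup>+x. e2ennreal (K x * ereal (p x)) \<partial>lborel) \<noteq> \<infinity>"
    using fin by auto
  have "AE x in lborel. e2ennreal (K x * ereal (p x)) \<noteq> \<infinity>"
    by (rule nn_integral_PInf_AE[OF _ fin']) measurable
  then have Kfin: "AE x in lborel. K x < \<infinity>"
  proof eventually_elim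
    case (elim x)
    show ?case
    proof (rule ccontr)
      assume "\<not> K x < \<infinity>"
      then have "K x * ereal (p x) = \<infinity>"
        using p[of x] by simp
      with elim show False
        by simp
    qed
  qed
  define G where "G x = (LINT y|lborel. g x y)" for x
  have [measurable]: "G \<in> borel_measurable borel"
    unfolding G_def[abs_def] by measurable
  have KG: "AE x in lborel. integrable lborel (g x) \<and> K x = ereal (G x)"
    using Kfin
  proof eventually_elim
    case (elim x)
    then show ?case
      using Kint[OF elim] ext_integral_ereal[OF Kint[OF elim]] by (simp add: K_def G_def)
  qed
  have "(\<integral>\<^sup>+x. e2ennreal (K x * ereal (p x)) \<partial>lborel) = (\<integral>\<^sup>+x. ennreal (G x * p x) \<partial>lborel)"
    using KG by (intro nn_integral_cong_AE) auto
  moreover have "AE x in lborel. 0 \<le> G x * p x"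
    using KG
  proof eventually_elim
    case (elim x)
    then show ?case
      using Kp0[of x] by simp
  qed
  ultimately have Gp: "integrable lborel (\<lambda>x. G x * p x)"
    using fin' by (intro integrableI_nonneg) (auto simp: less_top)
  have RU': "?RU = ereal (LINT x|lborel. G x * p x)"
    unfolding g_def[symmetric] K_def[symmetric]
    by (subst ext_integral_ereal[OF Gp, symmetric], rule ext_integral_cong_AE) (use KG in auto)
  define B where "B x = (LINT y|lborel. q y * l x y)" for x
  have li: "integrable (lborel \<Otimes>\<^sub>M lborel) (\<lambda>(x, y). p x * (q y * l x y))"
    and lD: "integral\<^sup>L (lborel \<Otimes>\<^sub>M lborel) (\<lambda>(x, y). p x * (q y * l x y)) = D"
    using l by (auto simp: has_bochner_integral_iff)
  have Bp: "integrable lborel (\<lambda>x. p x * B x)" "(LINT x|lborel. p x * B x) = D"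
    using lborel_pair.integrable_fst'[OF li] lborel_pair.integral_fst'[OF li] lD
    by (simp_all add: B_def)
  have "AE x in lborel. integrable lborel (\<lambda>y. p x * (q y * l x y))"
    using lborel_pair.AE_integrable_fst'[OF li] by simp
  then have lx: "AE x in lborel. integrable lborel (\<lambda>y. q y * l x y)"
  proof eventually_elim
    case (elim x)
    have "integrable lborel (\<lambda>y. 1 / p x * (p x * (q y * l x y)))"
      by (rule integrable_mult_right[OF elim])
    then show ?case
      using p[of x] by simp
  qed
  have gP: "q y * ln (q y / dP y x) = g x y - q y * l x y" for x y
    using q(1)[of y] dU(1)[of y x] by (simp add: g_def dP ln_div ln_mult algebra_simps)
  have "ext_integral lborel (\<lambda>x. ?K x * ereal (p x))
      = ext_integral lborel (\<lambda>x. ereal (G x * p x - p x * B x))"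
  proof (rule ext_integral_cong_AE)
    show "AE x in lborel. ?K x * ereal (p x)
        = ereal (G x * p x - p x * B x)"
      using KG lx
    proof eventually_elim
      case (elim x)
      then have "ext_integral lborel (\<lambda>y. ereal (g x y - q y * l x y)) = ereal (G x - B x)"
        unfolding G_def B_def by (subst ext_integral_ereal) auto
      then show ?case
        unfolding gP by (simp add: algebra_simps)
    qed
  qed
  also have "\<dots> = ereal ((LINT x|lborel. G x * p x) - D)"
    using Gp Bp by (subst ext_integral_ereal) auto
  finally show ?thesis
    using RU' by blast
qed

text \<open>The law is given through nonnegative test functions; splitting into positive and
  negative parts extends it to integrable ones.\<close>

lemma has_bochner_integral_law:
  fixes h :: "'a::euclidean_space \<Rightarrow> real"
  assumes s: "0 < s" and [measurable]: "w \<in> borel_measurable N" "\<Phi> \<in> borel_measurable N" "h \<in> borel_measurable borel"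
    and w: "\<And>z. 0 \<le> w z"
    and law: "\<And>g. g \<in> borel_measurable borel \<Longrightarrow> (\<integral>\<^sup>+z. ennreal (w z) * g (\<Phi> z) \<partial>N) = heat_nn s g \<zeta>"
    and int: "integrable lborel (\<lambda>x. gauss s (\<zeta> - x) * h x)"
  shows "has_bochner_integral N (\<lambda>z. w z * h (\<Phi> z)) (heat s h \<zeta>)"
proof -
  have nonneg: "has_bochner_integral N (\<lambda>z. w z * k (\<Phi> z)) (heat s k \<zeta>)"
    if [measurable]: "k \<in> borel_measurable borel" and k: "\<And>x. 0 \<le> k x"
      and i: "integrable lborel (\<lambda>x. gauss s (\<zeta> - x) * k x)" for k
  proof (rule has_bochner_integral_nn_integral)
    have "(\<integral>\<^sup>+z. ennreal (w z * k (\<Phi> z)) \<partial>N) = heat_nn s (\<lambda>x. ennreal (k x)) \<zeta>"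
      using law[of "\<lambda>x. ennreal (k x)"] w k by (simp add: ennreal_mult)
    then show "(\<integral>\<^sup>+z. ennreal (w z * k (\<Phi> z)) \<partial>N) = ennreal (heat s k \<zeta>)"
      using heat_nn_eq_heat[OF s k i] by simp
    show "0 \<le> heat s k \<zeta>"
      by (rule heat_nonneg[OF s]) (rule k)
  qed (use w k in auto)
  have i: "integrable lborel (\<lambda>x. gauss s (\<zeta> - x) * max 0 (h x))" "integrable lborel (\<lambda>x. gauss s (\<zeta> - x) * max 0 (- h x))"
    by (rule Bochner_Integration.integrable_bound[OF int];
        use s in \<open>auto simp: abs_mult gauss_nonneg intro!: AE_I2 mult_left_mono\<close>)+
  have "has_bochner_integral N (\<lambda>z. w z * max 0 (h (\<Phi> z)) - w z * max 0 (- h (\<Phi> z)))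
     (heat s (\<lambda>x. max 0 (h x)) \<zeta> - heat s (\<lambda>x. max 0 (- h x)) \<zeta>)"
    by (intro has_bochner_integral_diff nonneg i) auto
  moreover have "w z * max 0 (h (\<Phi> z)) - w z * max 0 (- h (\<Phi> z)) = w z * h (\<Phi> z)" for z
    by (auto simp: max_def)
  moreover have "heat s (\<lambda>x. max 0 (h x)) \<zeta> - heat s (\<lambda>x. max 0 (- h x)) \<zeta> = heat s h \<zeta>"
    unfolding heat_def by (subst Bochner_Integration.integral_diff[OF i, symmetric])
      (auto simp: max_def intro!: Bochner_Integration.integral_cong)
  ultimately show ?thesis
    by simp
qed

context model
begin

abbreviation "w \<theta> z \<equiv> p (fst z) \<theta> * q (snd z) \<theta>"

text \<open>The log ratio of the predictive densities integrates to the gap between the two averages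
  of \<open>ln m\<close>. By \<open>log_gap_strict\<close> this gap is positive at every
  \<open>\<theta>\<close>, so the risk is strictly smaller everywhere.\<close>

lemma dominates_mre:
  assumes f: "superheat f sX sW"
    and strict: "sW < s" "s < sX"
      "heat_flow.sqrt_lap f s y < 0"
    and fin: "\<And>\<theta>. kl_risk p q \<theta> (mre) < \<infinity>"
  shows "dominates (kl_risk p q) (bayes f) (mre)"
proof -
  let ?EW = "\<lambda>\<theta>. heat sW (\<lambda>x. ln (heat sW f x)) (H2 *v \<theta>)" and ?EX = "\<lambda>\<theta>. heat sX (\<lambda>x. ln (heat sX f x)) (H2 *v \<theta>)"
  let ?W = "\<lambda>z. W (H2 *v fst z) (H2 *v snd z)" and ?L = "lborel \<Otimes>\<^sub>M lborel"
  interpret superheat f sX sW by fact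
  define l where "l x z = ln (heat sW f (W (H2 *v x) (H2 *v z))) - ln (heat sX f (H2 *v x))" for x z
  have hp: "0 < heat sW f z" "0 < heat sX f z" for z
    using pos by (auto intro!: m_pos)
  \<comment> \<open>The uniform prior is the case \<open>f = 1\<close> of the same formulas, and all
    its convolutions equal 1.\<close>
  have flow1: "heat_flow (\<lambda>_::real^'m. 1) sX"
    by (rule heat_flow_bounded[of _ _ 1]) (use pos in auto)
  have nz1: "\<not> (AE \<zeta>::real^'m in lborel. (1::real) = 0)"
    using ae_filter_eq_bot_iff[of "lborel :: (real^'m) measure"] by (simp add: trivial_limit_def)
  have one: "heat t (\<lambda>_. 1) z = 1" if "0 < t" for t and z :: "real^'m"
    using that by (simp add: heat_def integral_gauss)
  have U: "mre z x = r (x - z)" for x z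
    unfolding mre_pred_density_def using bayes_pred_eq[OF flow1 nz1, of z x] pos by (simp add: one)
  have P: "bayes f z x = mre z x * exp (l x z)" for x z
    unfolding U bayes_pred_eq[OF heat_flow_axioms nonzero] using hp by (simp add: l_def exp_diff)
  have gap: "\<exists>A. kl_risk p q \<theta> (mre) = ereal A \<and>
      kl_risk p q \<theta> (bayes f)
        = ereal (A - (?EW \<theta> - ?EX \<theta>))" for \<theta>
    unfolding kl_risk_def
  proof (rule risk_difference)
    show "(\<lambda>(x, y). mre y x) \<in> borel_measurable (borel \<Otimes>\<^sub>M borel)"
      unfolding U by measurable
    show "0 < mre y x" for x y
      unfolding U by (rule r_outer(2))
    show "(\<integral>\<^sup>+y. ennreal (mre y x) \<partial>lborel) = 1" for x
      unfolding mre_pred_density_def using nn_integral_bayes_pred[OF flow1 nz1] by simp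
    show "bayes f y x = mre y x * exp (l x y)" for x y
      by (rule P)
    show "ext_integral lborel (\<lambda>x. ext_integral lborel (\<lambda>y. ereal (q y \<theta> * ln (q y \<theta> / mre y x))) * ereal (p x \<theta>)) < \<infinity>"
      using fin[of \<theta>] unfolding kl_risk_def .
    show "(\<integral>\<^sup>+y. ennreal (q y \<theta>) \<partial>lborel) = 1"
      by (rule MY.nn_integral_dens_1(2))
    have "has_bochner_integral ?L
        (\<lambda>z. w \<theta> z * ln (heat sW f (?W z)))
        (?EW \<theta>)"
    proof (rule has_bochner_integral_law[where \<Phi>="?W"])
      fix g :: "real^'m \<Rightarrow> ennreal" assume [measurable]: "g \<in> borel_measurable borel"
      have "(\<integral>\<^sup>+z. ennreal (w \<theta> z) * g (?W z) \<partial>?L)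
         = (\<integral>\<^sup>+x. \<integral>\<^sup>+y. ennreal (p x \<theta>) * (ennreal (q y \<theta>) * g (W (H2 *v x) (H2 *v y))) \<partial>lborel \<partial>lborel)"
        by (subst lborel.nn_integral_fst[symmetric])
           (simp_all add: ennreal_mult mult.assoc)
      then show "(\<integral>\<^sup>+z. ennreal (w \<theta> z) * g (?W z) \<partial>?L)
         = heat_nn sW g (H2 *v \<theta>)"
        by (simp add: joint_law)
    qed (use pos in \<open>auto simp: integrable_ln\<close>)
    moreover have "has_bochner_integral ?L
        (\<lambda>z. w \<theta> z * ln (heat sX f (H2 *v fst z)))
        (?EX \<theta>)"
    proof (rule has_bochner_integral_law[where \<Phi>="\<lambda>z. H2 *v fst z"])
      fix g :: "real^'m \<Rightarrow> ennreal" assume [measurable]: "g \<in> borel_measurable borel"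
      have "(\<integral>\<^sup>+z. ennreal (w \<theta> z) * g (H2 *v fst z) \<partial>?L)
         = (\<integral>\<^sup>+x. \<integral>\<^sup>+y. ennreal (p x \<theta>) * g (H2 *v x) * ennreal (q y \<theta>) \<partial>lborel \<partial>lborel)"
        by (subst lborel.nn_integral_fst[symmetric])
           (simp_all add: ennreal_mult mult_ac)
      also have "\<dots> = heat_nn sX g (H2 *v \<theta>)"
        by (simp add: nn_integral_cmult MY.nn_integral_dens_1 marginal_X)
      finally show "(\<integral>\<^sup>+z. ennreal (w \<theta> z) * g (H2 *v fst z) \<partial>?L)
         = heat_nn sX g (H2 *v \<theta>)" .
    qed (use pos in \<open>auto simp: integrable_ln\<close>)
    ultimately have "has_bochner_integral ?L
        (\<lambda>z. w \<theta> z * ln (heat sW f (?W z))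
           - w \<theta> z * ln (heat sX f (H2 *v fst z)))
        (?EW \<theta> - ?EX \<theta>)"
      by (rule has_bochner_integral_diff)
    then show "has_bochner_integral ?L (\<lambda>(x, y). p x \<theta> * (q y \<theta> * l x y))
        (?EW \<theta> - ?EX \<theta>)"
      by (simp add: l_def case_prod_unfold right_diff_distrib mult.assoc)
  qed auto
  have lt: "heat sX (\<lambda>x. ln (heat sX f x)) z < heat sW (\<lambda>x. ln (heat sW f x)) z" for z
    by (rule log_gap_strict[OF strict])
  have "kl_risk p q \<theta> (bayes f) < kl_risk p q \<theta> (mre)" for \<theta>
    using gap[of \<theta>] lt[of "H2 *v \<theta>"] by auto
  then show ?thesis
    unfolding dominates_def by (auto intro: less_imp_le)
qed

end

section \<open>Reduction of the three conditions to superharmonicity of the square root\<close>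

lemma laplacian_condition_imp:
  fixes f :: "real^'m \<Rightarrow> real"
  assumes f: "heat_flow f sX" "\<not> (AE \<zeta> in lborel. f \<zeta> = 0)" and pos: "0 < sX" "0 < sY"
    and cond: "laplacian_condition sX sY F"
    and lap: "\<And>s z. 0 < s \<Longrightarrow> s < sX \<Longrightarrow> \<exists>k>0. \<exists>e\<ge>0. k * laplacian (\<lambda>z. F z s) z
      = heat_flow.sqrt_lap f s z + e"
  shows "superheat f sX (sX * sY / (sX + sY))"
    and "\<exists>s y. sX * sY / (sX + sY) < s \<and> s < sX \<and>
      heat_flow.sqrt_lap f s y < 0"
proof -
  interpret heat_flow f sX by fact
  have W: "0 < sX * sY / (sX + sY)" "sX * sY / (sX + sY) < sX"
    using pos by (auto simp: field_simps)
  show "superheat f sX (sX * sY / (sX + sY))"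
  proof (intro superheat.intro f(1) superheat_axioms.intro W f(2))
    fix s z assume s: "sX * sY / (sX + sY) < s" "s < sX"
    obtain k e where "0 < k" "0 \<le> e" "k * laplacian (\<lambda>z. F z s) z
      = sqrt_lap s z + e"
      using lap[of s z] s W by force
    moreover have "laplacian (\<lambda>z. F z s) z \<le> 0"
      using cond s unfolding laplacian_condition_def by blast
    ultimately show "sqrt_lap s z \<le> 0"
      using mult_nonneg_nonpos[of k "laplacian (\<lambda>z. F z s) z"] by simp
  qed
  obtain s where s: "sX * sY / (sX + sY) < s" "s < sX" "0 < emeasure lebesgue {z. laplacian (\<lambda>z. F z s) z < 0}"
    using cond unfolding laplacian_condition_def by blast
  then obtain y where y: "laplacian (\<lambda>z. F z s) y < 0"
    by (cases "{z. laplacian (\<lambda>z. F z s) z < 0} = {}") auto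
  obtain k e where "0 < k" "0 \<le> e" "k * laplacian (\<lambda>z. F z s) y
      = sqrt_lap s y + e"
    using lap[of s y] s W by force
  then have "sqrt_lap s y < 0"
    using mult_pos_neg[OF _ y, of k] by simp
  with s show "\<exists>s y. sX * sY / (sX + sY) < s \<and> s < sX \<and>
      sqrt_lap s y < 0"
    by blast
qed

text \<open>The weak condition gives \<open>Delta m \<le> 0\<close>, and \<open>sqrt_lap\<close>
  subtracts a gradient term. Were there no strict point, the gradient would vanish at one
  \<open>s\<close>, so \<open>heat s f\<close> would be constant, and then \<open>f\<close> too
  almost everywhere.\<close>

lemma weak_laplacian_imp:
  fixes f :: "real^'m \<Rightarrow> real"
  assumes f: "heat_flow f T" "\<not> (\<exists>c. AE \<zeta> in lborel. f \<zeta> = c)" and s0: "0 < s0" "s0 < T"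
    and weak: "weak_laplacian_nonpos f"
  shows "superheat f T s0"
    and "\<exists>s y. s0 < s \<and> s < T \<and>
      heat_flow.sqrt_lap f s y < 0"
proof -
  interpret heat_flow f T by fact
  have nonzero: "\<not> (AE \<zeta> in lborel. f \<zeta> = 0)"
    using f(2) by blast
  have D2: "(\<Sum>b\<in>Basis. D2 s b z) \<le> 0" if "0 < s" "s < T" for s z
    by (rule weak_laplacian_imp_heat[OF f(1) weak that])
  have D1: "0 \<le> (\<Sum>b\<in>Basis. (D1 s b z)\<^sup>2) / (2 * heat s f z)" if "0 < s" "s < T" for s z
    using heat_pos[OF nonzero, of s z] that by (intro divide_nonneg_nonneg sum_nonneg) auto
  show "superheat f T s0"
  proof (intro superheat.intro f(1) superheat_axioms.intro s0 nonzero)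
    show "sqrt_lap s z \<le> 0" if "s0 < s" "s < T" for s z
      using D2[of s z] D1[of s z] that s0 unfolding sqrt_lap_eq by simp
  qed
  show "\<exists>s y. s0 < s \<and> s < T \<and> sqrt_lap s y < 0"
  proof (rule ccontr)
    assume no: "\<not> ?thesis"
    define s where "s = (s0 + T) / 2"
    have s: "s0 < s" "s < T" "0 < s"
      using s0 by (auto simp: s_def)
    have D10: "D1 s b y = 0" if b: "b \<in> Basis" for b y
    proof -
      have "\<not> sqrt_lap s y < 0"
        using no s by blast
      then have "(\<Sum>b\<in>Basis. (D1 s b y)\<^sup>2) / (2 * heat s f y) = 0"
        using D2[of s y] D1[of s y] s unfolding sqrt_lap_eq by linarith
      then have "(\<Sum>b\<in>Basis. (D1 s b y)\<^sup>2) = 0"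
        using heat_pos[OF nonzero, of s y] s by simp
      then show ?thesis
        using b by (simp add: sum_nonneg_eq_0_iff)
    qed
    have "AE x in lborel. f x = heat s f 0"
      using partials_zero_imp_const[OF heat_partials[OF s(3,2)] D10]
      by (intro heat_const_imp_const[OF D2 s(3,2)]) auto
    with f(2) show False
      by blast
  qed
qed

text \<open>The index type \<open>'m option\<close> carries the \<open>d\<close> coordinates, with
  \<open>None\<close> for the direction of \<open>a\<close>. A finite MRE risk lets the two risks be
  subtracted in \<open>risk_difference\<close>; the integrability hypothesis expresses that the
  marginal is finite at variance \<open>\<sigma>X2\<close>.\<close>

theorem corollary1:
  fixes a :: "real^('m::finite option)"
    and \<sigma>X2 \<sigma>Y2 :: real
    and L1 L2 :: "real \<Rightarrow> real"
    and H :: "real^('m option)^('m option)"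
    and H2 :: "real^('m option)^'m"
    and \<pi>\<^sub>0 :: "real^'m \<Rightarrow> real"
  defines "p \<equiv> (\<lambda>x \<theta>. mmn_density \<theta> a (mat \<sigma>X2) L1 x)"
    and "q \<equiv> (\<lambda>y \<theta>. mmn_density \<theta> a (mat \<sigma>Y2) L2 y)"
  assumes "4 \<le> CARD('m option)"
    and "a \<noteq> 0"
    and "0 < \<sigma>X2" and "0 < \<sigma>Y2"
    and "is_cdf L1" and "is_cdf L2"
    and "orthogonal_matrix H"
    and "row None H = (1 / norm a) *\<^sub>R a"
    and "\<And>i. row (Some i) H = row i H2"
    and "\<pi>\<^sub>0 \<in> borel_measurable borel"
    and "\<And>\<zeta>. 0 \<le> \<pi>\<^sub>0 \<zeta>"
    and "\<not> (\<exists>c. AE \<zeta> in lborel. \<pi>\<^sub>0 \<zeta> = c)"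
    and "\<And>z. integrable lborel (\<lambda>\<zeta>. mvn_density (mat \<sigma>X2) (z - \<zeta>) * \<pi>\<^sub>0 \<zeta>)"
    and "\<And>\<theta>. kl_risk p q \<theta> (mre_pred_density p q) < \<infinity>"
  shows
    "(laplacian_condition \<sigma>X2 \<sigma>Y2 (marginal_m \<pi>\<^sub>0) \<longrightarrow>
        dominates (kl_risk p q) (bayes_pred_density p q (\<lambda>\<theta>. \<pi>\<^sub>0 (H2 *v \<theta>)))
          (mre_pred_density p q)) \<and>
     (laplacian_condition \<sigma>X2 \<sigma>Y2 (\<lambda>z s. sqrt (marginal_m \<pi>\<^sub>0 z s)) \<longrightarrow>
        dominates (kl_risk p q) (bayes_pred_density p q (\<lambda>\<theta>. \<pi>\<^sub>0 (H2 *v \<theta>)))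
          (mre_pred_density p q)) \<and>
     (weak_laplacian_nonpos \<pi>\<^sub>0 \<longrightarrow>
        dominates (kl_risk p q) (bayes_pred_density p q (\<lambda>\<theta>. \<pi>\<^sub>0 (H2 *v \<theta>)))
          (mre_pred_density p q))"
proof -
  let ?dom = "dominates (kl_risk p q) (bayes_pred_density p q (\<lambda>\<theta>. \<pi>\<^sub>0 (H2 *v \<theta>))) (mre_pred_density p q)"
  interpret split: orthogonal_split H H2
    by (rule orthogonal_split.intro) fact+
  interpret M1: real_distribution "interval_measure L1"
    by (rule real_distribution_is_cdf) fact
  interpret M2: real_distribution "interval_measure L2"
    by (rule real_distribution_is_cdf) fact
  interpret model H H2 "interval_measure L1" "interval_measure L2" \<sigma>X2 \<sigma>Y2 a
  proof
    show "H2 *v a = 0"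
      by (rule split.H2_zero) fact+
  qed fact+
  have pq: "p = (\<lambda>x \<theta>. MX.dens (x - \<theta>))" "q = (\<lambda>y \<theta>. MY.dens (y - \<theta>))"
    using \<open>0 < \<sigma>X2\<close> \<open>0 < \<sigma>Y2\<close>
    by (simp_all add: p_def q_def mmn_density_def MX.dens_def MY.dens_def mvn_density_eq_gauss fun_eq_iff)
  interpret heat_flow \<pi>\<^sub>0 \<sigma>X2
  proof
    show "integrable lborel (\<lambda>x. gauss \<sigma>X2 (z - x) * \<pi>\<^sub>0 x)" for z
      using assms(15)[of z] \<open>0 < \<sigma>X2\<close> by (simp add: mvn_density_eq_gauss)
  qed fact+
  have nonzero: "\<not> (AE \<zeta> in lborel. \<pi>\<^sub>0 \<zeta> = 0)"
    using assms(14) by blast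
  have m: "marginal_m \<pi>\<^sub>0 z s = heat s \<pi>\<^sub>0 z" if "0 < s" for z s
    using that by (simp add: marginal_m_def heat_def mvn_density_eq_gauss)
  have concl: ?dom
    if "superheat \<pi>\<^sub>0 \<sigma>X2 (\<sigma>X2 * \<sigma>Y2 / (\<sigma>X2 + \<sigma>Y2))"
      "\<exists>s y. \<sigma>X2 * \<sigma>Y2 / (\<sigma>X2 + \<sigma>Y2) < s \<and> s < \<sigma>X2 \<and>
        sqrt_lap s y < 0"
    using that dominates_mre[OF _ _ _ _ assms(16)[unfolded pq]] unfolding pq sW_def[symmetric] by blast
  show ?thesis
  proof (intro conjI impI)
    assume cond: "laplacian_condition \<sigma>X2 \<sigma>Y2 (marginal_m \<pi>\<^sub>0)"
    \<comment> \<open>Here \<open>k = 1\<close>, and \<open>e\<close> is the gradient term by which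
      \<open>Delta m\<close> exceeds \<open>sqrt_lap\<close>.\<close>
    have lap: "\<exists>k>0. \<exists>e\<ge>0. k * laplacian (\<lambda>z. marginal_m \<pi>\<^sub>0 z s) z
        = sqrt_lap s z + e" if s: "0 < s" "s < \<sigma>X2" for s z
    proof (intro exI conjI)
      show "0 \<le> (\<Sum>b\<in>Basis. (D1 s b z)\<^sup>2) / (2 * heat s \<pi>\<^sub>0 z)"
        using heat_pos[OF nonzero, of s z] s by (intro divide_nonneg_nonneg sum_nonneg) auto
      show "1 * laplacian (\<lambda>z. marginal_m \<pi>\<^sub>0 z s) z = sqrt_lap s z
          + (\<Sum>b\<in>Basis. (D1 s b z)\<^sup>2) / (2 * heat s \<pi>\<^sub>0 z)"
        using s laplacian_eq[OF heat_partials[OF s], of z] by (simp add: m sqrt_lap_eq)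
    qed simp
    show ?dom
      using laplacian_condition_imp[OF heat_flow_axioms nonzero assms(5,6) cond lap] by (rule concl)
  next
    assume cond: "laplacian_condition \<sigma>X2 \<sigma>Y2 (\<lambda>z s. sqrt (marginal_m \<pi>\<^sub>0 z s))"
    \<comment> \<open>Here \<open>k = 2 * sqrt m\<close> and \<open>e = 0\<close>, by the formula
      for the Laplacian of a square root.\<close>
    have lap: "\<exists>k>0. \<exists>e\<ge>0. k * laplacian (\<lambda>z. sqrt (marginal_m \<pi>\<^sub>0 z s)) z
        = sqrt_lap s z + e" if s: "0 < s" "s < \<sigma>X2" for s z
    proof (intro exI conjI)
      have hp: "0 < heat s \<pi>\<^sub>0 z" for z
        using s by (intro heat_pos[OF nonzero]) auto
      show "0 < 2 * sqrt (heat s \<pi>\<^sub>0 z)"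
        using hp by simp
      show "2 * sqrt (heat s \<pi>\<^sub>0 z) * laplacian (\<lambda>z. sqrt (marginal_m \<pi>\<^sub>0 z s)) z
          = sqrt_lap s z + 0"
        using s hp[of z] laplacian_eq[OF has_partials_sqrt[OF heat_partials[OF s] hp], of z]
        by (simp add: m sum_divide_distrib[symmetric] less_imp_neq[symmetric])
    qed simp
    show ?dom
      using laplacian_condition_imp[OF heat_flow_axioms nonzero assms(5,6) cond lap] by (rule concl)
  next
    assume "weak_laplacian_nonpos \<pi>\<^sub>0"
    from weak_laplacian_imp[OF heat_flow_axioms assms(14) _ _ this]
    show ?dom
      using pos unfolding sW_def by (intro concl) auto
  qed
qed

end
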